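(* Let $f:\mathbb{N}\to[0,\infty)$ be any nonnegative function satisfying $f(n)\to\infty$ and $f(n)=o(n^{1/3})$ as $n\to\infty$. Then there exists a sequence $(\beta_n)$ with $\beta_n\to1^-$ (i.e., converging to $1$ from below) such that for all but finitely many $n$, $$\mathbb{E}\,\big\|\mathrm{cov}(\mu_{\beta_n,n})\big\|_{\mathrm{op}}\ge f(n),$$ where $\mu_{\beta,n}$ denotes the Sherrington--Kirkpatrick Gibbs measure on $\{-1,+1\}^n$ at inverse temperature $\beta$ with no external field.
   Context: Let $(g_{ij})_{1\le i<j\le n}$ be i.i.d. standard Gaussian $N(0,1)$ random variables (the disorder), and let $\beta \ge 0$. The Sherrington--Kirkpatrick Gibbs measure (no external field) is the random probability measure on $\{-1,+1\}^n$ $$\mu_{\beta,n}(\sigma) = \frac{1}{Z}\exp\Big\{\frac{\beta}{\sqrt{n}}\sum_{i<j} g_{ij}\sigma_i\sigma_j\Big\},\qquad \sigma\in\{-1,+1\}^n,$$ with $Z$ the normalizing constant. The bracket $\langle\cdot\rangle$ denotes the average with respect to $\mu_{\beta,n}$ (for fixed disorder). The covariance matrix is the $n\times n$ random matrix $\mathrm{cov}(\mu_{\beta,n})$ with entries $(\mathrm{cov}(\mu_{\beta,n}))_{ij} = \langle \sigma_i\sigma_j\rangle$ for $i,j\in\{1,\dots,n\}$ (the mean is zero by symmetry). $\|\cdot\|_{\mathrm{op}}$ is the operator (spectral) norm, and $\mathbb{E}$ is the expectation over the disorder $(g_{ij})$. *)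

theory Defs
  imports "HOL-Probability.Probability"
begin

definition sk_pairs :: "nat \<Rightarrow> (nat \<times> nat) set" where
  "sk_pairs n = {(i, j). 1 \<le> i \<and> i < j \<and> j \<le> n}"

definition sk_disorder :: "'a measure \<Rightarrow> nat \<Rightarrow> (nat \<Rightarrow> nat \<Rightarrow> 'a \<Rightarrow> real) \<Rightarrow> bool" where
  "sk_disorder M n g \<longleftrightarrow>
     prob_space M \<and>
     prob_space.indep_vars M (\<lambda>_. borel) (\<lambda>(i, j). g i j) (sk_pairs n) \<and>
     (\<forall>(i, j) \<in> sk_pairs n. distributed M lborel (g i j) (\<lambda>x. ennreal (std_normal_density x)))"

(* The cube {-1,+1}^n: functions on {1..n}, made unique by the value undefined elsewhere. *)
definition spins :: "nat \<Rightarrow> (nat \<Rightarrow> real) set" where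
  "spins n = {1..n} \<rightarrow>\<^sub>E {-1, 1}"

definition sk_weight :: "real \<Rightarrow> nat \<Rightarrow> (nat \<Rightarrow> nat \<Rightarrow> real) \<Rightarrow> (nat \<Rightarrow> real) \<Rightarrow> real" where
  "sk_weight \<beta> n w \<sigma> = exp (\<beta> / sqrt (real n) * (\<Sum>(i, j) \<in> sk_pairs n. w i j * \<sigma> i * \<sigma> j))"

definition sk_partition :: "real \<Rightarrow> nat \<Rightarrow> (nat \<Rightarrow> nat \<Rightarrow> real) \<Rightarrow> real" where
  "sk_partition \<beta> n w = (\<Sum>\<sigma> \<in> spins n. sk_weight \<beta> n w \<sigma>)"

definition sk_gibbs :: "real \<Rightarrow> nat \<Rightarrow> (nat \<Rightarrow> nat \<Rightarrow> real) \<Rightarrow> (nat \<Rightarrow> real) measure" where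
  "sk_gibbs \<beta> n w =
     point_measure (spins n) (\<lambda>\<sigma>. ennreal (sk_weight \<beta> n w \<sigma> / sk_partition \<beta> n w))"

(* The mean of the Gibbs measure vanishes by the symmetry of the weights under negation of
   the spins (lemma sk_gibbs_mean below), so no product of means is subtracted. *)
definition sk_cov :: "real \<Rightarrow> nat \<Rightarrow> (nat \<Rightarrow> nat \<Rightarrow> real) \<Rightarrow> nat \<Rightarrow> nat \<Rightarrow> real" where
  "sk_cov \<beta> n w i j = (\<integral>\<sigma>. \<sigma> i * \<sigma> j \<partial>sk_gibbs \<beta> n w)"

(* Euclidean operator norm of the n x n matrix (A i j), 1 \<le> i, j \<le> n. Matrices are functions
   because the dimension n varies within the statement. Only the entries of v with index in
   {1..n} matter. *)
definition op_norm :: "nat \<Rightarrow> (nat \<Rightarrow> nat \<Rightarrow> real) \<Rightarrow> real" where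
  "op_norm n A =
     (SUP v \<in> {v :: nat \<Rightarrow> real. L2_set v {1..n} \<le> 1}.
        L2_set (\<lambda>i. \<Sum>j = 1..n. A i j * v j) {1..n})"

lemma finite_spins: "finite (spins n)"
  unfolding spins_def by (intro finite_PiE) auto

lemma spins_nonempty: "spins n \<noteq> {}"
  unfolding spins_def by (simp add: PiE_eq_empty_iff)

lemma sk_weight_pos: "0 < sk_weight \<beta> n w \<sigma>"
  by (simp add: sk_weight_def)

lemma sk_partition_pos: "0 < sk_partition \<beta> n w"
  unfolding sk_partition_def
  by (intro sum_pos finite_spins spins_nonempty sk_weight_pos)

lemma integral_sk_gibbs:
  fixes h :: "(nat \<Rightarrow> real) \<Rightarrow> real"
  shows "(\<integral>\<sigma>. h \<sigma> \<partial>sk_gibbs \<beta> n w) =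
    (\<Sum>\<sigma> \<in> spins n. h \<sigma> * sk_weight \<beta> n w \<sigma>) / sk_partition \<beta> n w"
  unfolding sk_gibbs_def
  by (subst lebesgue_integral_point_measure_finite)
     (auto simp: finite_spins sum_divide_distrib mult.commute
           sk_weight_pos sk_partition_pos less_imp_le)

lemma prob_space_sk_gibbs: "prob_space (sk_gibbs \<beta> n w)"
proof
  have "emeasure (sk_gibbs \<beta> n w) (space (sk_gibbs \<beta> n w)) =
      (\<Sum>\<sigma> \<in> spins n. ennreal (sk_weight \<beta> n w \<sigma> / sk_partition \<beta> n w))"
    unfolding sk_gibbs_def
    by (simp add: space_point_measure emeasure_point_measure_finite finite_spins)
  also have "\<dots> = ennreal (\<Sum>\<sigma> \<in> spins n. sk_weight \<beta> n w \<sigma> / sk_partition \<beta> n w)"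
    by (intro sum_ennreal divide_nonneg_nonneg less_imp_le sk_weight_pos sk_partition_pos)
  also have "\<dots> = 1"
    using sk_partition_pos[of \<beta> n w]
    by (simp add: sum_divide_distrib[symmetric] sk_partition_def)
  finally show "emeasure (sk_gibbs \<beta> n w) (space (sk_gibbs \<beta> n w)) = 1" .
qed

lemma sk_gibbs_mean:
  assumes "i \<in> {1..n}"
  shows "(\<integral>\<sigma>. \<sigma> i \<partial>sk_gibbs \<beta> n w) = 0"
proof -
  define N :: "(nat \<Rightarrow> real) \<Rightarrow> nat \<Rightarrow> real"
    where "N \<sigma> = (\<lambda>k. if k \<in> {1..n} then - \<sigma> k else undefined)" for \<sigma>
  have N_spins: "N \<sigma> \<in> spins n" if "\<sigma> \<in> spins n" for \<sigma>
    using that by (fastforce simp: spins_def N_def PiE_iff extensional_def)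
  have NN: "N (N \<sigma>) = \<sigma>" if "\<sigma> \<in> spins n" for \<sigma>
    using that by (auto simp: spins_def N_def PiE_iff extensional_def fun_eq_iff)
  have weight: "sk_weight \<beta> n w (N \<sigma>) = sk_weight \<beta> n w \<sigma>" for \<sigma>
  proof -
    have "(\<Sum>(i, j) \<in> sk_pairs n. w i j * N \<sigma> i * N \<sigma> j) =
        (\<Sum>(i, j) \<in> sk_pairs n. w i j * \<sigma> i * \<sigma> j)"
      by (rule sum.cong) (auto simp: sk_pairs_def N_def)
    then show ?thesis by (simp add: sk_weight_def)
  qed
  have "(\<Sum>\<sigma> \<in> spins n. \<sigma> i * sk_weight \<beta> n w \<sigma>) =
      (\<Sum>\<sigma> \<in> spins n. - (\<sigma> i * sk_weight \<beta> n w \<sigma>))"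
    by (rule sum.reindex_bij_witness[of _ N N])
       (use assms in \<open>auto simp: N_spins NN weight\<close>, auto simp: N_def)
  then have "(\<Sum>\<sigma> \<in> spins n. \<sigma> i * sk_weight \<beta> n w \<sigma>) = 0"
    by (simp add: sum_negf)
  then show ?thesis by (simp add: integral_sk_gibbs)
qed

end

theory Submission
  imports Defs "HOL-Real_Asymp.Real_Asymp" "Jordan_Normal_Form.Determinant"
begin

text \<open>
  Let \<open>G\<close> be the symmetric matrix with entries \<open>g\<^sub>i\<^sub>j / sqrt n\<close> and zero diagonal, \<open>M\<close> the Gibbs
  covariance, \<open>z = 2 + i \<eta>\<close>, \<open>Q = (z - G)\<^sup>-\<^sup>1\<close> and \<open>m = E tr Q / n\<close>. In the Gaussian integration by
  parts of \<open>E tr (G Q M)\<close> no four-point function appears: the derivative of \<open>M\<^sub>a\<^sub>i\<close> in the direction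
  \<open>ij\<close> shares the index \<open>i\<close>, and \<open>\<sigma>\<^sub>i\<^sup>2 = 1\<close> collapses it to \<open>\<beta> (M\<^sub>a\<^sub>j - M\<^sub>a\<^sub>i M\<^sub>i\<^sub>j)\<close>. Hence
  \<open>(z - \<beta> - m) E tr (Q M) / n = 1 + \<epsilon>\<close>, where \<open>\<epsilon>\<close> is controlled by the variance of \<open>tr Q\<close> (Gaussian
  Poincare inequality) and by \<open>E tr M\<^sup>2 \<le> n E op_norm M\<close>; it is small when \<open>n \<eta>\<^sup>3\<close> is large, unless
  \<open>E op_norm M\<close> already exceeds \<open>1 / \<eta>\<close>. The same computation without \<open>M\<close> gives
  \<open>m\<^sup>2 - z m + 1 \<approx> 0\<close>, so for \<open>1 - \<beta> \<le> sqrt \<eta>\<close> the factor \<open>z - \<beta> - m\<close> has modulus and imaginary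
  part of order \<open>sqrt \<eta>\<close>, and \<open>- Im E tr (Q M) / n\<close> is at least of order \<open>1 / sqrt \<eta>\<close>. On the other
  hand \<open>- Im Q\<close> is positive, so \<open>- Im tr (Q M) / n \<le> op_norm M * (- Im tr Q / n)\<close>, and \<open>- Im tr Q / n\<close> is
  of order \<open>sqrt \<eta>\<close>. Therefore \<open>E op_norm M\<close> is at least of order \<open>1 / \<eta>\<close>; take
  \<open>\<eta> = 1 / (512 f n)\<close> and \<open>\<beta>\<^sub>n = 1 - 1 / (n + 1)\<close>.
\<close>

section \<open>Gaussian integration by parts and the Poincare inequality\<close>

text \<open>The point 2 is the edge of the limiting spectrum of \<open>G\<close>. There m = 1 is a
  double root of m^2 - 2 m + 1, so at \<beta> = 1 the factor z - \<beta> - m degenerates. This makes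
  E tr (Q M) / n large, but it also leaves little room for errors: the one in the equation for m has
  to be small against \<eta>, the one called \<epsilon> only against 1.

  The exponent 1/3 comes from the covariance of tr Q and tr (Q M). The Poincare inequality gives tr
  Q a standard deviation of at most 2 / \<eta>^2, whatever n is, while |tr (Q M)| \<le> n / \<eta>;
  after division by n^2 the product is 2 / (n \<eta>^3). The bound n / \<eta> requires no control of
  the operator norm, since M is the Gibbs average of the rank one matrices \<sigma> \<sigma>^T and
  |\<sigma>|^2 = n.

  The constant is 512 = 2 * 64 * 4: the quantity - Im E tr (Q M) / n is at least 1 / (64 sqrt
  \<eta>), half of this pays for the fluctuations of Im tr Q, and 4 sqrt \<eta> bounds - Im tr Q / n
  away from a rare event.\<close>

definition std_gauss :: "real measure" where
  "std_gauss = density lborel (\<lambda>x. ennreal (std_normal_density x))"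

lemma sets_std_gauss [simp, measurable_cong]: "sets std_gauss = sets borel"
  by (simp add: std_gauss_def)

lemma space_std_gauss [simp]: "space std_gauss = UNIV"
  by (simp add: std_gauss_def)

lemma prob_space_std_gauss: "prob_space std_gauss"
  unfolding std_gauss_def by (rule prob_space_normal_density) simp

lemma integral_std_gauss:
  fixes f :: "real \<Rightarrow> 'b::{banach, second_countable_topology}"
  assumes "f \<in> borel_measurable borel"
  shows "(\<integral>x. f x \<partial>std_gauss) = (\<integral>x. std_normal_density x *\<^sub>R f x \<partial>lborel)"
  unfolding std_gauss_def by (rule integral_density) (use assms in auto)

lemma integrable_std_gauss:
  fixes f :: "real \<Rightarrow> 'b::{banach, second_countable_topology}"
  assumes "f \<in> borel_measurable borel"
  shows "integrable std_gauss f \<longleftrightarrow> integrable lborel (\<lambda>x. std_normal_density x *\<^sub>R f x)"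
  unfolding std_gauss_def by (rule integrable_density) (use assms in auto)

lemma integrable_std_gauss_quadratic:
  fixes f :: "real \<Rightarrow> 'b::{banach, second_countable_topology}"
  assumes meas: "f \<in> borel_measurable borel" and bound: "\<And>x. norm (f x) \<le> a + b * x\<^sup>2"
  shows "integrable std_gauss f"
proof (rule Bochner_Integration.integrable_bound)
  show "integrable std_gauss (\<lambda>x. a + b * x\<^sup>2)"
  proof -
    have "integrable lborel (\<lambda>x. a * (std_normal_density x * x ^ 0) + b * (std_normal_density x * x ^ 2))"
      by (intro Bochner_Integration.integrable_add integrable_mult_right integrable_std_normal_moment)
    then show ?thesis
      by (subst integrable_std_gauss) (auto simp: algebra_simps)
  qed
  show "AE x in std_gauss. norm (f x) \<le> norm (a + b * x\<^sup>2)"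
    using bound by (intro AE_I2) (smt (verit) real_norm_def)
qed (use meas in \<open>auto simp: std_gauss_def\<close>)

lemma linear_growth_of_bounded_derivative:
  fixes H H' :: "real \<Rightarrow> 'b::euclidean_space"
  assumes "\<And>x. (H has_vector_derivative H' x) (at x)" and "\<And>x. norm (H' x) \<le> b"
  shows "norm (H x) \<le> norm (H 0) + b * \<bar>x\<bar>"
proof -
  have "norm (H x - H 0) \<le> b * norm (x - 0)"
  proof (rule differentiable_bound[of UNIV H "\<lambda>x h. h *\<^sub>R H' x"])
    show "onorm (\<lambda>h. h *\<^sub>R H' x) \<le> b" for x
      using mult_right_mono[OF assms(2)[of x], of "\<bar>h\<bar>" for h]
      by (intro onorm_bound order_trans[OF norm_ge_zero assms(2)]) (simp add: mult.commute)
  qed (use assms(1) in \<open>auto simp: has_vector_derivative_def\<close>)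
  then show ?thesis
    using norm_triangle_ineq[of "H x - H 0" "H 0"] by simp
qed

text \<open>With \<phi> the Gaussian density, \<phi>' = - x \<phi>, so \<open>K\<close> = \<phi> H
  has the derivative \<phi> H' - x \<phi> H. A bounded \<open>H'\<close> makes \<open>H\<close> grow
  at most linearly; hence \<open>K\<close> vanishes at both infinities and its derivative integrates
  to 0. Euclidean values cover the complex case needed for resolvents.\<close>

lemma stein_identity:
  fixes H H' :: "real \<Rightarrow> 'b::euclidean_space"
  assumes deriv: "\<And>x. (H has_vector_derivative H' x) (at x)"
    and cont: "continuous_on UNIV H'" and bound: "\<And>x. norm (H' x) \<le> b"
  shows "(\<integral>x. x *\<^sub>R H x \<partial>std_gauss) = (\<integral>x. H' x \<partial>std_gauss)"
proof -
  let ?\<phi> = std_normal_density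
  have contH: "continuous_on UNIV H"
    using deriv has_vector_derivative_continuous continuous_at_imp_continuous_on by blast
  have [measurable]: "H \<in> borel_measurable borel" "H' \<in> borel_measurable borel"
    using contH cont by (auto intro: borel_measurable_continuous_onI)
  have b0: "0 \<le> b" using bound[of 0] norm_ge_zero order_trans by blast
  define a where "a = norm (H 0)"
  have Hbd: "norm (H x) \<le> a + b * \<bar>x\<bar>" for x
    unfolding a_def by (rule linear_growth_of_bounded_derivative[OF deriv bound])
  have intH': "integrable std_gauss H'"
    by (rule integrable_std_gauss_quadratic[where a = b and b = 0]) (use bound in auto)
  have intxH: "integrable std_gauss (\<lambda>x. x *\<^sub>R H x)"
  proof (rule integrable_std_gauss_quadratic[where a = a and b = "a + b"])
    fix x :: real
    have "norm (x *\<^sub>R H x) \<le> \<bar>x\<bar> * (a + b * \<bar>x\<bar>)"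
      using Hbd[of x] by (simp add: mult_left_mono)
    also have "\<dots> = a * \<bar>x\<bar> + b * x\<^sup>2"
      by (simp add: algebra_simps power2_eq_square)
    also have "a * \<bar>x\<bar> \<le> a * (1 + x\<^sup>2)"
    proof (rule mult_left_mono)
      have "0 \<le> (\<bar>x\<bar> - 1)\<^sup>2" "0 \<le> x\<^sup>2" by simp_all
      then show "\<bar>x\<bar> \<le> 1 + x\<^sup>2" by (simp add: power2_diff)
    qed (simp add: a_def)
    finally show "norm (x *\<^sub>R H x) \<le> a + (a + b) * x\<^sup>2" by (simp add: algebra_simps)
  qed simp
  define K where "K x = ?\<phi> x *\<^sub>R H x" for x
  define K' where "K' x = ?\<phi> x *\<^sub>R H' x - ?\<phi> x *\<^sub>R (x *\<^sub>R H x)" for x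
  have \<phi>_deriv: "(?\<phi> has_real_derivative (- x * ?\<phi> x)) (at x)" for x
    unfolding std_normal_density_def
    by (auto intro!: derivative_eq_intros simp: field_simps)
  have K_deriv: "(K has_vector_derivative K' x) (at x)" for x
  proof -
    have "(K has_vector_derivative (?\<phi> x *\<^sub>R H' x + (- x * ?\<phi> x) *\<^sub>R H x)) (at x)"
      unfolding K_def by (rule has_vector_derivative_scaleR[OF \<phi>_deriv deriv])
    then show ?thesis by (simp add: K'_def mult.commute)
  qed
  have cont\<phi>: "continuous_on UNIV ?\<phi>"
    using \<phi>_deriv DERIV_isCont continuous_at_imp_continuous_on by blast
  have contK': "continuous_on UNIV K'"
    unfolding K'_def by (intro continuous_intros cont\<phi> cont contH)
  have int1: "integrable lborel (\<lambda>x. ?\<phi> x *\<^sub>R H' x)"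
    using intH' by (subst (asm) integrable_std_gauss) auto
  have int2: "integrable lborel (\<lambda>x. ?\<phi> x *\<^sub>R (x *\<^sub>R H x))"
    using intxH by (subst (asm) integrable_std_gauss) auto
  have intK': "integrable lborel K'"
    unfolding K'_def by (intro Bochner_Integration.integrable_diff int1 int2)
  have dom: "norm (K x) \<le> ?\<phi> x * (a + b * \<bar>x\<bar>)" for x
    unfolding K_def by (simp add: mult_left_mono[OF Hbd])
  have top: "((\<lambda>x. ?\<phi> x * (a + b * \<bar>x\<bar>)) \<longlongrightarrow> 0) at_top"
  proof -
    have "((\<lambda>x. (1 / sqrt (2 * pi)) * exp (- x\<^sup>2 / 2) * (a + b * x)) \<longlongrightarrow> 0) at_top"
      by real_asymp
    moreover have "\<forall>\<^sub>F x in at_top. (1 / sqrt (2 * pi)) * exp (- x\<^sup>2 / 2) * (a + b * x) = ?\<phi> x * (a + b * \<bar>x\<bar>)"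
      using eventually_ge_at_top[of 0] by eventually_elim (simp add: std_normal_density_def)
    ultimately show ?thesis by (rule Lim_transform_eventually)
  qed
  have bot: "((\<lambda>x. ?\<phi> x * (a + b * \<bar>x\<bar>)) \<longlongrightarrow> 0) at_bot"
    unfolding filterlim_at_bot_mirror using top by (simp add: std_normal_density_def)
  have Ktop: "(K \<longlongrightarrow> 0) at_top" by (rule Lim_null_comparison[OF _ top]) (use dom in auto)
  have Kbot: "(K \<longlongrightarrow> 0) at_bot" by (rule Lim_null_comparison[OF _ bot]) (use dom in auto)
  have "(LBINT x=-\<infinity>..\<infinity>. K' x) = 0 - 0"
  proof (rule interval_integral_FTC_integrable)
    show "((K \<circ> real_of_ereal) \<longlongrightarrow> 0) (at_right (-\<infinity>))"
      using Kbot by (simp add: ereal_tendsto_simps)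
    show "((K \<circ> real_of_ereal) \<longlongrightarrow> 0) (at_left \<infinity>)"
      using Ktop by (simp add: ereal_tendsto_simps)
    show "set_integrable lborel (einterval (-\<infinity>) \<infinity>) K'"
      using intK' by (simp add: einterval_def set_integrable_def)
  qed (use K_deriv contK' in \<open>auto simp: continuous_on_eq_continuous_at\<close>)
  then have "integral\<^sup>L lborel K' = 0"
    by (simp add: interval_lebesgue_integral_def set_lebesgue_integral_def einterval_def)
  then have "(\<integral>x. ?\<phi> x *\<^sub>R H' x \<partial>lborel) = (\<integral>x. ?\<phi> x *\<^sub>R (x *\<^sub>R H x) \<partial>lborel)"
    unfolding K'_def using int1 int2 by (simp add: Bochner_Integration.integral_diff)
  then show ?thesis
    by (simp add: integral_std_gauss)
qed

text \<open>Chernoff's argument: $(f(x) - f(0))^2 \le x H(x)$ for the primitive $H$ of $f'^2$ that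
  vanishes at $0$, and Stein's identity evaluates the mean of $x H(x)$.\<close>

lemma gaussian_poincare_at_0:
  fixes f f' :: "real \<Rightarrow> real"
  assumes deriv: "\<And>x. (f has_real_derivative f' x) (at x)"
    and cont: "continuous_on UNIV f'" and bound: "\<And>x. \<bar>f' x\<bar> \<le> b"
  shows "(\<integral>x. (f x - f 0)\<^sup>2 \<partial>std_gauss) \<le> (\<integral>x. (f' x)\<^sup>2 \<partial>std_gauss)"
proof -
  have "\<exists>F. \<forall>x :: real. -\<infinity> < ereal x \<longrightarrow> ereal x < \<infinity> \<longrightarrow> (F has_vector_derivative (f' x)\<^sup>2) (at x)"
    by (rule einterval_antiderivative)
       (use cont in \<open>auto simp: continuous_on_eq_continuous_at intro!: continuous_intros\<close>)
  then obtain F where F: "\<And>x :: real. (F has_vector_derivative (f' x)\<^sup>2) (at x)" by auto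
  define H where "H x = F x - F 0" for x
  have H: "(H has_vector_derivative (f' x)\<^sup>2) (at x)" for x
    unfolding H_def using has_vector_derivative_diff[OF F[of x] has_vector_derivative_const] by simp
  have Hd: "(H has_real_derivative (f' x)\<^sup>2) (at x)" for x
    using H by (simp add: has_real_derivative_iff_has_vector_derivative)
  have b: "(f' x)\<^sup>2 \<le> b\<^sup>2" for x using bound[of x] by (simp add: abs_le_square_iff[symmetric])
  have stein: "(\<integral>x. x *\<^sub>R H x \<partial>std_gauss) = (\<integral>x. (f' x)\<^sup>2 \<partial>std_gauss)"
    by (rule stein_identity[where b = "b\<^sup>2"]) (use H cont b in \<open>auto intro!: continuous_intros\<close>)
  have pw: "(f x - f 0)\<^sup>2 \<le> x * H x" for x
  proof (cases "x = 0")
    case False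
    define d where "d = (f x - f 0) / x"
    \<comment> \<open>Cauchy-Schwarz by monotonicity: \<open>d\<close> is the mean slope and g' =
      (f' - d)^2, so \<open>g\<close> is nondecreasing. Multiplying its increment by
      \<open>x\<close> treats both signs of \<open>x\<close> at once.\<close>
    define g where "g t = H t - 2 * d * f t + d\<^sup>2 * t" for t
    have gd: "(g has_real_derivative (f' t - d)\<^sup>2) (at t)" for t
      unfolding g_def by (rule derivative_eq_intros Hd deriv refl)+ (simp add: power2_eq_square algebra_simps)
    have mono: "g s \<le> g t" if "s \<le> t" for s t
      by (rule DERIV_nonneg_imp_nondecreasing[OF that]) (use gd in \<open>auto intro!: exI\<close>)
    have gx: "g x - g 0 = H x - d\<^sup>2 * x"
      using False by (simp add: g_def H_def d_def field_simps power2_eq_square)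
    have "0 \<le> x * (g x - g 0)"
      using mono[of 0 x] mono[of x 0] linear[of 0 x] by (auto simp: zero_le_mult_iff)
    then have "d\<^sup>2 * x\<^sup>2 \<le> x * H x" unfolding gx by (simp add: algebra_simps power2_eq_square)
    moreover have "d\<^sup>2 * x\<^sup>2 = (f x - f 0)\<^sup>2" using False by (simp add: d_def field_simps)
    ultimately show ?thesis by simp
  qed (simp add: H_def)
  have contf: "continuous_on UNIV f"
    using deriv DERIV_isCont continuous_at_imp_continuous_on by blast
  have contH: "continuous_on UNIV H"
    using Hd DERIV_isCont continuous_at_imp_continuous_on by blast
  have Hbd: "\<bar>H x\<bar> \<le> b\<^sup>2 * \<bar>x\<bar>" for x
    using linear_growth_of_bounded_derivative[OF H, of "b\<^sup>2" x] b by (simp add: H_def)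
  have xH: "x * H x \<le> b\<^sup>2 * x\<^sup>2" "\<bar>x * H x\<bar> \<le> b\<^sup>2 * x\<^sup>2" for x
    using mult_left_mono[OF Hbd[of x], of "\<bar>x\<bar>"]
    by (auto simp: abs_mult power2_eq_square algebra_simps intro: order_trans[OF abs_ge_self])
  have "(\<integral>x. (f x - f 0)\<^sup>2 \<partial>std_gauss) \<le> (\<integral>x. x * H x \<partial>std_gauss)"
  proof (rule integral_mono)
    show "integrable std_gauss (\<lambda>x. (f x - f 0)\<^sup>2)"
      by (rule integrable_std_gauss_quadratic[where a = 0 and b = "b\<^sup>2"])
         (use contf xH pw in \<open>auto intro!: borel_measurable_continuous_onI continuous_intros intro: order_trans\<close>)
    show "integrable std_gauss (\<lambda>x. x * H x)"
      by (rule integrable_std_gauss_quadratic[where a = 0 and b = "b\<^sup>2"])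
         (use contH xH in \<open>auto intro!: borel_measurable_continuous_onI continuous_intros\<close>)
  qed (use pw in auto)
  with stein show ?thesis by simp
qed

lemma (in prob_space) variance_decomposition:
  fixes f :: "'a \<Rightarrow> real"
  assumes "integrable M f" and "integrable M (\<lambda>x. (f x)\<^sup>2)"
  shows "(\<integral>x. (f x - c)\<^sup>2 \<partial>M) = (\<integral>x. (f x - expectation f)\<^sup>2 \<partial>M) + (expectation f - c)\<^sup>2"
proof -
  have *: "(\<integral>x. (f x - a)\<^sup>2 \<partial>M) = (\<integral>x. (f x)\<^sup>2 \<partial>M) - 2 * a * expectation f + a\<^sup>2" for a
  proof -
    have "(\<lambda>x. (f x - a)\<^sup>2) = (\<lambda>x. (f x)\<^sup>2 - 2 * a * f x + a\<^sup>2)"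
      by (auto simp: power2_diff)
    then show ?thesis using assms by (simp add: prob_space)
  qed
  show ?thesis unfolding * by (simp add: power2_eq_square algebra_simps)
qed

lemma (in prob_space) square_expectation_le:
  fixes f :: "'a \<Rightarrow> real"
  assumes "integrable M f" and "integrable M (\<lambda>x. (f x)\<^sup>2)"
  shows "(expectation f)\<^sup>2 \<le> (\<integral>x. (f x)\<^sup>2 \<partial>M)"
  using variance_decomposition[OF assms, of 0] by (simp add: integral_nonneg_AE)

lemma (in prob_space) integrable_bounded:
  fixes f :: "'a \<Rightarrow> 'b::{banach, second_countable_topology}"
  assumes "f \<in> borel_measurable M" and "\<And>x. norm (f x) \<le> B"
  shows "integrable M f"
  by (rule integrable_const_bound[where B = B]) (use assms in auto)

lemma (in prob_space) norm_expectation_le: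
  fixes f :: "'a \<Rightarrow> 'b::{banach, second_countable_topology}"
  assumes "f \<in> borel_measurable M" and "\<And>x. norm (f x) \<le> B"
  shows "norm (expectation f) \<le> B"
proof -
  have "norm (expectation f) \<le> (\<integral>x. norm (f x) \<partial>M)" by (rule integral_norm_bound)
  also have "\<dots> \<le> (\<integral>x. B \<partial>M)"
    by (rule integral_mono) (use assms in \<open>auto intro!: integrable_bounded[where B = B]\<close>)
  finally show ?thesis by (simp add: prob_space)
qed

section \<open>Products of the standard Gaussian measure\<close>

abbreviation gauss_prod :: "'i set \<Rightarrow> ('i \<Rightarrow> real) measure" where
  "gauss_prod J \<equiv> Pi\<^sub>M J (\<lambda>_. std_gauss)"

interpretation std_gauss: prob_space std_gauss
  by (rule prob_space_std_gauss)

interpretation gauss_prod: product_prob_space "\<lambda>_ :: 'i. std_gauss" UNIV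
  by unfold_locales

lemma prob_space_gauss_prod: "prob_space (gauss_prod J)"
  by (rule prob_space_PiM) (rule prob_space_std_gauss)

lemma measurable_gauss_prod_upd:
  "(\<lambda>(x, y). x(k := y)) \<in> measurable (gauss_prod I \<Otimes>\<^sub>M std_gauss) (gauss_prod (insert k I))"
  by (rule measurable_add_dim)

lemma borel_measurable_gauss_prod_upd:
  assumes "F \<in> borel_measurable (gauss_prod (insert k I))"
  shows "(\<lambda>(x, y). F (x(k := y))) \<in> borel_measurable (gauss_prod I \<Otimes>\<^sub>M std_gauss)"
  using measurable_compose[OF measurable_gauss_prod_upd assms] by (simp add: case_prod_beta')

lemma borel_measurable_gauss_prod_upd1:
  assumes "F \<in> borel_measurable (gauss_prod (insert k I))" and "x \<in> space (gauss_prod I)"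
  shows "(\<lambda>y. F (x(k := y))) \<in> borel_measurable std_gauss"
  using measurable_compose[OF measurable_Pair1'[OF assms(2)] borel_measurable_gauss_prod_upd[OF assms(1)]]
  by simp

lemma borel_measurable_gauss_prod_avg:
  fixes F :: "('i \<Rightarrow> real) \<Rightarrow> 'b::{banach, second_countable_topology}"
  assumes "F \<in> borel_measurable (gauss_prod (insert k I))"
  shows "(\<lambda>x. \<integral>y. F (x(k := y)) \<partial>std_gauss) \<in> borel_measurable (gauss_prod I)"
  using std_gauss.borel_measurable_lebesgue_integral[OF borel_measurable_gauss_prod_upd[OF assms]] by simp

text \<open>A nonintegrable \<open>G\<close> has integral 0 by convention, so the bound holds for it
  too. It can therefore be applied to the slice of a function through any point, inside or outside
  the product space.\<close>

lemma abs_std_gauss_expectation_le: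
  fixes G :: "real \<Rightarrow> real"
  assumes "\<And>y. \<bar>G y\<bar> \<le> C"
  shows "\<bar>\<integral>y. G y \<partial>std_gauss\<bar> \<le> C"
proof (cases "integrable std_gauss G")
  case True
  then show ?thesis
    using std_gauss.norm_expectation_le[of G C] assms by auto
next
  case False
  then show ?thesis using assms[of 0] by (simp add: not_integrable_integral_eq)
qed

lemma integrable_gauss_prod_avg:
  fixes F :: "('i \<Rightarrow> real) \<Rightarrow> real"
  assumes "F \<in> borel_measurable (gauss_prod (insert k I))" and "\<And>w. \<bar>F w\<bar> \<le> C"
  shows "integrable (gauss_prod I) (\<lambda>x. \<integral>y. F (x(k := y)) \<partial>std_gauss)"
proof -
  interpret prob_space "gauss_prod I" by (rule prob_space_gauss_prod)
  show ?thesis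
    by (rule integrable_bounded[OF borel_measurable_gauss_prod_avg[OF assms(1)], of C])
       (use abs_std_gauss_expectation_le assms(2) in auto)
qed

lemma integral_gauss_prod_insert:
  fixes F :: "('i \<Rightarrow> real) \<Rightarrow> 'b::{banach, second_countable_topology}"
  assumes "finite I" "k \<notin> I" "integrable (gauss_prod (insert k I)) F"
  shows "(\<integral>w. F w \<partial>gauss_prod (insert k I)) = (\<integral>x. (\<integral>y. F (x(k := y)) \<partial>std_gauss) \<partial>gauss_prod I)"
  by (rule gauss_prod.product_integral_insert[OF assms])

lemma integrable_gauss_prod_component:
  assumes "p \<in> J"
  shows "integrable (gauss_prod J) (\<lambda>w. w p)"
proof -
  have "distr (gauss_prod J) std_gauss (\<lambda>w. w p) = std_gauss"
    by (rule distr_PiM_component) (use assms prob_space_std_gauss in auto)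
  moreover have "integrable std_gauss (\<lambda>x. x)"
  proof (rule integrable_std_gauss_quadratic[where a = 1 and b = 1])
    fix x :: real
    have "0 \<le> (\<bar>x\<bar> - 1)\<^sup>2" "0 \<le> x\<^sup>2" by simp_all
    then show "norm x \<le> 1 + 1 * x\<^sup>2" by (simp add: power2_diff)
  qed simp
  ultimately have "integrable (distr (gauss_prod J) std_gauss (\<lambda>w. w p)) (\<lambda>x. x)" by simp
  then show ?thesis
    by (rule integrable_distr[rotated]) (use assms in simp)
qed

lemma integrable_gauss_prod_component_scaleR:
  fixes F :: "('i \<Rightarrow> real) \<Rightarrow> 'b::{banach, second_countable_topology}"
  assumes p: "p \<in> J" and meas: "F \<in> borel_measurable (gauss_prod J)" and bd: "\<And>w. norm (F w) \<le> B"
  shows "integrable (gauss_prod J) (\<lambda>w. w p *\<^sub>R F w)"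
proof (rule Bochner_Integration.integrable_bound)
  show "integrable (gauss_prod J) (\<lambda>w. B * w p)"
    using integrable_gauss_prod_component[OF p] by simp
  show "(\<lambda>w. w p *\<^sub>R F w) \<in> borel_measurable (gauss_prod J)"
    using p meas by measurable
  have "0 \<le> B" using bd norm_ge_zero order_trans by blast
  then show "AE w in gauss_prod J. norm (w p *\<^sub>R F w) \<le> norm (B * w p)"
    using mult_right_mono[OF bd] by (intro AE_I2) (simp add: abs_mult mult.commute[of "\<bar>w p\<bar>" for w])
qed

text \<open>Fubini freezes all coordinates but \<open>p\<close>, and Stein's identity acts on each
  slice. The slice derivatives are given by one function \<open>D\<close> of the whole point, so
  that their mean is again an integral over the product.\<close>

lemma gauss_prod_integration_by_parts:
  fixes F D :: "('i \<Rightarrow> real) \<Rightarrow> 'b::euclidean_space"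
  assumes J: "finite J" "p \<in> J"
    and meas: "F \<in> borel_measurable (gauss_prod J)" "D \<in> borel_measurable (gauss_prod J)"
    and bd: "\<And>w. norm (F w) \<le> B" "\<And>w. norm (D w) \<le> C"
    and deriv: "\<And>w y. ((\<lambda>y. F (w(p := y))) has_vector_derivative D (w(p := y))) (at y)"
    and cont: "\<And>w. continuous_on UNIV (\<lambda>y. D (w(p := y)))"
  shows "(\<integral>w. w p *\<^sub>R F w \<partial>gauss_prod J) = (\<integral>w. D w \<partial>gauss_prod J)"
proof -
  interpret N: prob_space "gauss_prod J" by (rule prob_space_gauss_prod)
  define I where "I = J - {p}"
  have I: "finite I" "p \<notin> I" and JI: "J = insert p I" using J by (auto simp: I_def)
  have int: "integrable (gauss_prod J) (\<lambda>w. w p *\<^sub>R F w)"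
    by (rule integrable_gauss_prod_component_scaleR[OF J(2) meas(1) bd(1)])
  have intD: "integrable (gauss_prod J) D"
    by (rule N.integrable_bounded[OF meas(2) bd(2)])
  have "(\<integral>w. w p *\<^sub>R F w \<partial>gauss_prod J) = (\<integral>x. (\<integral>y. y *\<^sub>R F (x(p := y)) \<partial>std_gauss) \<partial>gauss_prod I)"
    using integral_gauss_prod_insert[OF I, of "\<lambda>w. w p *\<^sub>R F w"] int by (simp add: JI)
  also have "\<dots> = (\<integral>x. (\<integral>y. D (x(p := y)) \<partial>std_gauss) \<partial>gauss_prod I)"
    by (intro Bochner_Integration.integral_cong refl stein_identity[OF deriv cont bd(2)])
  also have "\<dots> = (\<integral>w. D w \<partial>gauss_prod J)"
    using integral_gauss_prod_insert[OF I, of D] intD by (simp add: JI)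
  finally show ?thesis .
qed

text \<open>Induction on the coordinates. Conditioning on all but the new coordinate
  \<open>k\<close> splits the variance into the mean variance over \<open>k\<close> and the variance
  of the \<open>k\<close>-average \<open>A\<close>. The induction hypothesis bounds the latter by a
  sum over \<open>I\<close>, and averaging over \<open>k\<close> can only decrease each of its
  terms.\<close>

lemma efron_stein_gauss_prod:
  fixes F :: "('i \<Rightarrow> real) \<Rightarrow> real"
  assumes "finite J" and "F \<in> borel_measurable (gauss_prod J)" and "\<And>w. \<bar>F w\<bar> \<le> B"
  shows "(\<integral>w. (F w - (\<integral>w. F w \<partial>gauss_prod J))\<^sup>2 \<partial>gauss_prod J)
    \<le> (\<Sum>p\<in>J. \<integral>w. (F w - (\<integral>y. F (w(p := y)) \<partial>std_gauss))\<^sup>2 \<partial>gauss_prod J)"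
  using assms
proof (induction J arbitrary: F rule: finite_induct)
  case empty
  interpret N: prob_space "gauss_prod ({} :: 'i set)" by (rule prob_space_gauss_prod)
  have "(\<integral>w. (F w - (\<integral>w. F w \<partial>gauss_prod {}))\<^sup>2 \<partial>gauss_prod {}) = 0"
    by (simp add: PiM_empty lebesgue_integral_count_space_finite)
  then show ?case by simp
next
  case (insert k I)
  note F [measurable] = insert.prems(1)
  let ?N = "gauss_prod (insert k I)"
  interpret N: prob_space ?N by (rule prob_space_gauss_prod)
  interpret N': prob_space "gauss_prod I" by (rule prob_space_gauss_prod)
  have B: "\<bar>F w\<bar> \<le> B" for w by fact
  have sq: "(a - b)\<^sup>2 \<le> (2 * B)\<^sup>2" if "\<bar>a\<bar> \<le> B" "\<bar>b\<bar> \<le> B" for a b :: real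
    using that by (intro abs_le_square_iff[THEN iffD1]) auto
  define A where "A x = (\<integral>y. F (x(k := y)) \<partial>std_gauss)" for x
  have A_meas [measurable]: "A \<in> borel_measurable (gauss_prod I)"
    unfolding A_def by (rule borel_measurable_gauss_prod_avg[OF F])
  have A'_meas: "A \<in> borel_measurable ?N"
    unfolding A_def by (rule borel_measurable_gauss_prod_avg) (use F in simp)
  have A_bound: "\<bar>A x\<bar> \<le> B" for x
    unfolding A_def by (rule abs_std_gauss_expectation_le) (rule B)
  define \<mu> where "\<mu> = (\<integral>w. F w \<partial>?N)"
  have int_F: "integrable ?N F" by (rule N.integrable_bounded[OF F]) (use B in auto)
  have \<mu>: "\<mu> = (\<integral>x. A x \<partial>gauss_prod I)"
    unfolding \<mu>_def A_def by (rule integral_gauss_prod_insert[OF insert.hyps int_F])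
  have \<mu>_bound: "\<bar>\<mu>\<bar> \<le> B"
    unfolding \<mu>_def using N.norm_expectation_le[OF F, of B] B by simp
  have slice: "(\<lambda>y. F (x(k := y))) \<in> borel_measurable std_gauss" if "x \<in> space (gauss_prod I)" for x
    by (rule borel_measurable_gauss_prod_upd1[OF F that])
  have slice_int: "integrable std_gauss (\<lambda>y. F (x(k := y)))"
    "integrable std_gauss (\<lambda>y. (F (x(k := y)))\<^sup>2)" if "x \<in> space (gauss_prod I)" for x
  proof -
    show "integrable std_gauss (\<lambda>y. F (x(k := y)))"
      by (rule std_gauss.integrable_bounded[OF slice[OF that], of B]) (use B in auto)
    have "(F w)\<^sup>2 \<le> B\<^sup>2" for w
      using B[of w] by (simp add: abs_le_square_iff[symmetric])
    then show "integrable std_gauss (\<lambda>y. (F (x(k := y)))\<^sup>2)"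
      using slice[OF that] by (intro std_gauss.integrable_bounded[of _ "B\<^sup>2"]) auto
  qed
  have meas_k: "(\<lambda>w. (F w - (\<integral>y. F (w(k := y)) \<partial>std_gauss))\<^sup>2) \<in> borel_measurable ?N"
    using A'_meas unfolding A_def[symmetric] by measurable
  have int_k: "integrable ?N (\<lambda>w. (F w - (\<integral>y. F (w(k := y)) \<partial>std_gauss))\<^sup>2)"
    by (rule N.integrable_bounded[OF meas_k, of "(2 * B)\<^sup>2"])
       (use sq[OF B abs_std_gauss_expectation_le[OF B]] in auto)
  have k_term: "(\<integral>w. (F w - (\<integral>y. F (w(k := y)) \<partial>std_gauss))\<^sup>2 \<partial>?N) =
      (\<integral>x. (\<integral>y. (F (x(k := y)) - A x)\<^sup>2 \<partial>std_gauss) \<partial>gauss_prod I)"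
    using integral_gauss_prod_insert[OF insert.hyps int_k] by (simp add: A_def)
  have int_var: "integrable (gauss_prod I) (\<lambda>x. \<integral>y. (F (x(k := y)) - A x)\<^sup>2 \<partial>std_gauss)"
  proof (rule N'.integrable_bounded[of _ "(2 * B)\<^sup>2"])
    show "(\<lambda>x. \<integral>y. (F (x(k := y)) - A x)\<^sup>2 \<partial>std_gauss) \<in> borel_measurable (gauss_prod I)"
      using borel_measurable_gauss_prod_avg[OF meas_k] by (simp add: A_def)
    show "norm (\<integral>y. (F (x(k := y)) - A x)\<^sup>2 \<partial>std_gauss) \<le> (2 * B)\<^sup>2" for x
      unfolding real_norm_def by (rule abs_std_gauss_expectation_le) (use sq[OF B A_bound] in simp)
  qed
  have int_A2: "integrable (gauss_prod I) (\<lambda>x. (A x - \<mu>)\<^sup>2)"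
    by (rule N'.integrable_bounded[of _ "(2 * B)\<^sup>2"]) (use sq[OF A_bound \<mu>_bound] in auto)
  have int_\<mu>: "integrable ?N (\<lambda>w. (F w - \<mu>)\<^sup>2)"
    by (rule N.integrable_bounded[of _ "(2 * B)\<^sup>2"]) (use sq[OF B \<mu>_bound] in auto)
  have "(\<integral>w. (F w - \<mu>)\<^sup>2 \<partial>?N) = (\<integral>x. (\<integral>y. (F (x(k := y)) - \<mu>)\<^sup>2 \<partial>std_gauss) \<partial>gauss_prod I)"
    using integral_gauss_prod_insert[OF insert.hyps int_\<mu>] by simp
  also have "\<dots> = (\<integral>x. (\<integral>y. (F (x(k := y)) - A x)\<^sup>2 \<partial>std_gauss) + (A x - \<mu>)\<^sup>2 \<partial>gauss_prod I)"
    using std_gauss.variance_decomposition[OF slice_int, of _ \<mu>] unfolding A_def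
    by (intro Bochner_Integration.integral_cong refl) auto
  also have "\<dots> = (\<integral>w. (F w - (\<integral>y. F (w(k := y)) \<partial>std_gauss))\<^sup>2 \<partial>?N) + (\<integral>x. (A x - \<mu>)\<^sup>2 \<partial>gauss_prod I)"
    using int_var int_A2 by (simp add: k_term)
  also have "(\<integral>x. (A x - \<mu>)\<^sup>2 \<partial>gauss_prod I) \<le>
      (\<Sum>p\<in>I. \<integral>x. (A x - (\<integral>u. A (x(p := u)) \<partial>std_gauss))\<^sup>2 \<partial>gauss_prod I)"
    unfolding \<mu> by (rule insert.IH[OF A_meas A_bound])
  also have "\<dots> \<le> (\<Sum>p\<in>I. \<integral>w. (F w - (\<integral>u. F (w(p := u)) \<partial>std_gauss))\<^sup>2 \<partial>?N)"
  proof (rule sum_mono)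
    fix p assume p: "p \<in> I"
    then have pk: "p \<noteq> k" using insert.hyps by auto
    have ins: "insert p I = I" "insert p (insert k I) = insert k I" using p by auto
    define d where "d w = F w - (\<integral>u. F (w(p := u)) \<partial>std_gauss)" for w
    have d_meas [measurable]: "d \<in> borel_measurable ?N"
      unfolding d_def using borel_measurable_gauss_prod_avg[of F p "insert k I"] F ins(2)
      by (intro borel_measurable_diff) auto
    have d_bound: "\<bar>d w\<bar> \<le> 2 * B" for w
      unfolding d_def using B[of w] abs_std_gauss_expectation_le[of "\<lambda>u. F (w(p := u))" B] B by fastforce
    have d2_bound: "(d w)\<^sup>2 \<le> (2 * B)\<^sup>2" for w
      using sq[OF B abs_std_gauss_expectation_le[OF B]] unfolding d_def by auto
    have int_d2: "integrable ?N (\<lambda>w. (d w)\<^sup>2)"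
      by (rule N.integrable_bounded[of _ "(2 * B)\<^sup>2"]) (use d2_bound in auto)
    \<comment> \<open>Averaging over \<open>p\<close> and over \<open>k\<close> commute, so the
      deviation of \<open>A\<close> in direction \<open>p\<close> is the \<open>k\<close>-average of
      the deviation \<open>d\<close> of \<open>F\<close>. Jensen's inequality then moves the square
      inside the average.\<close>
    have avg_d: "A x - (\<integral>u. A (x(p := u)) \<partial>std_gauss) = (\<integral>y. d (x(k := y)) \<partial>std_gauss)"
      if x: "x \<in> space (gauss_prod I)" for x
    proof -
      have m2: "(\<lambda>(u, y). F (x(p := u, k := y))) \<in> borel_measurable (std_gauss \<Otimes>\<^sub>M std_gauss)"
      proof -
        have "(\<lambda>u. x(p := u)) \<in> measurable std_gauss (gauss_prod I)"
          using measurable_compose[OF measurable_Pair1'[OF x] measurable_gauss_prod_upd[of p I]] ins(1)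
          by simp
        then have "(\<lambda>(u, y). (x(p := u), y)) \<in> measurable (std_gauss \<Otimes>\<^sub>M std_gauss) (gauss_prod I \<Otimes>\<^sub>M std_gauss)"
          by measurable
        from measurable_compose[OF this borel_measurable_gauss_prod_upd[OF F]]
        show ?thesis by (rule measurable_cong[THEN iffD1, rotated]) (auto simp: fun_upd_def)
      qed
      interpret P: pair_prob_space std_gauss std_gauss ..
      have int2: "integrable (std_gauss \<Otimes>\<^sub>M std_gauss) (\<lambda>(u, y). F (x(p := u, k := y)))"
        by (rule P.integrable_bounded[OF m2, of B]) (use B in auto)
      have "(\<integral>u. A (x(p := u)) \<partial>std_gauss) = (\<integral>u. (\<integral>y. F (x(p := u, k := y)) \<partial>std_gauss) \<partial>std_gauss)"
        by (simp add: A_def)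
      also have "\<dots> = (\<integral>y. (\<integral>u. F (x(p := u, k := y)) \<partial>std_gauss) \<partial>std_gauss)"
        using P.Fubini_integral[of "\<lambda>u y. F (x(p := u, k := y))"] int2 by simp
      finally have eq: "(\<integral>u. A (x(p := u)) \<partial>std_gauss) = (\<integral>y. (\<integral>u. F (x(p := u, k := y)) \<partial>std_gauss) \<partial>std_gauss)" .
      have int3: "integrable std_gauss (\<lambda>y. \<integral>u. F (x(p := u, k := y)) \<partial>std_gauss)"
        using P.integrable_snd[of "\<lambda>u y. F (x(p := u, k := y))"] int2 by simp
      show ?thesis
        unfolding d_def eq unfolding A_def
        using slice_int(1)[OF x] int3 pk
        by (simp add: Bochner_Integration.integral_diff fun_upd_twist)
    qed
    have "(\<integral>x. (A x - (\<integral>u. A (x(p := u)) \<partial>std_gauss))\<^sup>2 \<partial>gauss_prod I)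
        = (\<integral>x. (\<integral>y. d (x(k := y)) \<partial>std_gauss)\<^sup>2 \<partial>gauss_prod I)"
      by (intro Bochner_Integration.integral_cong refl) (simp add: avg_d)
    also have "\<dots> \<le> (\<integral>x. (\<integral>y. (d (x(k := y)))\<^sup>2 \<partial>std_gauss) \<partial>gauss_prod I)"
    proof (rule integral_mono)
      have "\<bar>\<integral>y. d (x(k := y)) \<partial>std_gauss\<bar> \<le> 2 * B" for x
        by (rule abs_std_gauss_expectation_le) (rule d_bound)
      then have "(\<integral>y. d (x(k := y)) \<partial>std_gauss)\<^sup>2 \<le> (2 * B)\<^sup>2" for x
        unfolding abs_le_square_iff[symmetric] by (rule order_trans[OF _ abs_ge_self])
      then show "integrable (gauss_prod I) (\<lambda>x. (\<integral>y. d (x(k := y)) \<partial>std_gauss)\<^sup>2)"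
        using borel_measurable_gauss_prod_avg[OF d_meas]
        by (intro N'.integrable_bounded[of _ "(2 * B)\<^sup>2"]) auto
      show "integrable (gauss_prod I) (\<lambda>x. \<integral>y. (d (x(k := y)))\<^sup>2 \<partial>std_gauss)"
        by (rule integrable_gauss_prod_avg[of "\<lambda>w. (d w)\<^sup>2" k I "(2 * B)\<^sup>2"]) (use d2_bound in auto)
      fix x assume x: "x \<in> space (gauss_prod I)"
      have m: "(\<lambda>y. d (x(k := y))) \<in> borel_measurable std_gauss"
        by (rule borel_measurable_gauss_prod_upd1[OF d_meas x])
      show "(\<integral>y. d (x(k := y)) \<partial>std_gauss)\<^sup>2 \<le> (\<integral>y. (d (x(k := y)))\<^sup>2 \<partial>std_gauss)"
      proof (rule std_gauss.square_expectation_le)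
        show "integrable std_gauss (\<lambda>y. d (x(k := y)))"
          by (rule std_gauss.integrable_bounded[OF m, of "2 * B"]) (use d_bound in auto)
        show "integrable std_gauss (\<lambda>y. (d (x(k := y)))\<^sup>2)"
          by (rule std_gauss.integrable_bounded[of _ "(2 * B)\<^sup>2"]) (use m d2_bound in auto)
      qed
    qed
    also have "\<dots> = (\<integral>w. (d w)\<^sup>2 \<partial>?N)"
      using integral_gauss_prod_insert[OF insert.hyps int_d2] by simp
    finally show "(\<integral>x. (A x - (\<integral>u. A (x(p := u)) \<partial>std_gauss))\<^sup>2 \<partial>gauss_prod I)
        \<le> (\<integral>w. (F w - (\<integral>u. F (w(p := u)) \<partial>std_gauss))\<^sup>2 \<partial>?N)"
      by (simp add: d_def)
  qed
  finally show ?case using insert.hyps by (simp add: \<mu>_def fun_upd_def)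
qed

text \<open>Efron-Stein leaves one conditional variance per coordinate, and the one-dimensional
  inequality bounds each of them by the mean square of the partial derivative.\<close>

lemma gauss_prod_poincare:
  fixes F :: "('i \<Rightarrow> real) \<Rightarrow> real"
  assumes J: "finite J"
    and F: "F \<in> borel_measurable (gauss_prod J)" "\<And>w. \<bar>F w\<bar> \<le> B"
    and D: "\<And>p. p \<in> J \<Longrightarrow> D p \<in> borel_measurable (gauss_prod J)" "\<And>p w. p \<in> J \<Longrightarrow> \<bar>D p w\<bar> \<le> C"
    and deriv: "\<And>p w y. p \<in> J \<Longrightarrow> ((\<lambda>y. F (w(p := y))) has_real_derivative D p (w(p := y))) (at y)"
    and cont: "\<And>p w. p \<in> J \<Longrightarrow> continuous_on UNIV (\<lambda>y. D p (w(p := y)))"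
  shows "(\<integral>w. (F w - (\<integral>w. F w \<partial>gauss_prod J))\<^sup>2 \<partial>gauss_prod J) \<le> (\<Sum>p\<in>J. \<integral>w. (D p w)\<^sup>2 \<partial>gauss_prod J)"
proof -
  interpret N: prob_space "gauss_prod J" by (rule prob_space_gauss_prod)
  have sqF: "(F w)\<^sup>2 \<le> B\<^sup>2" for w using F(2)[of w] by (simp add: abs_le_square_iff[symmetric])
  have "(\<integral>w. (F w - (\<integral>y. F (w(p := y)) \<partial>std_gauss))\<^sup>2 \<partial>gauss_prod J) \<le> (\<integral>w. (D p w)\<^sup>2 \<partial>gauss_prod J)"
    if p: "p \<in> J" for p
  proof -
    define I where "I = J - {p}"
    have I: "finite I" "p \<notin> I" and JI: "J = insert p I" using J p by (auto simp: I_def)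
    interpret N': prob_space "gauss_prod I" by (rule prob_space_gauss_prod)
    note F' = F(1)[unfolded JI] and D' = D(1)[OF p, unfolded JI]
    have sqD: "(D p w)\<^sup>2 \<le> C\<^sup>2" for w
      using D(2)[OF p, of w] by (simp add: abs_le_square_iff[symmetric])
    have avg: "\<bar>\<integral>y. F (w(p := y)) \<partial>std_gauss\<bar> \<le> B" for w
      by (rule abs_std_gauss_expectation_le) (rule F(2))
    have dev_bound: "(F w - (\<integral>y. F (w'(p := y)) \<partial>std_gauss))\<^sup>2 \<le> (2 * B)\<^sup>2" for w w'
      using F(2)[of w] avg[of w'] by (intro abs_le_square_iff[THEN iffD1]) auto
    have avg_meas: "(\<lambda>w. \<integral>y. F (w(p := y)) \<partial>std_gauss) \<in> borel_measurable (gauss_prod (insert p I))"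
      by (rule borel_measurable_gauss_prod_avg) (use F' in simp)
    have dev_meas: "(\<lambda>w. (F w - (\<integral>y. F (w(p := y)) \<partial>std_gauss))\<^sup>2) \<in> borel_measurable (gauss_prod (insert p I))"
      using avg_meas F' by measurable
    have D2_meas: "(\<lambda>w. (D p w)\<^sup>2) \<in> borel_measurable (gauss_prod (insert p I))"
      using D' by measurable
    have int_dev: "integrable (gauss_prod (insert p I)) (\<lambda>w. (F w - (\<integral>y. F (w(p := y)) \<partial>std_gauss))\<^sup>2)"
      using dev_bound dev_meas unfolding JI[symmetric] by (intro N.integrable_bounded[of _ "(2 * B)\<^sup>2"]) auto
    have int_D: "integrable (gauss_prod (insert p I)) (\<lambda>w. (D p w)\<^sup>2)"
      using sqD D2_meas unfolding JI[symmetric] by (intro N.integrable_bounded[of _ "C\<^sup>2"]) auto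
    have slice: "(\<integral>y. (F (x(p := y)) - (\<integral>y. F (x(p := y)) \<partial>std_gauss))\<^sup>2 \<partial>std_gauss)
        \<le> (\<integral>y. (D p (x(p := y)))\<^sup>2 \<partial>std_gauss)" if x: "x \<in> space (gauss_prod I)" for x
    proof -
      have m: "(\<lambda>y. F (x(p := y))) \<in> borel_measurable std_gauss"
        by (rule borel_measurable_gauss_prod_upd1[OF F' x])
      \<comment> \<open>The second moment is smallest about the mean, so recentring at the value for
        y = 0 only enlarges it and produces the left side of
        \<open>gaussian_poincare_at_0\<close>.\<close>
      have "(\<integral>y. (F (x(p := y)) - (\<integral>y. F (x(p := y)) \<partial>std_gauss))\<^sup>2 \<partial>std_gauss)
          \<le> (\<integral>y. (F (x(p := y)) - F (x(p := 0)))\<^sup>2 \<partial>std_gauss)"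
      proof (subst (2) std_gauss.variance_decomposition)
        show "integrable std_gauss (\<lambda>y. F (x(p := y)))"
          by (rule std_gauss.integrable_bounded[OF m, of B]) (use F(2) in auto)
        show "integrable std_gauss (\<lambda>y. (F (x(p := y)))\<^sup>2)"
          by (rule std_gauss.integrable_bounded[of _ "B\<^sup>2"]) (use m sqF in auto)
      qed simp
      also have "\<dots> \<le> (\<integral>y. (D p (x(p := y)))\<^sup>2 \<partial>std_gauss)"
        by (rule gaussian_poincare_at_0[where f = "\<lambda>y. F (x(p := y))" and f' = "\<lambda>y. D p (x(p := y))" and b = C])
           (use deriv[OF p] cont[OF p] D(2)[OF p] in auto)
      finally show ?thesis .
    qed
    have "(\<integral>w. (F w - (\<integral>y. F (w(p := y)) \<partial>std_gauss))\<^sup>2 \<partial>gauss_prod (insert p I))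
        = (\<integral>x. (\<integral>y. (F (x(p := y)) - (\<integral>y. F (x(p := y)) \<partial>std_gauss))\<^sup>2 \<partial>std_gauss) \<partial>gauss_prod I)"
      using integral_gauss_prod_insert[OF I int_dev] by simp
    also have "\<dots> \<le> (\<integral>x. (\<integral>y. (D p (x(p := y)))\<^sup>2 \<partial>std_gauss) \<partial>gauss_prod I)"
    proof (rule integral_mono)
      show "integrable (gauss_prod I) (\<lambda>x. \<integral>y. (F (x(p := y)) - (\<integral>y. F (x(p := y)) \<partial>std_gauss))\<^sup>2 \<partial>std_gauss)"
        using integrable_gauss_prod_avg[OF dev_meas, of "(2 * B)\<^sup>2"] dev_bound by auto
      show "integrable (gauss_prod I) (\<lambda>x. \<integral>y. (D p (x(p := y)))\<^sup>2 \<partial>std_gauss)"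
        using integrable_gauss_prod_avg[OF D2_meas, of "C\<^sup>2"] sqD by auto
    qed (rule slice)
    also have "\<dots> = (\<integral>w. (D p w)\<^sup>2 \<partial>gauss_prod (insert p I))"
      using integral_gauss_prod_insert[OF I int_D] by simp
    finally show ?thesis by (simp add: JI)
  qed
  then have "(\<Sum>p\<in>J. \<integral>w. (F w - (\<integral>y. F (w(p := y)) \<partial>std_gauss))\<^sup>2 \<partial>gauss_prod J)
      \<le> (\<Sum>p\<in>J. \<integral>w. (D p w)\<^sup>2 \<partial>gauss_prod J)"
    by (rule sum_mono)
  with efron_stein_gauss_prod[OF J F] show ?thesis by (rule order_trans)
qed

section \<open>Resolvents of real symmetric matrices\<close>

text \<open>A bijection \<open>h\<close> from {0..<n} carries the claim to matrices that have a
  determinant: a trivial kernel makes it nonzero, and this gives a two-sided inverse that is carried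
  back.\<close>

lemma inverse_of_trivial_kernel:
  fixes B :: "'i \<Rightarrow> 'i \<Rightarrow> 'a::field"
  assumes "finite I"
    and ker: "\<And>v i. (\<And>i. i \<in> I \<Longrightarrow> (\<Sum>j\<in>I. B i j * v j) = 0) \<Longrightarrow> i \<in> I \<Longrightarrow> v i = 0"
  shows "\<exists>Q. \<forall>i \<in> I. \<forall>j \<in> I.
    (\<Sum>k\<in>I. B i k * Q k j) = of_bool (i = j) \<and> (\<Sum>k\<in>I. Q i k * B k j) = of_bool (i = j)"
proof -
  define n where "n = card I"
  obtain h where h: "bij_betw h {0..<n} I"
    using ex_bij_betw_nat_finite[OF assms(1)] by (auto simp: n_def)
  define g where "g = the_inv_into {0..<n} h"
  have inj: "inj_on h {0..<n}" and img: "h ` {0..<n} = I"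
    using h by (simp_all add: bij_betw_def)
  have gh: "g (h k) = k" if "k < n" for k
    unfolding g_def by (rule the_inv_into_f_f[OF inj]) (simp add: that)
  have hg: "h (g i) = i" "g i < n" if "i \<in> I" for i
  proof -
    show "h (g i) = i" unfolding g_def by (rule f_the_inv_into_f[OF inj]) (simp add: img that)
    have "g i \<in> {0..<n}" unfolding g_def by (rule the_inv_into_into[OF inj]) (simp_all add: img that)
    then show "g i < n" by simp
  qed
  have hI: "h k \<in> I" if "k < n" for k
    using h that by (auto simp: bij_betw_def)
  have shift: "(\<Sum>k\<in>I. f k) = (\<Sum>k = 0..<n. f (h k))" for f :: "'i \<Rightarrow> 'a"
    by (rule sum.reindex_bij_betw[OF h, symmetric])
  define M where "M = Matrix.mat n n (\<lambda>(i, j). B (h i) (h j))"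
  have M: "M \<in> carrier_mat n n" by (simp add: M_def)
  have "Determinant.det M \<noteq> 0"
  proof
    assume "Determinant.det M = 0"
    then obtain v where v: "v \<in> carrier_vec n" "v \<noteq> 0\<^sub>v n" "M *\<^sub>v v = 0\<^sub>v n"
      unfolding det_0_iff_vec_prod_zero_field[OF M] by blast
    have *: "vec_index v (g i) = 0" if "i \<in> I" for i
    proof (rule ker[of "\<lambda>i. vec_index v (g i)", OF _ that])
      fix i assume i: "i \<in> I"
      have "vec_index (M *\<^sub>v v) (g i) = 0" unfolding v(3) using hg[OF i] by simp
      then show "(\<Sum>j\<in>I. B i j * vec_index v (g j)) = 0"
        using hg[OF i] v(1) by (simp add: M_def shift scalar_prod_def gh)
    qed
    have "vec_index v i = 0" if "i < n" for i
      using *[OF hI[OF that]] by (simp add: gh that)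
    then have "v = 0\<^sub>v n" using v(1) by auto
    with v(2) show False by simp
  qed
  then have "M \<in> Units (ring_mat TYPE('a) n ())" by (rule det_non_zero_imp_unit[OF M])
  then have "\<exists>C \<in> carrier_mat n n. C * M = 1\<^sub>m n \<and> M * C = 1\<^sub>m n"
    unfolding Units_def ring_mat_def by simp
  then obtain C where C: "C \<in> carrier_mat n n" "M * C = 1\<^sub>m n" "C * M = 1\<^sub>m n"
    by blast
  define Q where "Q i j = C $$ (g i, g j)" for i j
  have "(\<Sum>k\<in>I. B i k * Q k j) = of_bool (i = j) \<and> (\<Sum>k\<in>I. Q i k * B k j) = of_bool (i = j)"
    if i: "i \<in> I" and j: "j \<in> I" for i j
  proof
    have "g i = g j \<longleftrightarrow> i = j" using hg(1)[OF i] hg(1)[OF j] by metis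
    then have d: "(1\<^sub>m n) $$ (g i, g j) = (of_bool (i = j) :: 'a)"
      using hg(2)[OF i] hg(2)[OF j] by simp
    note ij = hg[OF i] hg[OF j]
    have "(M * C) $$ (g i, g j) = (\<Sum>k\<in>I. B i k * Q k j)"
      using ij C(1) by (simp add: M_def shift scalar_prod_def Q_def gh)
    with C(2) d show "(\<Sum>k\<in>I. B i k * Q k j) = of_bool (i = j)" by simp
    have "(C * M) $$ (g i, g j) = (\<Sum>k\<in>I. Q i k * B k j)"
      using ij C(1) by (simp add: M_def shift scalar_prod_def Q_def gh)
    with C(3) d show "(\<Sum>k\<in>I. Q i k * B k j) = of_bool (i = j)" by simp
  qed
  then show ?thesis by (intro exI[of _ Q]) simp
qed

lemma cnj_of_bool: "cnj (of_bool b) = of_bool b"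
  by (cases b) auto

definition mat_app :: "'i set \<Rightarrow> ('i \<Rightarrow> 'i \<Rightarrow> complex) \<Rightarrow> ('i \<Rightarrow> complex) \<Rightarrow> 'i \<Rightarrow> complex" where
  "mat_app I Q v i = (\<Sum>j \<in> I. Q i j * v j)"

definition nrm2 :: "'i set \<Rightarrow> ('i \<Rightarrow> complex) \<Rightarrow> real" where
  "nrm2 I v = (\<Sum>i \<in> I. (cmod (v i))\<^sup>2)"

lemma nrm2_nonneg [simp]: "0 \<le> nrm2 I v"
  by (simp add: nrm2_def sum_nonneg)

lemma nrm2_eq_0_iff: "finite I \<Longrightarrow> nrm2 I v = 0 \<longleftrightarrow> (\<forall>i \<in> I. v i = 0)"
  by (simp add: nrm2_def sum_nonneg_eq_0_iff)

lemma nrm2_unit: "finite I \<Longrightarrow> i \<in> I \<Longrightarrow> nrm2 I (\<lambda>j. of_bool (j = i)) = 1"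
  by (simp add: nrm2_def of_bool_def if_distrib[of cmod] if_distrib[of "\<lambda>x. x\<^sup>2"] sum.delta cong: if_cong)

lemma sum_cmod_mult_le:
  "(\<Sum>i \<in> I. cmod (u i) * cmod (v i)) \<le> sqrt (nrm2 I u) * sqrt (nrm2 I v)"
  using L2_set_mult_ineq[of "\<lambda>i. cmod (u i)" "\<lambda>i. cmod (v i)" "I"]
  by (simp add: L2_set_def nrm2_def)

lemma cmod_sum_mult_le:
  "cmod (\<Sum>i \<in> I. u i * v i) \<le> sqrt (nrm2 I u) * sqrt (nrm2 I v)"
proof -
  have "cmod (\<Sum>i \<in> I. u i * v i) \<le> (\<Sum>i \<in> I. cmod (u i) * cmod (v i))"
    by (rule order_trans[OF norm_sum]) (simp add: norm_mult)
  also note sum_cmod_mult_le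
  finally show ?thesis .
qed

lemma nrm2_cnj [simp]: "nrm2 I (\<lambda>i. cnj (v i)) = nrm2 I v"
  by (simp add: nrm2_def)

lemma sum_of_bool_mult [simp]:
  fixes f :: "'i \<Rightarrow> 'a::comm_semiring_1"
  assumes "finite I"
  shows "i \<in> I \<Longrightarrow> (\<Sum>k \<in> I. of_bool (k = i) * f k) = f i"
    "i \<in> I \<Longrightarrow> (\<Sum>k \<in> I. of_bool (i = k) * f k) = f i"
    "i \<in> I \<Longrightarrow> (\<Sum>k \<in> I. f k * of_bool (k = i)) = f i"
    "i \<in> I \<Longrightarrow> (\<Sum>k \<in> I. f k * of_bool (i = k)) = f i"
  using assms by (auto simp: of_bool_def if_distrib[of "\<lambda>x. x * _"] if_distrib[of "\<lambda>x. _ * x"] sum.delta sum.delta' cong: if_cong)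

text \<open>The inverse of z - A on \<open>I\<close>; entries outside \<open>I\<close> are whatever
  the choice yields. The choice is meaningful once \<open>resolvent_inverse\<close> has shown that
  an inverse exists.\<close>

definition resolvent :: "'i set \<Rightarrow> complex \<Rightarrow> ('i \<Rightarrow> 'i \<Rightarrow> real) \<Rightarrow> 'i \<Rightarrow> 'i \<Rightarrow> complex" where
  "resolvent I z A = (SOME Q. \<forall>i \<in> I. \<forall>j \<in> I.
     (\<Sum>k \<in> I. (z * of_bool (i = k) - A i k) * Q k j) = of_bool (i = j) \<and>
     (\<Sum>k \<in> I. Q i k * (z * of_bool (k = j) - A k j)) = of_bool (i = j))"

locale sym_resolvent =
  fixes I :: "'i set" and z :: complex and A :: "'i \<Rightarrow> 'i \<Rightarrow> real"
  assumes fin [simp]: "finite I" and sym: "\<And>i j. A i j = A j i" and Im_pos: "0 < Im z"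
begin

abbreviation "Q \<equiv> resolvent I z A"

text \<open>For v = (z - A) y the Hermitian form of the real symmetric \<open>A\<close> at
  \<open>y\<close> is real, so only Im z contributes. It speaks of a solution \<open>y\<close> of
  the linear system, and not of the resolvent, because it also serves to prove that the resolvent
  exists.\<close>

lemma im_quadratic_form:
  assumes "\<And>i. i \<in> I \<Longrightarrow> v i = (\<Sum>k \<in> I. (z * of_bool (i = k) - A i k) * y k)"
  shows "Im (\<Sum>i \<in> I. cnj (v i) * y i) = - Im z * nrm2 I y"
proof -
  define S where "S = (\<Sum>i \<in> I. \<Sum>k \<in> I. A i k * cnj (y k) * y i)"
  have "cnj S = S"
    unfolding S_def by (simp, subst sum.swap) (simp add: sym mult_ac)
  then have S: "Im S = 0" by (metis cnj.simps(2) neg_equal_0_iff_equal equal_neg_zero)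
  have "(\<Sum>i \<in> I. cnj (v i) * y i)
      = (\<Sum>i \<in> I. cnj z * (cnj (y i) * y i) - (\<Sum>k \<in> I. A i k * cnj (y k) * y i))"
  proof (rule sum.cong)
    fix i assume i: "i \<in> I"
    have "v i = z * y i - (\<Sum>k \<in> I. A i k * y k)"
      using assms[OF i] i by (simp add: left_diff_distrib sum_subtractf mult.assoc sum_distrib_left[symmetric])
    then have "cnj (v i) = cnj z * cnj (y i) - (\<Sum>k \<in> I. A i k * cnj (y k))" by simp
    then show "cnj (v i) * y i = cnj z * (cnj (y i) * y i) - (\<Sum>k \<in> I. A i k * cnj (y k) * y i)"
      by (simp add: left_diff_distrib sum_distrib_right mult.assoc)
  qed simp
  also have "\<dots> = cnj z * (\<Sum>i \<in> I. cnj (y i) * y i) - S"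
    by (simp add: sum_subtractf sum_distrib_left S_def)
  also have "(\<Sum>i \<in> I. cnj (y i) * y i) = complex_of_real (nrm2 I y)"
    by (simp add: nrm2_def mult.commute flip: complex_norm_square)
  finally show ?thesis using S by simp
qed

text \<open>Cauchy-Schwarz applied to the imaginary part just computed. With v = 0 it yields the
  trivial kernel, with y = Q v the norm bound 1 / Im z for the resolvent.\<close>

lemma nrm2_solution_le:
  assumes "\<And>i. i \<in> I \<Longrightarrow> v i = (\<Sum>k \<in> I. (z * of_bool (i = k) - A i k) * y k)"
  shows "(Im z)\<^sup>2 * nrm2 I y \<le> nrm2 I v"
proof -
  have "Im z * nrm2 I y = \<bar>Im (\<Sum>i \<in> I. cnj (v i) * y i)\<bar>"
    using im_quadratic_form[OF assms] Im_pos by simp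
  also have "\<dots> \<le> sqrt (nrm2 I v) * sqrt (nrm2 I y)"
    using cmod_sum_mult_le[of "\<lambda>i. cnj (v i)" y I] abs_Im_le_cmod order_trans by fastforce
  finally have "(Im z * nrm2 I y)\<^sup>2 \<le> (sqrt (nrm2 I v) * sqrt (nrm2 I y))\<^sup>2"
    using Im_pos by (intro power_mono) auto
  then have "(Im z)\<^sup>2 * nrm2 I y * nrm2 I y \<le> nrm2 I v * nrm2 I y"
    by (simp add: power_mult_distrib power2_eq_square mult_ac)
  then show ?thesis
    using nrm2_nonneg[of I y] nrm2_nonneg[of I v] by (cases "nrm2 I y = 0") auto
qed

lemma resolvent_inverse:
  assumes "i \<in> I" "j \<in> I"
  shows "(\<Sum>k \<in> I. (z * of_bool (i = k) - A i k) * Q k j) = of_bool (i = j)"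
    and "(\<Sum>k \<in> I. Q i k * (z * of_bool (k = j) - A k j)) = of_bool (i = j)"
proof -
  have "\<exists>Q. \<forall>i \<in> I. \<forall>j \<in> I.
     (\<Sum>k \<in> I. (z * of_bool (i = k) - A i k) * Q k j) = of_bool (i = j) \<and>
     (\<Sum>k \<in> I. Q i k * (z * of_bool (k = j) - A k j)) = of_bool (i = j)"
  proof (rule inverse_of_trivial_kernel[OF fin])
    fix v i assume v: "\<And>i. i \<in> I \<Longrightarrow> (\<Sum>j \<in> I. (z * of_bool (i = j) - A i j) * v j) = 0"
      and i: "i \<in> I"
    have "(Im z)\<^sup>2 * nrm2 I v \<le> nrm2 I (\<lambda>_. 0)"
      by (rule nrm2_solution_le) (simp add: v)
    then have "nrm2 I v = 0"
      using Im_pos nrm2_nonneg[of I v] by (auto simp: nrm2_def mult_le_0_iff)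
    then show "v i = 0" using i by (simp add: nrm2_eq_0_iff)
  qed
  from someI_ex[OF this] assms show
    "(\<Sum>k \<in> I. (z * of_bool (i = k) - A i k) * Q k j) = of_bool (i = j)"
    "(\<Sum>k \<in> I. Q i k * (z * of_bool (k = j) - A k j)) = of_bool (i = j)"
    unfolding resolvent_def by blast+
qed

lemma resolvent_right:
  assumes "i \<in> I" "j \<in> I"
  shows "(\<Sum>k \<in> I. A i k * Q k j) = z * Q i j - of_bool (i = j)"
  using resolvent_inverse(1)[OF assms] assms(1)
  by (simp add: left_diff_distrib sum_subtractf mult.assoc sum_distrib_left[symmetric] algebra_simps)

lemma app_solves:
  assumes i: "i \<in> I"
  shows "v i = (\<Sum>k \<in> I. (z * of_bool (i = k) - A i k) * mat_app I Q v k)"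
proof -
  have "(\<Sum>k \<in> I. (z * of_bool (i = k) - A i k) * mat_app I Q v k)
      = (\<Sum>j \<in> I. (\<Sum>k \<in> I. (z * of_bool (i = k) - A i k) * Q k j) * v j)"
    unfolding mat_app_def sum_distrib_left sum_distrib_right by (subst sum.swap) (simp add: mult.assoc)
  also have "\<dots> = (\<Sum>j \<in> I. of_bool (i = j) * v j)"
    using i by (intro sum.cong) (simp_all only: resolvent_inverse(1) refl)
  finally show ?thesis using i by simp
qed

lemma im_app: "Im (\<Sum>i \<in> I. cnj (v i) * mat_app I Q v i) = - Im z * nrm2 I (mat_app I Q v)"
  by (rule im_quadratic_form) (rule app_solves)

lemma nrm2_app_le: "nrm2 I (mat_app I Q v) \<le> nrm2 I v / (Im z)\<^sup>2"
  using nrm2_solution_le[OF app_solves, of v] Im_pos by (simp add: field_simps)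

lemma sqrt_nrm2_app_le: "sqrt (nrm2 I (mat_app I Q v)) \<le> sqrt (nrm2 I v) / Im z"
  using real_sqrt_le_mono[OF nrm2_app_le[of v]] Im_pos by (simp add: real_sqrt_divide)

lemma cmod_bilinear_le:
  "cmod (\<Sum>i \<in> I. u i * mat_app I Q v i) \<le> sqrt (nrm2 I u) * sqrt (nrm2 I v) / Im z"
proof -
  have "cmod (\<Sum>i \<in> I. u i * mat_app I Q v i) \<le> sqrt (nrm2 I u) * sqrt (nrm2 I (mat_app I Q v))"
    by (rule cmod_sum_mult_le)
  also have "\<dots> \<le> sqrt (nrm2 I u) * (sqrt (nrm2 I v) / Im z)"
    by (intro mult_left_mono sqrt_nrm2_app_le) simp
  finally show ?thesis by simp
qed

text \<open>With B = z - A, which equals its transpose, Q^T = Q B Q^T = Q (Q B)^T = Q. No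
  conjugation is involved.\<close>

lemma resolvent_sym:
  assumes i: "i \<in> I" and j: "j \<in> I"
  shows "Q i j = Q j i"
proof -
  let ?B = "\<lambda>i k. z * of_bool (i = k) - complex_of_real (A i k)"
  have B: "?B i k = ?B k i" for i k by (auto simp: sym)
  have "Q j i = (\<Sum>k \<in> I. of_bool (i = k) * Q j k)"
    using i by simp
  also have "\<dots> = (\<Sum>k \<in> I. (\<Sum>l \<in> I. Q i l * ?B l k) * Q j k)"
    using i by (intro sum.cong) (simp_all only: resolvent_inverse(2) refl)
  also have "\<dots> = (\<Sum>l \<in> I. Q i l * (\<Sum>k \<in> I. Q j k * ?B k l))"
    unfolding sum_distrib_left sum_distrib_right by (subst sum.swap) (simp add: B[of _ _] mult_ac)
  also have "\<dots> = (\<Sum>l \<in> I. Q i l * of_bool (j = l))"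
    using j by (intro sum.cong) (simp_all only: resolvent_inverse(2) refl)
  finally show ?thesis using j by simp
qed

lemma mat_app_unit: "j \<in> I \<Longrightarrow> mat_app I Q (\<lambda>k. of_bool (k = j)) i = Q i j"
  by (simp add: mat_app_def)

lemma mat_app_unit': "j \<in> I \<Longrightarrow> mat_app I Q (\<lambda>k. of_bool (k = j)) = (\<lambda>i. Q i j)"
  by (rule ext) (rule mat_app_unit)

lemma cmod_resolvent_le:
  assumes "i \<in> I" "j \<in> I"
  shows "cmod (Q i j) \<le> 1 / Im z"
  using cmod_bilinear_le[of "\<lambda>k. of_bool (k = i)" "\<lambda>k. of_bool (k = j)"] assms
  by (simp add: mat_app_unit' nrm2_unit)

lemma nrm2_col_le: "j \<in> I \<Longrightarrow> nrm2 I (\<lambda>i. Q i j) \<le> 1 / (Im z)\<^sup>2"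
  using nrm2_app_le[of "\<lambda>k. of_bool (k = j)"] by (simp add: mat_app_unit' nrm2_unit)

text \<open>The Ward identity: the imaginary part of a diagonal entry is a multiple of the squared
  norm of its column.\<close>

lemma im_diag: "j \<in> I \<Longrightarrow> Im (Q j j) = - Im z * nrm2 I (\<lambda>i. Q i j)"
  using im_app[of "\<lambda>k. of_bool (k = j)"] by (simp add: mat_app_unit' cnj_of_bool del: Im_sum)

end

lemma resolvent_identity:
  assumes "sym_resolvent I z A" "sym_resolvent I z A'" and ij: "i \<in> I" "j \<in> I"
  shows "resolvent I z A' i j - resolvent I z A i j =
    (\<Sum>k \<in> I. \<Sum>l \<in> I. resolvent I z A i k * (A' k l - A k l) * resolvent I z A' l j)"
proof -
  interpret A: sym_resolvent I z A by fact
  interpret A': sym_resolvent I z A' by fact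
  let ?B = "\<lambda>A i k. z * of_bool (i = k) - complex_of_real (A i k)"
  have "A'.Q i j = (\<Sum>l \<in> I. of_bool (i = l) * A'.Q l j)"
    using ij by simp
  also have "\<dots> = (\<Sum>l \<in> I. (\<Sum>k \<in> I. A.Q i k * ?B A k l) * A'.Q l j)"
    using ij by (intro sum.cong) (simp_all only: A.resolvent_inverse(2) refl)
  also have "\<dots> = (\<Sum>k \<in> I. \<Sum>l \<in> I. A.Q i k * ?B A k l * A'.Q l j)"
    unfolding sum_distrib_right by (rule sum.swap)
  finally have 1: "A'.Q i j = \<dots>" .
  have "A.Q i j = (\<Sum>k \<in> I. A.Q i k * of_bool (k = j))"
    using ij by simp
  also have "\<dots> = (\<Sum>k \<in> I. A.Q i k * (\<Sum>l \<in> I. ?B A' k l * A'.Q l j))"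
    using ij by (intro sum.cong) (simp_all only: A'.resolvent_inverse(1) refl)
  also have "\<dots> = (\<Sum>k \<in> I. \<Sum>l \<in> I. A.Q i k * ?B A' k l * A'.Q l j)"
    by (simp add: sum_distrib_left mult.assoc)
  finally have 2: "A.Q i j = \<dots>" .
  show ?thesis
    unfolding 1 2 sum_subtractf[symmetric]
    by (intro sum.cong refl) (simp add: algebra_simps)
qed

section \<open>The operator norm\<close>

text \<open>A crude bound by the entries. It makes the supremum in \<open>op_norm\<close> that of a
  bounded set and, applied to a difference of matrices, gives the Lipschitz estimate
  \<open>op_norm_perturb\<close>.\<close>

lemma L2_set_mat_le:
  fixes A :: "nat \<Rightarrow> nat \<Rightarrow> real"
  assumes "L2_set v {1..n} \<le> 1"
  shows "L2_set (\<lambda>i. \<Sum>j = 1..n. A i j * v j) {1..n} \<le> (\<Sum>i = 1..n. \<Sum>j = 1..n. \<bar>A i j\<bar>)"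
proof -
  have v: "\<bar>v j\<bar> \<le> 1" if "j \<in> {1..n}" for j
  proof -
    have "\<bar>v j\<bar> \<le> L2_set (\<lambda>j. \<bar>v j\<bar>) {1..n}" by (rule member_le_L2_set) (use that in auto)
    also have "\<dots> = L2_set v {1..n}" by (simp add: L2_set_def)
    finally show ?thesis using assms by linarith
  qed
  have "L2_set (\<lambda>i. \<Sum>j = 1..n. A i j * v j) {1..n} \<le> (\<Sum>i = 1..n. \<bar>\<Sum>j = 1..n. A i j * v j\<bar>)"
    by (rule L2_set_le_sum_abs)
  also have "\<dots> \<le> (\<Sum>i = 1..n. \<Sum>j = 1..n. \<bar>A i j\<bar>)"
  proof (rule sum_mono, rule order_trans[OF sum_abs], rule sum_mono)
    fix i j assume "j \<in> {1..n}"
    then show "\<bar>A i j * v j\<bar> \<le> \<bar>A i j\<bar>"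
      using mult_left_mono[OF v, of j "\<bar>A i j\<bar>"] by (simp add: abs_mult)
  qed
  finally show ?thesis .
qed

lemma bdd_above_op_norm:
  fixes A :: "nat \<Rightarrow> nat \<Rightarrow> real"
  shows
  "bdd_above ((\<lambda>v. L2_set (\<lambda>i. \<Sum>j = 1..n. A i j * v j) {1..n}) ` {v. L2_set v {1..n} \<le> 1})"
  by (rule bdd_aboveI2) (use L2_set_mat_le in blast)

lemma unit_ball_nonempty: "{v :: nat \<Rightarrow> real. L2_set v {1..n} \<le> 1} \<noteq> {}"
proof -
  have "(\<lambda>_. 0) \<in> {v :: nat \<Rightarrow> real. L2_set v {1..n} \<le> 1}" by (simp add: L2_set_def)
  then show ?thesis by blast
qed

lemma L2_set_mat_le_op_norm:
  assumes "L2_set v {1..n} \<le> 1"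
  shows "L2_set (\<lambda>i. \<Sum>j = 1..n. A i j * v j) {1..n} \<le> op_norm n A"
  unfolding op_norm_def by (rule cSUP_upper[OF _ bdd_above_op_norm]) (use assms in simp)

lemma op_norm_nonneg: "0 \<le> op_norm n A"
  using L2_set_mat_le_op_norm[of "\<lambda>_. 0" n A] by (simp add: L2_set_def)

lemma op_norm_le_entries: "op_norm n A \<le> (\<Sum>i = 1..n. \<Sum>j = 1..n. \<bar>A i j\<bar>)"
  unfolding op_norm_def by (rule cSUP_least[OF unit_ball_nonempty]) (use L2_set_mat_le in blast)

text \<open>Lipschitz dependence on the entries: the source of continuity, and hence of
  measurability, of the norm of a random matrix.\<close>

lemma op_norm_perturb: "op_norm n A \<le> op_norm n B + (\<Sum>i = 1..n. \<Sum>j = 1..n. \<bar>A i j - B i j\<bar>)"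
  unfolding op_norm_def[of n A]
proof (rule cSUP_least[OF unit_ball_nonempty])
  fix v :: "nat \<Rightarrow> real" assume "v \<in> {v. L2_set v {1..n} \<le> 1}"
  then have v: "L2_set v {1..n} \<le> 1" by simp
  have "L2_set (\<lambda>i. \<Sum>j = 1..n. A i j * v j) {1..n}
      = L2_set (\<lambda>i. (\<Sum>j = 1..n. B i j * v j) + (\<Sum>j = 1..n. (A i j - B i j) * v j)) {1..n}"
    by (simp add: sum.distrib[symmetric] algebra_simps)
  also have "\<dots> \<le> L2_set (\<lambda>i. \<Sum>j = 1..n. B i j * v j) {1..n}
      + L2_set (\<lambda>i. \<Sum>j = 1..n. (A i j - B i j) * v j) {1..n}"
    by (rule L2_set_triangle_ineq)
  also have "\<dots> \<le> op_norm n B + (\<Sum>i = 1..n. \<Sum>j = 1..n. \<bar>A i j - B i j\<bar>)"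
    by (intro add_mono L2_set_mat_le_op_norm L2_set_mat_le v)
  finally show "L2_set (\<lambda>i. \<Sum>j = 1..n. A i j * v j) {1..n} \<le> \<dots>" .
qed

lemma quadratic_form_le_op_norm:
  "(\<Sum>i = 1..n. \<Sum>j = 1..n. r i * A i j * r j) \<le> op_norm n A * (\<Sum>i = 1..n. (r i)\<^sup>2)"
proof (cases "L2_set r {1..n} = 0")
  case True
  then have "r i = 0" if "i \<in> {1..n}" for i
    using that by (simp add: L2_set_eq_0_iff)
  then show ?thesis by (auto intro!: sum_nonpos)
next
  case False
  define c where "c = L2_set r {1..n}"
  have c: "0 < c" using False L2_set_nonneg[of r "{1..n}"] unfolding c_def by linarith
  have c2: "c\<^sup>2 = (\<Sum>i = 1..n. (r i)\<^sup>2)" by (simp add: c_def L2_set_def sum_nonneg)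
  have "L2_set (\<lambda>j. r j / c) {1..n} = 1"
    using L2_set_right_distrib[of "1 / c" r "{1..n}"] c by (simp add: c_def)
  then have *: "L2_set (\<lambda>i. \<Sum>j = 1..n. A i j * (r j / c)) {1..n} \<le> op_norm n A"
    by (intro L2_set_mat_le_op_norm) simp
  have Ar: "L2_set (\<lambda>i. \<Sum>j = 1..n. A i j * r j) {1..n} \<le> op_norm n A * c"
  proof -
    have "(\<lambda>i. \<Sum>j = 1..n. A i j * r j) = (\<lambda>i. c * (\<Sum>j = 1..n. A i j * (r j / c)))"
      using c by (auto simp: sum_distrib_left intro!: sum.cong)
    then have "L2_set (\<lambda>i. \<Sum>j = 1..n. A i j * r j) {1..n} = c * L2_set (\<lambda>i. \<Sum>j = 1..n. A i j * (r j / c)) {1..n}"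
      using L2_set_right_distrib[of c "\<lambda>i. \<Sum>j = 1..n. A i j * (r j / c)" "{1..n}"] c by simp
    also have "\<dots> \<le> c * op_norm n A" using * c by (intro mult_left_mono) auto
    finally show ?thesis by (simp add: mult.commute)
  qed
  have "(\<Sum>i = 1..n. \<Sum>j = 1..n. r i * A i j * r j) = (\<Sum>i = 1..n. r i * (\<Sum>j = 1..n. A i j * r j))"
    by (simp add: sum_distrib_left mult.assoc)
  also have "\<dots> \<le> (\<Sum>i = 1..n. \<bar>r i\<bar> * \<bar>\<Sum>j = 1..n. A i j * r j\<bar>)"
    by (rule sum_mono) (simp flip: abs_mult)
  also have "\<dots> \<le> c * L2_set (\<lambda>i. \<Sum>j = 1..n. A i j * r j) {1..n}"
    unfolding c_def by (rule L2_set_mult_ineq)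
  also have "\<dots> \<le> c * (op_norm n A * c)"
    using Ar c by (intro mult_left_mono) auto
  finally show ?thesis unfolding c2[symmetric] by (simp add: power2_eq_square mult_ac)
qed

lemma continuous_on_op_norm:
  fixes A :: "'b::t2_space \<Rightarrow> nat \<Rightarrow> nat \<Rightarrow> real"
  assumes "\<And>i j. i \<in> {1..n} \<Longrightarrow> j \<in> {1..n} \<Longrightarrow> continuous_on UNIV (\<lambda>w. A w i j)"
  shows "continuous_on UNIV (\<lambda>w. op_norm n (A w))"
  unfolding continuous_on_eq_continuous_at[OF open_UNIV] isCont_def
proof (intro ballI)
  fix w
  have lim: "((\<lambda>w'. \<Sum>i = 1..n. \<Sum>j = 1..n. \<bar>A w' i j - A w i j\<bar>) \<longlongrightarrow> 0) (at w)"
  proof (intro tendsto_null_sum)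
    fix i j assume "i \<in> {1..n}" "j \<in> {1..n}"
    then have "((\<lambda>w'. A w' i j) \<longlongrightarrow> A w i j) (at w)"
      using assms by (simp add: continuous_on_def)
    then show "((\<lambda>w'. \<bar>A w' i j - A w i j\<bar>) \<longlongrightarrow> 0) (at w)"
      by (simp add: tendsto_rabs_zero_iff LIM_zero)
  qed
  have "norm (op_norm n (A w') - op_norm n (A w)) \<le> (\<Sum>i = 1..n. \<Sum>j = 1..n. \<bar>A w' i j - A w i j\<bar>)" for w'
    using op_norm_perturb[of n "A w'" "A w"] op_norm_perturb[of n "A w" "A w'"]
    by (simp add: abs_minus_commute abs_le_iff)
  then have "((\<lambda>w'. op_norm n (A w') - op_norm n (A w)) \<longlongrightarrow> 0) (at w)"
    by (intro Lim_null_comparison[OF _ lim] always_eventually) blast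
  then show "((\<lambda>w'. op_norm n (A w')) \<longlongrightarrow> op_norm n (A w)) (at w)"
    by (rule LIM_zero_cancel)
qed

section \<open>The disorder as a parameter\<close>

definition sites :: "nat \<Rightarrow> nat set" where
  "sites n = {1..n}"

lemma finite_sites [simp]: "finite (sites n)"
  and card_sites [simp]: "card (sites n) = n"
  by (simp_all add: sites_def)

text \<open>The disorder coordinate shared by the matrix entries ij and ji, written with the smaller
  index first as in \<open>sk_pairs\<close>.\<close>

definition pair_of :: "nat \<Rightarrow> nat \<Rightarrow> nat \<times> nat" where
  "pair_of i j = (min i j, max i j)"

lemma pair_of_commute: "pair_of i j = pair_of j i"
  by (simp add: pair_of_def min.commute max.commute)

lemma pair_of_eq_iff: "pair_of k l = pair_of i j \<longleftrightarrow> (k = i \<and> l = j) \<or> (k = j \<and> l = i)"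
  by (auto simp: pair_of_def min_def max_def split: if_splits)

lemma pair_of_in_sk_pairs: "i \<in> sites n \<Longrightarrow> j \<in> sites n \<Longrightarrow> i \<noteq> j \<Longrightarrow> pair_of i j \<in> sk_pairs n"
  by (auto simp: pair_of_def sk_pairs_def sites_def min_def max_def)

lemma finite_sk_pairs: "finite (sk_pairs n)"
  by (rule finite_subset[of _ "sites n \<times> sites n"]) (auto simp: sk_pairs_def sites_def)

definition coupling :: "nat \<Rightarrow> (nat \<times> nat \<Rightarrow> real) \<Rightarrow> nat \<Rightarrow> nat \<Rightarrow> real" where
  "coupling n w i j = (if i = j then 0 else w (pair_of i j) / sqrt n)"

lemma coupling_upd:
  assumes "i \<noteq> j"
  shows "coupling n (w(pair_of i j := y')) k l - coupling n (w(pair_of i j := y)) k l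
    = (y' - y) / sqrt n * (of_bool (k = i) * of_bool (l = j) + of_bool (k = j) * of_bool (l = i))"
  using assms by (auto simp: coupling_def pair_of_eq_iff diff_divide_distrib)

definition sk_resolvent :: "nat \<Rightarrow> real \<Rightarrow> (nat \<times> nat \<Rightarrow> real) \<Rightarrow> nat \<Rightarrow> nat \<Rightarrow> complex" where
  "sk_resolvent n \<eta> w = resolvent (sites n) (Complex 2 \<eta>) (coupling n w)"

lemma sym_resolvent_coupling: "0 < \<eta> \<Longrightarrow> sym_resolvent (sites n) (Complex 2 \<eta>) (coupling n w)"
  by unfold_locales (simp_all add: coupling_def pair_of_commute)

lemma cmod_sk_resolvent_le:
  assumes "0 < \<eta>" "i \<in> sites n" "j \<in> sites n"
  shows "cmod (sk_resolvent n \<eta> w i j) \<le> 1 / \<eta>"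
proof -
  interpret sym_resolvent "sites n" "Complex 2 \<eta>" "coupling n w"
    using assms(1) by (rule sym_resolvent_coupling)
  show ?thesis using cmod_resolvent_le[OF assms(2,3)] by (simp add: sk_resolvent_def)
qed

lemma continuous_on_coupling: "continuous_on UNIV (\<lambda>w. coupling n w k l)"
proof (cases "k = l")
  case False
  then have "(\<lambda>w. coupling n w k l) = (\<lambda>w. w (pair_of k l) * (1 / sqrt n))"
    by (simp add: coupling_def)
  then show ?thesis
    by (simp only: continuous_on_mult continuous_on_const continuous_on_product_coordinates)
qed (simp add: coupling_def)

lemma continuous_on_sk_resolvent:
  assumes \<eta>: "0 < \<eta>" and ij: "i \<in> sites n" "j \<in> sites n"
  shows "continuous_on UNIV (\<lambda>w. sk_resolvent n \<eta> w i j)"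
  unfolding continuous_on_eq_continuous_at[OF open_UNIV] isCont_def
proof (intro ballI)
  fix w
  let ?d = "\<lambda>w'. \<Sum>k\<in>sites n. \<Sum>l\<in>sites n. \<bar>coupling n w' k l - coupling n w k l\<bar> / \<eta>\<^sup>2"
  have lim: "(?d \<longlongrightarrow> 0) (at w)"
  proof (intro tendsto_null_sum)
    fix k l
    have "((\<lambda>w'. coupling n w' k l) \<longlongrightarrow> coupling n w k l) (at w)"
      using continuous_on_coupling[of n k l] by (simp add: continuous_on_def)
    then have "((\<lambda>w'. \<bar>coupling n w' k l - coupling n w k l\<bar>) \<longlongrightarrow> 0) (at w)"
      by (simp add: tendsto_rabs_zero_iff LIM_zero)
    then show "((\<lambda>w'. \<bar>coupling n w' k l - coupling n w k l\<bar> / \<eta>\<^sup>2) \<longlongrightarrow> 0) (at w)"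
      by (rule tendsto_divide_zero)
  qed
  have "norm (sk_resolvent n \<eta> w' i j - sk_resolvent n \<eta> w i j) \<le> ?d w'" for w'
  proof -
    have eq: "sk_resolvent n \<eta> w' i j - sk_resolvent n \<eta> w i j = (\<Sum>k\<in>sites n. \<Sum>l\<in>sites n.
        sk_resolvent n \<eta> w i k * (coupling n w' k l - coupling n w k l) * sk_resolvent n \<eta> w' l j)"
      unfolding sk_resolvent_def
      by (rule resolvent_identity[OF sym_resolvent_coupling[OF \<eta>] sym_resolvent_coupling[OF \<eta>] ij])
    show ?thesis
      unfolding eq
    proof (intro sum_norm_le)
      fix k l assume kl: "k \<in> sites n" "l \<in> sites n"
      have "norm (sk_resolvent n \<eta> w i k * (coupling n w' k l - coupling n w k l) * sk_resolvent n \<eta> w' l j)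
          = \<bar>coupling n w' k l - coupling n w k l\<bar> * (cmod (sk_resolvent n \<eta> w i k) * cmod (sk_resolvent n \<eta> w' l j))"
        by (simp add: norm_mult flip: of_real_diff)
      also have "\<dots> \<le> \<bar>coupling n w' k l - coupling n w k l\<bar> * (1 / \<eta> * (1 / \<eta>))"
        using kl ij \<eta> by (intro mult_left_mono mult_mono cmod_sk_resolvent_le) auto
      finally show "norm (sk_resolvent n \<eta> w i k * (coupling n w' k l - coupling n w k l) * sk_resolvent n \<eta> w' l j)
          \<le> \<bar>coupling n w' k l - coupling n w k l\<bar> / \<eta>\<^sup>2" by (simp add: power2_eq_square)
    qed
  qed
  then have "((\<lambda>w'. sk_resolvent n \<eta> w' i j - sk_resolvent n \<eta> w i j) \<longlongrightarrow> 0) (at w)"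
    by (intro Lim_null_comparison[OF _ lim] always_eventually) blast
  then show "((\<lambda>w'. sk_resolvent n \<eta> w' i j) \<longlongrightarrow> sk_resolvent n \<eta> w i j) (at w)"
    by (rule LIM_zero_cancel)
qed

section \<open>Regularity in the disorder: slices, measurability, derivative of the
  resolvent\<close>

lemma continuous_on_fun_upd_const: "continuous_on UNIV (\<lambda>y. w(p := y) :: 'i \<Rightarrow> real)"
proof (rule continuous_on_coordinatewise_then_product)
  show "continuous_on UNIV (\<lambda>y. (w(p := y)) i)" for i
    by (cases "i = p") simp_all
qed

lemma continuous_on_slice:
  fixes F :: "('i \<Rightarrow> real) \<Rightarrow> 'b::topological_space"
  assumes "continuous_on UNIV F"
  shows "continuous_on UNIV (\<lambda>y. F (w(p := y)))"
  by (rule continuous_on_compose2[OF assms continuous_on_fun_upd_const]) simp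

text \<open>Over a countable index type measurability into the Borel sets of the product topology
  can be checked coordinate by coordinate. Measurability of functions of the disorder thus reduces
  to continuity.\<close>

lemma borel_measurable_gauss_prod_continuous:
  fixes F :: "('i::countable \<Rightarrow> real) \<Rightarrow> 'b::topological_space"
  assumes "continuous_on UNIV F"
  shows "F \<in> borel_measurable (gauss_prod J)"
proof -
  have "(\<lambda>w. w) \<in> measurable (gauss_prod J) (borel :: ('i \<Rightarrow> real) measure)"
  proof (rule measurable_coordinatewise_then_product)
    fix i
    show "(\<lambda>w. w i) \<in> borel_measurable (gauss_prod J)"
    proof (cases "i \<in> J")
      case True
      have "(\<lambda>w. w i) \<in> measurable (gauss_prod J) std_gauss"
        using True by (rule measurable_component_singleton)
      then show ?thesis by (simp add: measurable_cong_sets[OF refl sets_std_gauss])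
    next
      case False
      \<comment> \<open>Points of the product space take the value \<open>undefined\<close> outside
        \<open>J\<close>, so this coordinate is constant there.\<close>
      have "(\<lambda>w. w i) \<in> borel_measurable (gauss_prod J) \<longleftrightarrow> (\<lambda>w. undefined :: real) \<in> borel_measurable (gauss_prod J)"
        by (rule measurable_cong) (use False in \<open>auto simp: space_PiM PiE_def extensional_def\<close>)
      then show ?thesis by simp
    qed
  qed
  from measurable_compose[OF this borel_measurable_continuous_onI[OF assms]] show ?thesis .
qed

lemma sum_rank_one:
  fixes c :: "'a::comm_semiring_0"
  shows "(\<Sum>k\<in>K. \<Sum>l\<in>L. c * X k * Y l) = c * (sum X K * sum Y L)"
proof -
  have "(\<Sum>k\<in>K. \<Sum>l\<in>L. c * X k * Y l) = (\<Sum>k\<in>K. \<Sum>l\<in>L. c * (X k * Y l))"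
    by (simp add: mult.assoc)
  then show ?thesis by (simp only: sum_product) (simp only: sum_distrib_left)
qed

text \<open>Moving one disorder coordinate changes two entries of the coupling matrix. The resolvent
  identity gives the increment exactly as (y' - y) \<open>D y'\<close>, where the right factor is
  the moved resolvent; continuity of the resolvent then lets y' tend to y.\<close>

lemma has_vector_derivative_sk_resolvent:
  assumes \<eta>: "0 < \<eta>" and ij: "i \<in> sites n" "j \<in> sites n" "i \<noteq> j" and ab: "a \<in> sites n" "b \<in> sites n"
  shows "((\<lambda>y. sk_resolvent n \<eta> (w(pair_of i j := y)) a b) has_vector_derivative
    (let Q = sk_resolvent n \<eta> (w(pair_of i j := y)) in (Q a i * Q j b + Q a j * Q i b) / sqrt n)) (at y)"
proof -
  let ?Q = "\<lambda>y. sk_resolvent n \<eta> (w(pair_of i j := y))"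
  define D where "D y' = (?Q y a i * ?Q y' j b + ?Q y a j * ?Q y' i b) / sqrt n" for y'
  have diff: "?Q y' a b - ?Q y a b = (y' - y) *\<^sub>R D y'" for y'
  proof -
    let ?c = "complex_of_real ((y' - y) / sqrt n)"
    have "?Q y' a b - ?Q y a b = (\<Sum>k\<in>sites n. \<Sum>l\<in>sites n.
        ?Q y a k * complex_of_real (coupling n (w(pair_of i j := y')) k l - coupling n (w(pair_of i j := y)) k l) * ?Q y' l b)"
      unfolding sk_resolvent_def
      by (rule resolvent_identity[OF sym_resolvent_coupling[OF \<eta>] sym_resolvent_coupling[OF \<eta>] ab])
    also have "\<dots> = (\<Sum>k\<in>sites n. \<Sum>l\<in>sites n.
        ?c * (of_bool (k = i) * ?Q y a k) * (of_bool (l = j) * ?Q y' l b)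
        + ?c * (of_bool (k = j) * ?Q y a k) * (of_bool (l = i) * ?Q y' l b))"
      unfolding coupling_upd[OF ij(3)]
      by (intro sum.cong refl) (simp add: algebra_simps)
    also have "\<dots> = ?c * (?Q y a i * ?Q y' j b) + ?c * (?Q y a j * ?Q y' i b)"
      using ij by (simp only: sum.distrib sum_rank_one sum_of_bool_mult finite_sites)
    also have "\<dots> = (y' - y) *\<^sub>R D y'"
      by (simp add: D_def scaleR_conv_of_real algebra_simps add_divide_distrib)
    finally show ?thesis .
  qed
  have cont: "continuous_on UNIV (\<lambda>y. ?Q y c d)" if "c \<in> sites n" "d \<in> sites n" for c d
    by (rule continuous_on_slice[OF continuous_on_sk_resolvent[OF \<eta> that]])
  have "continuous_on UNIV D"
    unfolding D_def divide_inverse using ij ab by (intro continuous_intros cont) auto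
  then have "(D \<longlongrightarrow> D y) (at y)" by (simp add: continuous_on_def)
  then have lim: "((\<lambda>y'. norm (D y' - D y)) \<longlongrightarrow> 0) (at y)"
    using LIM_zero tendsto_norm_zero by blast
  have "((\<lambda>y'. (1 / norm (y' - y)) *\<^sub>R (?Q y' a b - (?Q y a b + (y' - y) *\<^sub>R D y))) \<longlongrightarrow> 0) (at y)"
  proof (rule Lim_null_comparison[OF _ lim], rule always_eventually, rule allI)
    fix y'
    have "?Q y' a b - (?Q y a b + (y' - y) *\<^sub>R D y) = (y' - y) *\<^sub>R (D y' - D y)"
      using diff[of y'] by (simp add: algebra_simps)
    then show "norm ((1 / norm (y' - y)) *\<^sub>R (?Q y' a b - (?Q y a b + (y' - y) *\<^sub>R D y))) \<le> norm (D y' - D y)"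
      by simp
  qed
  then have "((\<lambda>y. ?Q y a b) has_vector_derivative D y) (at y)"
    by (simp add: has_vector_derivative_def has_derivative_at2 bounded_linear_scaleR_left)
  then show ?thesis by (simp add: D_def Let_def)
qed

section \<open>Gibbs averages as functions of the disorder\<close>

definition gibbs_prob :: "real \<Rightarrow> nat \<Rightarrow> (nat \<times> nat \<Rightarrow> real) \<Rightarrow> (nat \<Rightarrow> real) \<Rightarrow> real" where
  "gibbs_prob \<beta> n w \<sigma> = sk_weight \<beta> n (curry w) \<sigma> / sk_partition \<beta> n (curry w)"

definition gibbs_cov :: "real \<Rightarrow> nat \<Rightarrow> (nat \<times> nat \<Rightarrow> real) \<Rightarrow> nat \<Rightarrow> nat \<Rightarrow> real" where
  "gibbs_cov \<beta> n w a b = (\<Sum>\<sigma>\<in>spins n. gibbs_prob \<beta> n w \<sigma> * (\<sigma> a * \<sigma> b))"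

lemma sk_cov_eq_gibbs_cov: "sk_cov \<beta> n (curry w) = gibbs_cov \<beta> n w"
  by (intro ext) (simp add: sk_cov_def integral_sk_gibbs gibbs_cov_def gibbs_prob_def
      sum_divide_distrib mult.commute)

lemma gibbs_prob_nonneg: "0 \<le> gibbs_prob \<beta> n w \<sigma>"
  by (simp add: gibbs_prob_def sk_weight_pos sk_partition_pos less_imp_le)

lemma sum_gibbs_prob: "(\<Sum>\<sigma>\<in>spins n. gibbs_prob \<beta> n w \<sigma>) = 1"
  using sk_partition_pos[of \<beta> n "curry w"]
  by (simp add: gibbs_prob_def sum_divide_distrib[symmetric] sk_partition_def)

lemma gibbs_average_le:
  assumes "\<And>\<sigma>. \<sigma> \<in> spins n \<Longrightarrow> h \<sigma> \<le> c"
  shows "(\<Sum>\<sigma>\<in>spins n. gibbs_prob \<beta> n w \<sigma> * h \<sigma>) \<le> c"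
proof -
  have "(\<Sum>\<sigma>\<in>spins n. gibbs_prob \<beta> n w \<sigma> * h \<sigma>) \<le> (\<Sum>\<sigma>\<in>spins n. gibbs_prob \<beta> n w \<sigma> * c)"
    by (intro sum_mono mult_left_mono gibbs_prob_nonneg assms)
  then show ?thesis by (simp add: sum_distrib_right[symmetric] sum_gibbs_prob)
qed

lemma norm_gibbs_average_le:
  fixes h :: "(nat \<Rightarrow> real) \<Rightarrow> complex"
  assumes "\<And>\<sigma>. \<sigma> \<in> spins n \<Longrightarrow> cmod (h \<sigma>) \<le> c"
  shows "cmod (\<Sum>\<sigma>\<in>spins n. gibbs_prob \<beta> n w \<sigma> * h \<sigma>) \<le> c"
proof -
  have "cmod (\<Sum>\<sigma>\<in>spins n. gibbs_prob \<beta> n w \<sigma> * h \<sigma>) \<le> (\<Sum>\<sigma>\<in>spins n. gibbs_prob \<beta> n w \<sigma> * cmod (h \<sigma>))"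
    by (rule order_trans[OF norm_sum]) (simp add: norm_mult gibbs_prob_nonneg)
  also have "\<dots> \<le> c" by (rule gibbs_average_le) (rule assms)
  finally show ?thesis .
qed

lemma spins_value: "\<sigma> \<in> spins n \<Longrightarrow> i \<in> sites n \<Longrightarrow> \<sigma> i = -1 \<or> \<sigma> i = 1"
  unfolding spins_def sites_def using PiE_mem[of \<sigma> "{1..n}" "\<lambda>_. {-1, 1}" i] by simp

lemma spins_square: "\<sigma> \<in> spins n \<Longrightarrow> i \<in> sites n \<Longrightarrow> \<sigma> i * \<sigma> i = 1"
  using spins_value by fastforce

lemma spins_abs: "\<sigma> \<in> spins n \<Longrightarrow> i \<in> sites n \<Longrightarrow> \<bar>\<sigma> i\<bar> = 1"
  using spins_value by fastforce

lemma gibbs_cov_commute: "gibbs_cov \<beta> n w a b = gibbs_cov \<beta> n w b a"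
  by (simp add: gibbs_cov_def mult.commute)

lemma gibbs_cov_diag: "a \<in> sites n \<Longrightarrow> gibbs_cov \<beta> n w a a = 1"
  by (simp add: gibbs_cov_def spins_square sum_gibbs_prob)

lemma abs_gibbs_cov_le:
  assumes "a \<in> sites n" "b \<in> sites n"
  shows "\<bar>gibbs_cov \<beta> n w a b\<bar> \<le> 1"
proof -
  have "\<bar>gibbs_cov \<beta> n w a b\<bar> \<le> (\<Sum>\<sigma>\<in>spins n. gibbs_prob \<beta> n w \<sigma> * \<bar>\<sigma> a * \<sigma> b\<bar>)"
    unfolding gibbs_cov_def by (rule order_trans[OF sum_abs]) (simp add: abs_mult gibbs_prob_nonneg)
  also have "\<dots> \<le> 1" by (rule gibbs_average_le) (use assms in \<open>simp add: abs_mult spins_abs\<close>)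
  finally show ?thesis .
qed

lemma sk_weight_curry:
  "sk_weight \<beta> n (curry w) \<sigma> = exp (\<beta> / sqrt n * (\<Sum>p\<in>sk_pairs n. w p * (\<sigma> (fst p) * \<sigma> (snd p))))"
  by (simp add: sk_weight_def case_prod_beta' mult.assoc)

lemma continuous_on_sk_weight: "continuous_on UNIV (\<lambda>w. sk_weight \<beta> n (curry w) \<sigma>)"
  unfolding sk_weight_curry
  by (intro continuous_on_exp continuous_on_mult continuous_on_const continuous_on_sum
      continuous_on_product_coordinates)

lemma continuous_on_gibbs_prob: "continuous_on UNIV (\<lambda>w. gibbs_prob \<beta> n w \<sigma>)"
  unfolding gibbs_prob_def sk_partition_def
  by (intro continuous_on_divide continuous_on_sum continuous_on_sk_weight ballI)
     (metis sk_partition_def sk_partition_pos less_irrefl)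

lemma continuous_on_gibbs_cov: "continuous_on UNIV (\<lambda>w. gibbs_cov \<beta> n w a b)"
  unfolding gibbs_cov_def
  by (intro continuous_on_mult continuous_on_const continuous_on_sum continuous_on_gibbs_prob)

lemma has_real_derivative_gibbs_prob:
  assumes ij: "i \<in> sites n" "j \<in> sites n" "i \<noteq> j"
  shows "((\<lambda>y. gibbs_prob \<beta> n (w(pair_of i j := y)) \<sigma>) has_real_derivative
    (let v = w(pair_of i j := y) in \<beta> / sqrt n * (gibbs_prob \<beta> n v \<sigma> * (\<sigma> i * \<sigma> j - gibbs_cov \<beta> n v i j)))) (at y)"
proof -
  let ?p = "pair_of i j"
  let ?W = "\<lambda>y \<sigma>. sk_weight \<beta> n (curry (w(?p := y))) \<sigma>"
  let ?Z = "\<lambda>y. sk_partition \<beta> n (curry (w(?p := y)))"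
  have p: "?p \<in> sk_pairs n" using ij by (rule pair_of_in_sk_pairs)
  have s: "\<sigma> (fst ?p) * \<sigma> (snd ?p) = \<sigma> i * \<sigma> j" for \<sigma> :: "nat \<Rightarrow> real"
    by (simp add: pair_of_def min_def max_def)
  have sum_eq: "(\<Sum>q\<in>sk_pairs n. (w(?p := y)) q * (\<sigma> (fst q) * \<sigma> (snd q)))
      = y * (\<sigma> i * \<sigma> j) + (\<Sum>q\<in>sk_pairs n - {?p}. w q * (\<sigma> (fst q) * \<sigma> (snd q)))" for y and \<sigma> :: "nat \<Rightarrow> real"
  proof -
    have "(\<Sum>q\<in>sk_pairs n - {?p}. (w(?p := y)) q * (\<sigma> (fst q) * \<sigma> (snd q)))
        = (\<Sum>q\<in>sk_pairs n - {?p}. w q * (\<sigma> (fst q) * \<sigma> (snd q)))"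
      by (rule sum.cong) auto
    then show ?thesis by (simp add: sum.remove[OF finite_sk_pairs p] s)
  qed
  have W: "((\<lambda>y. ?W y \<sigma>) has_real_derivative \<beta> / sqrt n * (\<sigma> i * \<sigma> j) * ?W y \<sigma>) (at y)" for \<sigma>
  proof -
    have "((\<lambda>y. exp (c * (y * s + k))) has_real_derivative c * s * exp (c * (y * s + k))) (at y)"
      for c s k :: real
      by (auto intro!: derivative_eq_intros)
    then show ?thesis unfolding sk_weight_curry sum_eq .
  qed
  have Z: "(?Z has_real_derivative (\<Sum>\<sigma>\<in>spins n. \<beta> / sqrt n * (\<sigma> i * \<sigma> j) * ?W y \<sigma>)) (at y)"
    unfolding sk_partition_def by (intro DERIV_sum W)
  have Z0: "?Z y \<noteq> 0" using sk_partition_pos less_irrefl by metis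
  have cov: "(\<Sum>\<sigma>\<in>spins n. \<beta> / sqrt n * (\<sigma> i * \<sigma> j) * ?W y \<sigma>) = \<beta> / sqrt n * gibbs_cov \<beta> n (w(?p := y)) i j * ?Z y"
    using Z0 by (simp add: gibbs_cov_def gibbs_prob_def sum_distrib_left sum_distrib_right mult_ac)
  show ?thesis
    unfolding gibbs_prob_def Let_def
  proof (rule DERIV_cong[OF DERIV_divide[OF W Z Z0]])
    have "(c * s * W * Z - W * (c * C * Z)) / (Z * Z) = c * (W / Z * (s - C))" if "Z \<noteq> 0" for c s W Z C :: real
      using that by (simp add: field_simps)
    from this[OF Z0]
    show "(\<beta> / sqrt n * (\<sigma> i * \<sigma> j) * ?W y \<sigma> * ?Z y
        - ?W y \<sigma> * (\<Sum>\<sigma>\<in>spins n. \<beta> / sqrt n * (\<sigma> i * \<sigma> j) * ?W y \<sigma>)) / (?Z y * ?Z y)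
      = \<beta> / sqrt n * (?W y \<sigma> / ?Z y * (\<sigma> i * \<sigma> j - gibbs_cov \<beta> n (w(?p := y)) i j))"
      unfolding cov .
  qed
qed

lemma has_real_derivative_gibbs_cov:
  assumes ij: "i \<in> sites n" "j \<in> sites n" "i \<noteq> j"
  shows "((\<lambda>y. gibbs_cov \<beta> n (w(pair_of i j := y)) a i) has_real_derivative
    (let v = w(pair_of i j := y) in \<beta> / sqrt n * (gibbs_cov \<beta> n v a j - gibbs_cov \<beta> n v a i * gibbs_cov \<beta> n v i j))) (at y)"
proof -
  let ?v = "w(pair_of i j := y)"
  have "((\<lambda>y. gibbs_cov \<beta> n (w(pair_of i j := y)) a i) has_real_derivative
    (\<Sum>\<sigma>\<in>spins n. \<beta> / sqrt n * (gibbs_prob \<beta> n ?v \<sigma> * (\<sigma> i * \<sigma> j - gibbs_cov \<beta> n ?v i j)) * (\<sigma> a * \<sigma> i))) (at y)"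
    unfolding gibbs_cov_def[of \<beta> n "w(pair_of i j := _)" a i]
    by (intro DERIV_sum DERIV_cmult_right has_real_derivative_gibbs_prob[OF ij, unfolded Let_def])
  also have "(\<Sum>\<sigma>\<in>spins n. \<beta> / sqrt n * (gibbs_prob \<beta> n ?v \<sigma> * (\<sigma> i * \<sigma> j - gibbs_cov \<beta> n ?v i j)) * (\<sigma> a * \<sigma> i))
    = (\<Sum>\<sigma>\<in>spins n. \<beta> / sqrt n * (gibbs_prob \<beta> n ?v \<sigma> * (\<sigma> a * \<sigma> j))
        - \<beta> / sqrt n * gibbs_cov \<beta> n ?v i j * (gibbs_prob \<beta> n ?v \<sigma> * (\<sigma> a * \<sigma> i)))"
  proof (rule sum.cong)
    fix \<sigma> assume "\<sigma> \<in> spins n"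
    then have "\<sigma> i * \<sigma> i = 1" using ij(1) by (rule spins_square)
    then have "\<sigma> i * \<sigma> j * (\<sigma> a * \<sigma> i) = \<sigma> a * \<sigma> j"
      by (metis mult.commute mult.left_commute mult_1_right)
    then have "(\<sigma> i * \<sigma> j - gibbs_cov \<beta> n ?v i j) * (\<sigma> a * \<sigma> i) = \<sigma> a * \<sigma> j - gibbs_cov \<beta> n ?v i j * (\<sigma> a * \<sigma> i)"
      by (simp only: left_diff_distrib)
    then have "\<beta> / sqrt n * (gibbs_prob \<beta> n ?v \<sigma> * (\<sigma> i * \<sigma> j - gibbs_cov \<beta> n ?v i j)) * (\<sigma> a * \<sigma> i)
      = \<beta> / sqrt n * (gibbs_prob \<beta> n ?v \<sigma> * (\<sigma> a * \<sigma> j - gibbs_cov \<beta> n ?v i j * (\<sigma> a * \<sigma> i)))"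
      by (simp only: mult.assoc)
    then show "\<beta> / sqrt n * (gibbs_prob \<beta> n ?v \<sigma> * (\<sigma> i * \<sigma> j - gibbs_cov \<beta> n ?v i j)) * (\<sigma> a * \<sigma> i)
      = \<beta> / sqrt n * (gibbs_prob \<beta> n ?v \<sigma> * (\<sigma> a * \<sigma> j))
        - \<beta> / sqrt n * gibbs_cov \<beta> n ?v i j * (gibbs_prob \<beta> n ?v \<sigma> * (\<sigma> a * \<sigma> i))"
      by (simp only: right_diff_distrib mult_ac)
  qed simp
  also have "\<dots> = \<beta> / sqrt n * gibbs_cov \<beta> n ?v a j - \<beta> / sqrt n * gibbs_cov \<beta> n ?v i j * gibbs_cov \<beta> n ?v a i"
    by (simp only: sum_subtractf sum_distrib_left[symmetric] gibbs_cov_def[symmetric])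
  also have "\<dots> = (let v = ?v in \<beta> / sqrt n * (gibbs_cov \<beta> n v a j - gibbs_cov \<beta> n v a i * gibbs_cov \<beta> n v i j))"
    by (simp add: Let_def algebra_simps)
  finally show ?thesis .
qed

section \<open>Loop equations\<close>

locale sk_model =
  fixes n :: nat and \<beta> \<eta> :: real
  assumes n_pos: "0 < n" and eta_pos: "0 < \<eta>"
begin

abbreviation "S \<equiv> sites n"
abbreviation "N \<equiv> gauss_prod (sk_pairs n)"
abbreviation "z \<equiv> Complex 2 \<eta>"
abbreviation "Q \<equiv> sk_resolvent n \<eta>"
abbreviation "M \<equiv> gibbs_cov \<beta> n"
abbreviation "opn w \<equiv> op_norm n (M w)"
abbreviation "spin \<sigma> \<equiv> \<lambda>i. complex_of_real (\<sigma> i)"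
abbreviation "gap w \<equiv> gibbs_prob \<beta> n w"

text \<open>The matrix Q M of the overview. The index order \<open>j i\<close> is the one that pairs
  with \<open>coupling n w i j\<close> in a trace.\<close>

definition "K w j i = (\<Sum>a\<in>S. Q w j a * complex_of_real (M w a i))"
definition "trQ w = (\<Sum>i\<in>S. Q w i i)"
definition "trK w = (\<Sum>i\<in>S. K w i i)"

sublocale N: prob_space N
  by (rule prob_space_gauss_prod)

lemma sym_resolvent_sk: "sym_resolvent S z (coupling n w)"
  by (rule sym_resolvent_coupling[OF eta_pos])

lemma trace_coupling_resolvent:
  "(\<Sum>i\<in>S. \<Sum>j\<in>S. coupling n w i j * Q w j i) = z * trQ w - n"
proof -
  interpret R: sym_resolvent S z "coupling n w" by (rule sym_resolvent_sk)
  have "(\<Sum>i\<in>S. \<Sum>j\<in>S. coupling n w i j * Q w j i) = (\<Sum>i\<in>S. z * Q w i i - 1)"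
    unfolding sk_resolvent_def by (rule sum.cong) (simp_all add: R.resolvent_right)
  then show ?thesis by (simp add: sum_subtractf trQ_def sum_distrib_left)
qed

text \<open>G Q M = z Q M - M, and the trace of M is n because its diagonal entries are 1.\<close>

lemma trace_coupling_K:
  "(\<Sum>i\<in>S. \<Sum>j\<in>S. coupling n w i j * K w j i) = z * trK w - n"
proof -
  interpret R: sym_resolvent S z "coupling n w" by (rule sym_resolvent_sk)
  have "(\<Sum>j\<in>S. coupling n w i j * K w j i) = z * K w i i - 1" if i: "i \<in> S" for i
  proof -
    have "(\<Sum>j\<in>S. coupling n w i j * K w j i) = (\<Sum>a\<in>S. (\<Sum>j\<in>S. coupling n w i j * Q w j a) * M w a i)"
      unfolding K_def sum_distrib_left sum_distrib_right by (subst sum.swap) (simp add: mult.assoc)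
    also have "\<dots> = (\<Sum>a\<in>S. (z * Q w i a - of_bool (i = a)) * M w a i)"
      unfolding sk_resolvent_def by (rule sum.cong) (simp_all only: R.resolvent_right i)
    also have "\<dots> = z * (\<Sum>a\<in>S. Q w i a * M w a i) - (\<Sum>a\<in>S. of_bool (i = a) * complex_of_real (M w a i))"
      by (simp add: left_diff_distrib sum_subtractf sum_distrib_left mult.assoc)
    also have "\<dots> = z * K w i i - 1"
      using i by (simp add: K_def gibbs_cov_diag)
    finally show ?thesis .
  qed
  then have "(\<Sum>i\<in>S. \<Sum>j\<in>S. coupling n w i j * K w j i) = (\<Sum>i\<in>S. z * K w i i - 1)" by simp
  then show ?thesis by (simp add: sum_subtractf trK_def sum_distrib_left)
qed

text \<open>M averages the rank one matrices \<sigma> \<sigma>^T, so \<open>K\<close> averages the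
  outer products of Q \<sigma> and \<sigma>. Traces become averages of forms in vectors of squared
  norm n, which are bounded uniformly in the disorder.\<close>

lemma K_eq_gibbs: "K w j i = (\<Sum>\<sigma>\<in>spins n. gap w \<sigma> * (mat_app S (Q w) (spin \<sigma>) j * spin \<sigma> i))"
proof -
  have "K w j i = (\<Sum>a\<in>S. \<Sum>\<sigma>\<in>spins n. Q w j a * (gap w \<sigma> * (\<sigma> a * \<sigma> i)))"
    by (simp add: K_def gibbs_cov_def sum_distrib_left)
  also have "\<dots> = (\<Sum>\<sigma>\<in>spins n. \<Sum>a\<in>S. Q w j a * (gap w \<sigma> * (\<sigma> a * \<sigma> i)))"
    by (rule sum.swap)
  also have "\<dots> = (\<Sum>\<sigma>\<in>spins n. gap w \<sigma> * (mat_app S (Q w) (spin \<sigma>) j * spin \<sigma> i))"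
    by (simp add: mat_app_def sum_distrib_left sum_distrib_right mult_ac)
  finally show ?thesis .
qed

section \<open>Bounds on traces, uniform in the disorder or in terms of the operator norm\<close>

lemma nrm2_spin: "\<sigma> \<in> spins n \<Longrightarrow> nrm2 S (spin \<sigma>) = n"
  by (simp add: nrm2_def spins_abs)

lemma nrm2_app_spin:
  assumes "\<sigma> \<in> spins n"
  shows "nrm2 S (mat_app S (Q w) (spin \<sigma>)) \<le> n / \<eta>\<^sup>2"
proof -
  interpret R: sym_resolvent S z "coupling n w" by (rule sym_resolvent_sk)
  show ?thesis using R.nrm2_app_le[of "spin \<sigma>"] nrm2_spin[OF assms] by (simp add: sk_resolvent_def)
qed

text \<open>The double sum is the Gibbs average of the bilinear square, without conjugate, of the
  vector Q \<sigma>; its modulus is at most |Q \<sigma>|^2.\<close>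

lemma cmod_trace_Q2M_le: "cmod (\<Sum>i\<in>S. \<Sum>j\<in>S. Q w j i * K w j i) \<le> n / \<eta>\<^sup>2"
proof -
  have "(\<Sum>i\<in>S. \<Sum>j\<in>S. Q w j i * K w j i)
      = (\<Sum>i\<in>S. \<Sum>j\<in>S. \<Sum>\<sigma>\<in>spins n. gap w \<sigma> * (mat_app S (Q w) (spin \<sigma>) j * (Q w j i * spin \<sigma> i)))"
    by (simp add: K_eq_gibbs sum_distrib_left mult_ac)
  also have "\<dots> = (\<Sum>\<sigma>\<in>spins n. \<Sum>j\<in>S. \<Sum>i\<in>S. gap w \<sigma> * (mat_app S (Q w) (spin \<sigma>) j * (Q w j i * spin \<sigma> i)))"
    by (subst sum.swap, subst (2) sum.swap, subst sum.swap) (rule refl)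
  also have "\<dots> = (\<Sum>\<sigma>\<in>spins n. gap w \<sigma> * (\<Sum>j\<in>S. mat_app S (Q w) (spin \<sigma>) j * mat_app S (Q w) (spin \<sigma>) j))"
    by (simp add: sum_distrib_left[symmetric]) (simp add: mat_app_def)
  finally have eq: "(\<Sum>i\<in>S. \<Sum>j\<in>S. Q w j i * K w j i)
    = (\<Sum>\<sigma>\<in>spins n. gap w \<sigma> * (\<Sum>j\<in>S. mat_app S (Q w) (spin \<sigma>) j * mat_app S (Q w) (spin \<sigma>) j))" .
  show ?thesis
    unfolding eq
  proof (rule norm_gibbs_average_le)
    fix \<sigma> assume "\<sigma> \<in> spins n"
    then show "cmod (\<Sum>j\<in>S. mat_app S (Q w) (spin \<sigma>) j * mat_app S (Q w) (spin \<sigma>) j) \<le> n / \<eta>\<^sup>2"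
      using cmod_sum_mult_le[of "mat_app S (Q w) (spin \<sigma>)" "mat_app S (Q w) (spin \<sigma>)" S] nrm2_app_spin[of \<sigma> w]
      by simp
  qed
qed

lemma sum_cmod_app_spin:
  assumes "\<sigma> \<in> spins n"
  shows "(\<Sum>i\<in>S. cmod (mat_app S (Q w) (spin \<sigma>) i) * cmod (spin \<sigma> i)) \<le> n / \<eta>"
proof -
  have "(\<Sum>i\<in>S. cmod (mat_app S (Q w) (spin \<sigma>) i) * cmod (spin \<sigma> i))
      \<le> sqrt (nrm2 S (mat_app S (Q w) (spin \<sigma>))) * sqrt (nrm2 S (spin \<sigma>))"
    by (rule sum_cmod_mult_le)
  also have "\<dots> \<le> sqrt (n / \<eta>\<^sup>2) * sqrt n"
    using assms by (intro mult_mono) (simp_all add: nrm2_spin nrm2_app_spin)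
  also have "\<dots> = n / \<eta>" using eta_pos by (simp add: real_sqrt_divide)
  finally show ?thesis .
qed

lemma cmod_diag_QK_le: "cmod (\<Sum>i\<in>S. Q w i i * K w i i) \<le> n / \<eta>\<^sup>2"
proof -
  have eq: "(\<Sum>i\<in>S. Q w i i * K w i i)
      = (\<Sum>\<sigma>\<in>spins n. gap w \<sigma> * (\<Sum>i\<in>S. Q w i i * (mat_app S (Q w) (spin \<sigma>) i * spin \<sigma> i)))"
    unfolding K_eq_gibbs sum_distrib_left by (subst sum.swap) (simp add: mult_ac)
  show ?thesis
    unfolding eq
  proof (rule norm_gibbs_average_le)
    fix \<sigma> assume \<sigma>: "\<sigma> \<in> spins n"
    have "cmod (\<Sum>i\<in>S. Q w i i * (mat_app S (Q w) (spin \<sigma>) i * spin \<sigma> i))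
        \<le> (\<Sum>i\<in>S. 1 / \<eta> * (cmod (mat_app S (Q w) (spin \<sigma>) i) * cmod (spin \<sigma> i)))"
    proof (rule sum_norm_le)
      fix i assume i: "i \<in> S"
      show "cmod (Q w i i * (mat_app S (Q w) (spin \<sigma>) i * spin \<sigma> i))
          \<le> 1 / \<eta> * (cmod (mat_app S (Q w) (spin \<sigma>) i) * cmod (spin \<sigma> i))"
        unfolding norm_mult using cmod_sk_resolvent_le[OF eta_pos i i]
        by (intro mult_right_mono) auto
    qed
    also have "\<dots> \<le> 1 / \<eta> * (n / \<eta>)"
      unfolding sum_distrib_left[symmetric] using sum_cmod_app_spin[OF \<sigma>, of w] eta_pos
      by (intro mult_left_mono) auto
    finally show "cmod (\<Sum>i\<in>S. Q w i i * (mat_app S (Q w) (spin \<sigma>) i * spin \<sigma> i)) \<le> n / \<eta>\<^sup>2"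
      by (simp add: power2_eq_square)
  qed
qed

text \<open>Conjugating a real spin changes nothing; it brings the sum into the form that
  \<open>im_app\<close> evaluates.\<close>

lemma trK_eq_gibbs: "trK w = (\<Sum>\<sigma>\<in>spins n. gap w \<sigma> * (\<Sum>i\<in>S. cnj (spin \<sigma> i) * mat_app S (Q w) (spin \<sigma>) i))"
  unfolding trK_def K_eq_gibbs sum_distrib_left by (subst sum.swap) (simp add: mult_ac)

lemma cmod_trK_le: "cmod (trK w) \<le> n / \<eta>"
  unfolding trK_eq_gibbs
proof (rule norm_gibbs_average_le)
  fix \<sigma> assume \<sigma>: "\<sigma> \<in> spins n"
  have "cmod (\<Sum>i\<in>S. cnj (spin \<sigma> i) * mat_app S (Q w) (spin \<sigma>) i)
      \<le> (\<Sum>i\<in>S. cmod (mat_app S (Q w) (spin \<sigma>) i) * cmod (spin \<sigma> i))"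
    by (rule sum_norm_le) (simp add: norm_mult mult.commute)
  also have "\<dots> \<le> n / \<eta>" by (rule sum_cmod_app_spin[OF \<sigma>])
  finally show "cmod (\<Sum>i\<in>S. cnj (spin \<sigma> i) * mat_app S (Q w) (spin \<sigma>) i) \<le> n / \<eta>" .
qed

lemma im_trQ: "- Im (trQ w) = \<eta> * (\<Sum>i\<in>S. nrm2 S (\<lambda>j. Q w j i))"
proof -
  interpret R: sym_resolvent S z "coupling n w" by (rule sym_resolvent_sk)
  have "Im (Q w i i) = - \<eta> * nrm2 S (\<lambda>j. Q w j i)" if "i \<in> S" for i
    using R.im_diag[OF that] by (simp add: sk_resolvent_def)
  then show ?thesis by (simp add: trQ_def sum_distrib_left sum_negf)
qed

lemma im_trQ_nonneg: "0 \<le> - Im (trQ w)"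
  unfolding im_trQ using eta_pos by (simp add: sum_nonneg)

lemma cmod_trQ_le: "cmod (trQ w) \<le> n / \<eta>"
proof -
  have "cmod (trQ w) \<le> (\<Sum>i\<in>S. 1 / \<eta>)"
    unfolding trQ_def by (rule sum_norm_le) (simp add: cmod_sk_resolvent_le eta_pos)
  then show ?thesis by simp
qed

lemma gibbs_quadratic_form_le:
  "(\<Sum>\<sigma>\<in>spins n. gap w \<sigma> * (\<Sum>a\<in>S. r a * \<sigma> a)\<^sup>2) \<le> opn w * (\<Sum>a\<in>S. (r a)\<^sup>2)"
proof -
  have "(\<Sum>\<sigma>\<in>spins n. gap w \<sigma> * (\<Sum>a\<in>S. r a * \<sigma> a)\<^sup>2)
      = (\<Sum>\<sigma>\<in>spins n. \<Sum>a\<in>S. \<Sum>b\<in>S. r a * (gap w \<sigma> * (\<sigma> a * \<sigma> b)) * r b)"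
    by (simp add: power2_eq_square sum_product sum_distrib_left mult_ac)
  also have "\<dots> = (\<Sum>a\<in>S. \<Sum>b\<in>S. \<Sum>\<sigma>\<in>spins n. r a * (gap w \<sigma> * (\<sigma> a * \<sigma> b)) * r b)"
    by (subst sum.swap, subst (2) sum.swap) (rule refl)
  also have "\<dots> = (\<Sum>a\<in>S. \<Sum>b\<in>S. r a * M w a b * r b)"
    by (simp add: gibbs_cov_def sum_distrib_left sum_distrib_right)
  also have "\<dots> \<le> opn w * (\<Sum>a\<in>S. (r a)\<^sup>2)"
    unfolding sites_def by (rule quadratic_form_le_op_norm)
  finally show ?thesis .
qed

lemma im_trK: "- Im (trK w) = \<eta> * (\<Sum>\<sigma>\<in>spins n. gap w \<sigma> * nrm2 S (mat_app S (Q w) (spin \<sigma>)))"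
proof -
  interpret R: sym_resolvent S z "coupling n w" by (rule sym_resolvent_sk)
  have "Im (\<Sum>i\<in>S. cnj (spin \<sigma> i) * mat_app S (Q w) (spin \<sigma>) i) = - \<eta> * nrm2 S (mat_app S (Q w) (spin \<sigma>))" for \<sigma>
    using R.im_app[of "spin \<sigma>"] by (simp only: sk_resolvent_def complex.sel)
  moreover have "Im (trK w) = (\<Sum>\<sigma>\<in>spins n. gap w \<sigma> * Im (\<Sum>i\<in>S. cnj (spin \<sigma> i) * mat_app S (Q w) (spin \<sigma>) i))"
  proof -
    have "Im (\<Sum>\<sigma>\<in>spins n. complex_of_real (p \<sigma>) * X \<sigma>) = (\<Sum>\<sigma>\<in>spins n. p \<sigma> * Im (X \<sigma>))" for p X
      by simp
    then show ?thesis unfolding trK_eq_gibbs .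
  qed
  ultimately show ?thesis
    by (simp add: sum_distrib_left sum_negf mult_ac)
qed

text \<open>The trace inequality for the positive matrix - Im Q, row by row. As M is real, the real
  and imaginary parts of a row of Q are two real vectors to which the quadratic form bound applies.
  Symmetry of Q turns the rows into the columns of the Ward identity.\<close>

lemma im_trK_le_op_norm: "- Im (trK w) \<le> opn w * (- Im (trQ w))"
proof -
  interpret R: sym_resolvent S z "coupling n w" by (rule sym_resolvent_sk)
  have row: "(\<Sum>\<sigma>\<in>spins n. gap w \<sigma> * (cmod (mat_app S (Q w) (spin \<sigma>) i))\<^sup>2) \<le> opn w * nrm2 S (\<lambda>j. Q w j i)"
    if i: "i \<in> S" for i
  proof -
    have re: "Re (mat_app S (Q w) (spin \<sigma>) i) = (\<Sum>a\<in>S. Re (Q w i a) * \<sigma> a)"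
      and im: "Im (mat_app S (Q w) (spin \<sigma>) i) = (\<Sum>a\<in>S. Im (Q w i a) * \<sigma> a)" for \<sigma>
      by (simp_all add: mat_app_def)
    have "(\<Sum>\<sigma>\<in>spins n. gap w \<sigma> * (cmod (mat_app S (Q w) (spin \<sigma>) i))\<^sup>2)
        = (\<Sum>\<sigma>\<in>spins n. gap w \<sigma> * (\<Sum>a\<in>S. Re (Q w i a) * \<sigma> a)\<^sup>2) + (\<Sum>\<sigma>\<in>spins n. gap w \<sigma> * (\<Sum>a\<in>S. Im (Q w i a) * \<sigma> a)\<^sup>2)"
      unfolding cmod_power2 re im by (simp add: sum.distrib distrib_left)
    also have "\<dots> \<le> opn w * (\<Sum>a\<in>S. (Re (Q w i a))\<^sup>2) + opn w * (\<Sum>a\<in>S. (Im (Q w i a))\<^sup>2)"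
      by (intro add_mono gibbs_quadratic_form_le)
    also have "\<dots> = opn w * (\<Sum>a\<in>S. (cmod (Q w i a))\<^sup>2)"
      by (simp add: cmod_power2 sum.distrib distrib_left)
    also have "(\<Sum>a\<in>S. (cmod (Q w i a))\<^sup>2) = nrm2 S (\<lambda>j. Q w j i)"
      unfolding nrm2_def using R.resolvent_sym[OF i] by (intro sum.cong) (simp_all add: sk_resolvent_def)
    finally show ?thesis .
  qed
  have "(\<Sum>\<sigma>\<in>spins n. gap w \<sigma> * nrm2 S (mat_app S (Q w) (spin \<sigma>)))
      = (\<Sum>i\<in>S. \<Sum>\<sigma>\<in>spins n. gap w \<sigma> * (cmod (mat_app S (Q w) (spin \<sigma>) i))\<^sup>2)"
    unfolding nrm2_def sum_distrib_left by (rule sum.swap)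
  also have "\<dots> \<le> (\<Sum>i\<in>S. opn w * nrm2 S (\<lambda>j. Q w j i))"
    by (rule sum_mono) (rule row)
  finally show ?thesis
    unfolding im_trK im_trQ sum_distrib_left[symmetric] using eta_pos
    by (simp add: mult.left_commute)
qed

text \<open>Unfolding just one of the two factors M as a Gibbs average turns tr M^2 into the average
  of \<sigma>^T M \<sigma>, where |\<sigma>|^2 = n. Through this bound the operator norm enters the
  error of the loop equation for tr (Q M).\<close>

lemma sum_cov_square_le: "(\<Sum>i\<in>S. nrm2 S (\<lambda>a. complex_of_real (M w a i))) \<le> n * opn w"
proof -
  have "(\<Sum>i\<in>S. nrm2 S (\<lambda>a. complex_of_real (M w a i))) = (\<Sum>i\<in>S. \<Sum>a\<in>S. M w a i * M w i a)"
    by (simp add: nrm2_def power2_eq_square gibbs_cov_commute[of _ _ _ a i for a i])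
  also have "\<dots> = (\<Sum>i\<in>S. \<Sum>a\<in>S. \<Sum>\<sigma>\<in>spins n. gap w \<sigma> * (\<sigma> i * M w i a * \<sigma> a))"
    by (subst gibbs_cov_def) (simp add: sum_distrib_left sum_distrib_right mult_ac)
  also have "\<dots> = (\<Sum>\<sigma>\<in>spins n. \<Sum>i\<in>S. \<Sum>a\<in>S. gap w \<sigma> * (\<sigma> i * M w i a * \<sigma> a))"
    by (subst (2) sum.swap, subst sum.swap) (rule refl)
  also have "\<dots> = (\<Sum>\<sigma>\<in>spins n. gap w \<sigma> * (\<Sum>i\<in>S. \<Sum>a\<in>S. \<sigma> i * M w i a * \<sigma> a))"
    by (simp add: sum_distrib_left)
  also have "\<dots> \<le> n * opn w"
  proof (rule gibbs_average_le)
    fix \<sigma> assume \<sigma>: "\<sigma> \<in> spins n"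
    have "(\<Sum>i\<in>S. \<Sum>a\<in>S. \<sigma> i * M w i a * \<sigma> a) \<le> opn w * (\<Sum>i\<in>S. (\<sigma> i)\<^sup>2)"
      unfolding sites_def by (rule quadratic_form_le_op_norm)
    also have "(\<Sum>i\<in>S. (\<sigma> i)\<^sup>2) = n"
      using spins_square[OF \<sigma>] by (simp add: power2_eq_square)
    finally show "(\<Sum>i\<in>S. \<Sum>a\<in>S. \<sigma> i * M w i a * \<sigma> a) \<le> n * opn w" by (simp add: mult.commute)
  qed
  finally show ?thesis .
qed

lemma cmod_trace_QM2_le: "cmod (\<Sum>i\<in>S. \<Sum>j\<in>S. K w j i * M w i j) \<le> n * opn w / \<eta>"
proof -
  interpret R: sym_resolvent S z "coupling n w" by (rule sym_resolvent_sk)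
  let ?m = "\<lambda>i a. complex_of_real (M w a i)"
  have "cmod (\<Sum>j\<in>S. K w j i * M w i j) \<le> nrm2 S (?m i) / \<eta>" for i
  proof -
    have "(\<Sum>j\<in>S. K w j i * M w i j) = (\<Sum>j\<in>S. ?m i j * mat_app S (resolvent S z (coupling n w)) (?m i) j)"
      by (simp add: K_def mat_app_def sk_resolvent_def mult.commute gibbs_cov_commute[of _ _ _ i])
    then show ?thesis
      using R.cmod_bilinear_le[of "?m i" "?m i"] by simp
  qed
  then have "cmod (\<Sum>i\<in>S. \<Sum>j\<in>S. K w j i * M w i j) \<le> (\<Sum>i\<in>S. nrm2 S (?m i) / \<eta>)"
    by (rule sum_norm_le)
  also have "\<dots> \<le> n * opn w / \<eta>"
    using sum_cov_square_le[of w] eta_pos by (simp add: sum_divide_distrib[symmetric] divide_right_mono)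
  finally show ?thesis .
qed

lemma nrm2_col_Q_le: "i \<in> S \<Longrightarrow> nrm2 S (\<lambda>j. Q w j i) \<le> 1 / \<eta>\<^sup>2"
  using sym_resolvent.nrm2_col_le[OF sym_resolvent_sk] by (simp add: sk_resolvent_def)

lemma cmod_trace_Q2_le: "cmod (\<Sum>i\<in>S. \<Sum>j\<in>S. Q w j i * Q w j i) \<le> n / \<eta>\<^sup>2"
proof -
  have "cmod (\<Sum>i\<in>S. \<Sum>j\<in>S. Q w j i * Q w j i) \<le> (\<Sum>i\<in>S. 1 / \<eta>\<^sup>2)"
  proof (rule sum_norm_le)
    fix i assume i: "i \<in> S"
    have "cmod (\<Sum>j\<in>S. Q w j i * Q w j i) \<le> nrm2 S (\<lambda>j. Q w j i)"
      using cmod_sum_mult_le[of "\<lambda>j. Q w j i" "\<lambda>j. Q w j i" S] by simp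
    with nrm2_col_Q_le[OF i, of w] show "cmod (\<Sum>j\<in>S. Q w j i * Q w j i) \<le> 1 / \<eta>\<^sup>2" by simp
  qed
  then show ?thesis by simp
qed

lemma cmod_diag_Q2_le: "cmod (\<Sum>i\<in>S. Q w i i * Q w i i) \<le> n / \<eta>\<^sup>2"
proof -
  have "cmod (\<Sum>i\<in>S. Q w i i * Q w i i) \<le> (\<Sum>i\<in>S. 1 / \<eta>\<^sup>2)"
  proof (rule sum_norm_le)
    fix i assume i: "i \<in> S"
    then show "cmod (Q w i i * Q w i i) \<le> 1 / \<eta>\<^sup>2"
      using mult_mono[OF cmod_sk_resolvent_le[OF eta_pos i i, of w] cmod_sk_resolvent_le[OF eta_pos i i, of w]] eta_pos
      by (simp add: norm_mult power2_eq_square)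
  qed
  then show ?thesis by simp
qed

text \<open>The squared Hilbert-Schmidt norm of Q^2, whose entries form the gradient of tr Q: each
  column of Q has squared norm at most 1 / \<eta>^2, and the second factor Q costs another 1 /
  \<eta>^2.\<close>

lemma sum_cmod_square_resolvent_le:
  "(\<Sum>i\<in>S. \<Sum>j\<in>S. (cmod (\<Sum>a\<in>S. Q w a i * Q w j a))\<^sup>2) \<le> n / \<eta> ^ 4"
proof -
  interpret R: sym_resolvent S z "coupling n w" by (rule sym_resolvent_sk)
  have "(\<Sum>j\<in>S. (cmod (\<Sum>a\<in>S. Q w a i * Q w j a))\<^sup>2) \<le> 1 / \<eta> ^ 4" if i: "i \<in> S" for i
  proof -
    have "(\<Sum>j\<in>S. (cmod (\<Sum>a\<in>S. Q w a i * Q w j a))\<^sup>2) = nrm2 S (mat_app S (Q w) (\<lambda>a. Q w a i))"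
      by (simp add: nrm2_def mat_app_def mult.commute)
    also have "\<dots> \<le> nrm2 S (\<lambda>a. Q w a i) / \<eta>\<^sup>2"
      using R.nrm2_app_le[of "\<lambda>a. Q w a i"] by (simp add: sk_resolvent_def)
    also have "\<dots> \<le> (1 / \<eta>\<^sup>2) / \<eta>\<^sup>2"
      by (intro divide_right_mono nrm2_col_Q_le i) simp
    finally show ?thesis by (simp add: power4_eq_xxxx power2_eq_square)
  qed
  then have "(\<Sum>i\<in>S. \<Sum>j\<in>S. (cmod (\<Sum>a\<in>S. Q w a i * Q w j a))\<^sup>2) \<le> (\<Sum>i\<in>S. 1 / \<eta> ^ 4)"
    by (rule sum_mono)
  then show ?thesis by simp
qed

section \<open>Continuity and integrability of the random traces\<close>

lemma integrable_continuous:
  fixes F :: "(nat \<times> nat \<Rightarrow> real) \<Rightarrow> 'b::{banach, second_countable_topology}"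
  assumes "continuous_on UNIV F" and "\<And>w. norm (F w) \<le> B"
  shows "integrable N F"
  by (rule N.integrable_bounded[OF borel_measurable_gauss_prod_continuous]) fact+

lemma continuous_Q: "i \<in> S \<Longrightarrow> j \<in> S \<Longrightarrow> continuous_on UNIV (\<lambda>w. Q w i j)"
  by (rule continuous_on_sk_resolvent[OF eta_pos])

lemma continuous_M: "continuous_on UNIV (\<lambda>w. complex_of_real (M w a b))"
  by (rule continuous_on_of_real[OF continuous_on_gibbs_cov])

lemma continuous_K: "j \<in> S \<Longrightarrow> continuous_on UNIV (\<lambda>w. K w j i)"
  unfolding K_def by (intro continuous_on_sum continuous_on_mult continuous_Q continuous_M)

lemma continuous_trQ: "continuous_on UNIV trQ"
  unfolding trQ_def[abs_def] by (intro continuous_on_sum continuous_Q)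

lemma continuous_trK: "continuous_on UNIV trK"
  unfolding trK_def[abs_def] by (intro continuous_on_sum continuous_K)

lemma continuous_opn: "continuous_on UNIV opn"
  by (rule continuous_on_op_norm) (rule continuous_on_gibbs_cov)

lemma cmod_Q_le: "i \<in> S \<Longrightarrow> j \<in> S \<Longrightarrow> cmod (Q w i j) \<le> 1 / \<eta>"
  by (rule cmod_sk_resolvent_le[OF eta_pos])

lemma cmod_K_le:
  assumes "j \<in> S" "i \<in> S"
  shows "cmod (K w j i) \<le> n / \<eta>"
proof -
  have "cmod (K w j i) \<le> (\<Sum>a\<in>S. 1 / \<eta>)"
    unfolding K_def
  proof (rule sum_norm_le)
    fix a assume "a \<in> S"
    then show "cmod (Q w j a * complex_of_real (M w a i)) \<le> 1 / \<eta>"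
      using mult_mono[OF cmod_Q_le[of j a w] abs_gibbs_cov_le[of a n i \<beta> w]] assms eta_pos
      by (simp add: norm_mult)
  qed
  then show ?thesis by simp
qed

lemma opn_le: "opn w \<le> n * n"
proof -
  have "opn w \<le> (\<Sum>i\<in>S. \<Sum>j\<in>S. \<bar>M w i j\<bar>)"
    unfolding sites_def by (rule op_norm_le_entries)
  also have "\<dots> \<le> (\<Sum>i\<in>S. \<Sum>j\<in>S. 1)"
    by (intro sum_mono abs_gibbs_cov_le)
  finally show ?thesis by simp
qed

lemma integrable_opn: "integrable N opn"
  by (rule integrable_continuous[OF continuous_opn, of "n * n"])
     (use opn_le op_norm_nonneg in \<open>simp add: abs_of_nonneg\<close>)

lemma integrable_trQ: "integrable N trQ"
  by (rule integrable_continuous[OF continuous_trQ cmod_trQ_le])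

lemma integrable_trK: "integrable N trK"
  by (rule integrable_continuous[OF continuous_trK cmod_trK_le])

text \<open>The derivative is given with a factor 1 / sqrt n split off; together with the 1 / sqrt n
  inside \<open>coupling\<close> it makes the 1 / n of the conclusion.\<close>

lemma coupling_integration_by_parts:
  fixes F D :: "(nat \<times> nat \<Rightarrow> real) \<Rightarrow> complex"
  assumes ij: "i \<in> S" "j \<in> S" "i \<noteq> j"
    and F: "continuous_on UNIV F" "\<And>w. cmod (F w) \<le> B"
    and D: "continuous_on UNIV D" "\<And>w. cmod (D w) \<le> C"
    and deriv: "\<And>w y. ((\<lambda>y. F (w(pair_of i j := y))) has_vector_derivative
      D (w(pair_of i j := y)) / sqrt n) (at y)"
  shows "integrable N (\<lambda>w. coupling n w i j * F w)"
    and "(\<integral>w. coupling n w i j * F w \<partial>N) = (\<integral>w. D w \<partial>N) / n"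
proof -
  let ?p = "pair_of i j"
  have p: "?p \<in> sk_pairs n" using ij by (rule pair_of_in_sk_pairs)
  have eq: "coupling n w i j * F w = (w ?p *\<^sub>R F w) / sqrt n" for w
    using ij(3) by (simp add: coupling_def scaleR_conv_of_real)
  have F_meas: "F \<in> borel_measurable N"
    by (rule borel_measurable_gauss_prod_continuous[OF F(1)])
  show "integrable N (\<lambda>w. coupling n w i j * F w)"
    unfolding eq by (rule integrable_divide_zero) (use integrable_gauss_prod_component_scaleR[OF p F_meas F(2)] in simp)
  have cont: "continuous_on UNIV (\<lambda>w. D w / complex_of_real (sqrt n))"
    using D(1) n_pos by (intro continuous_on_divide continuous_on_const) auto
  have "(\<integral>w. w ?p *\<^sub>R F w \<partial>N) = (\<integral>w. D w / complex_of_real (sqrt n) \<partial>N)"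
  proof (rule gauss_prod_integration_by_parts[OF finite_sk_pairs p F_meas])
    show "(\<lambda>w. D w / complex_of_real (sqrt n)) \<in> borel_measurable N"
      by (rule borel_measurable_gauss_prod_continuous[OF cont])
    show "cmod (F w) \<le> B" for w by (rule F(2))
    show "cmod (D w / complex_of_real (sqrt n)) \<le> C / sqrt n" for w
      using D(2)[of w] by (simp add: norm_divide divide_right_mono)
    show "((\<lambda>y. F (w(?p := y))) has_vector_derivative D (w(?p := y)) / complex_of_real (sqrt n)) (at y)" for w y
      by (rule deriv)
    show "continuous_on UNIV (\<lambda>y. D (w(?p := y)) / complex_of_real (sqrt n))" for w
      by (rule continuous_on_slice[OF cont])
  qed
  then have "(\<integral>w. coupling n w i j * F w \<partial>N) = (\<integral>w. D w \<partial>N) / complex_of_real (sqrt n) / complex_of_real (sqrt n)"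
    unfolding eq by simp
  also have "\<dots> = (\<integral>w. D w \<partial>N) / n"
    using n_pos by (simp add: of_real_mult[symmetric] del: of_real_mult)
  finally show "(\<integral>w. coupling n w i j * F w \<partial>N) = (\<integral>w. D w \<partial>N) / n" .
qed

text \<open>\<open>D\<close> has to be a derivative only off the diagonal, where the coupling is
  random. Completing its sum to all \<open>i\<close>, \<open>j\<close> makes traces appear, and the
  added diagonal is subtracted again.\<close>

lemma loop_equation:
  fixes F D :: "(nat \<times> nat \<Rightarrow> real) \<Rightarrow> nat \<Rightarrow> nat \<Rightarrow> complex"
  assumes F: "\<And>i j. i \<in> S \<Longrightarrow> j \<in> S \<Longrightarrow> continuous_on UNIV (\<lambda>w. F w i j)"
      "\<And>i j w. i \<in> S \<Longrightarrow> j \<in> S \<Longrightarrow> cmod (F w i j) \<le> B"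
    and D: "\<And>i j. i \<in> S \<Longrightarrow> j \<in> S \<Longrightarrow> continuous_on UNIV (\<lambda>w. D w i j)"
      "\<And>i j w. i \<in> S \<Longrightarrow> j \<in> S \<Longrightarrow> cmod (D w i j) \<le> C"
    and deriv: "\<And>i j w y. i \<in> S \<Longrightarrow> j \<in> S \<Longrightarrow> i \<noteq> j \<Longrightarrow>
      ((\<lambda>y. F (w(pair_of i j := y)) i j) has_vector_derivative D (w(pair_of i j := y)) i j / sqrt n) (at y)"
  shows "(\<integral>w. (\<Sum>i\<in>S. \<Sum>j\<in>S. coupling n w i j * F w i j) \<partial>N)
    = (\<integral>w. (\<Sum>i\<in>S. \<Sum>j\<in>S. D w i j) - (\<Sum>i\<in>S. D w i i) \<partial>N) / n"
proof -
  have int_D: "integrable N (\<lambda>w. D w i j)" if "i \<in> S" "j \<in> S" for i j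
    by (rule integrable_continuous[OF D(1)[OF that] D(2)[OF that]])
  have term_int: "integrable N (\<lambda>w. coupling n w i j * F w i j)" if "i \<in> S" "j \<in> S" for i j
  proof (cases "i = j")
    case False
    with coupling_integration_by_parts(1)[OF that False F(1)[OF that] F(2)[OF that] D(1)[OF that] D(2)[OF that]]
      deriv[OF that False] show ?thesis by blast
  qed (simp add: coupling_def)
  have term_eq: "(\<integral>w. coupling n w i j * F w i j \<partial>N) = (\<integral>w. D w i j \<partial>N) / n - of_bool (i = j) * ((\<integral>w. D w i j \<partial>N) / n)"
    if "i \<in> S" "j \<in> S" for i j
  proof (cases "i = j")
    case False
    with coupling_integration_by_parts(2)[OF that False F(1)[OF that] F(2)[OF that] D(1)[OF that] D(2)[OF that]]
      deriv[OF that False] show ?thesis by simp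
  qed (simp add: coupling_def)
  have "(\<integral>w. (\<Sum>i\<in>S. \<Sum>j\<in>S. coupling n w i j * F w i j) \<partial>N)
      = (\<Sum>i\<in>S. \<Sum>j\<in>S. \<integral>w. coupling n w i j * F w i j \<partial>N)"
    by (subst Bochner_Integration.integral_sum, intro Bochner_Integration.integrable_sum term_int)
       (auto intro!: sum.cong Bochner_Integration.integral_sum term_int)
  also have "\<dots> = (\<Sum>i\<in>S. \<Sum>j\<in>S. (\<integral>w. D w i j \<partial>N) / n - of_bool (i = j) * ((\<integral>w. D w i j \<partial>N) / n))"
    by (intro sum.cong refl term_eq)
  also have "\<dots> = (\<Sum>i\<in>S. \<Sum>j\<in>S. (\<integral>w. D w i j \<partial>N)) / n - (\<Sum>i\<in>S. \<integral>w. D w i i \<partial>N) / n"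
  proof -
    have "(\<Sum>j\<in>S. of_bool (i = j) * ((\<integral>w. D w i j \<partial>N) / n)) = (\<integral>w. D w i i \<partial>N) / n" if "i \<in> S" for i
      by (rule sum_of_bool_mult(2)[OF finite_sites that])
    then show ?thesis
      by (simp only: sum_subtractf sum_divide_distrib cong: sum.cong)
  qed
  also have "\<dots> = (\<integral>w. (\<Sum>i\<in>S. \<Sum>j\<in>S. D w i j) - (\<Sum>i\<in>S. D w i i) \<partial>N) / n"
  proof -
    have "(\<integral>w. (\<Sum>i\<in>S. \<Sum>j\<in>S. D w i j) - (\<Sum>i\<in>S. D w i i) \<partial>N)
        = (\<integral>w. (\<Sum>i\<in>S. \<Sum>j\<in>S. D w i j) \<partial>N) - (\<integral>w. (\<Sum>i\<in>S. D w i i) \<partial>N)"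
      by (intro Bochner_Integration.integral_diff Bochner_Integration.integrable_sum int_D)
    also have "(\<integral>w. (\<Sum>i\<in>S. D w i i) \<partial>N) = (\<Sum>i\<in>S. \<integral>w. D w i i \<partial>N)"
      by (intro Bochner_Integration.integral_sum int_D)
    also have "(\<integral>w. (\<Sum>i\<in>S. \<Sum>j\<in>S. D w i j) \<partial>N) = (\<Sum>i\<in>S. \<Sum>j\<in>S. \<integral>w. D w i j \<partial>N)"
      by (subst Bochner_Integration.integral_sum, intro Bochner_Integration.integrable_sum int_D)
         (auto intro!: sum.cong Bochner_Integration.integral_sum int_D)
    finally show ?thesis by (simp add: diff_divide_distrib)
  qed
  finally show ?thesis .
qed

text \<open>The product of diagonal entries \<open>Q w j j * Q w i i\<close> sums to the square of
  the trace, of order n^2 for bounded normalised trace; what remains is at most 3 n /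
  \<eta>^2.\<close>

lemma loop_equation_trQ:
  "z * (\<integral>w. trQ w \<partial>N) - n =
    (\<integral>w. (trQ w)\<^sup>2 + ((\<Sum>i\<in>S. \<Sum>j\<in>S. Q w j i * Q w j i) - 2 * (\<Sum>i\<in>S. Q w i i * Q w i i)) \<partial>N) / n"
proof -
  have "z * (\<integral>w. trQ w \<partial>N) - n = (\<integral>w. z * trQ w - n \<partial>N)"
    using integrable_trQ by (simp add: N.prob_space)
  also have "\<dots> = (\<integral>w. (\<Sum>i\<in>S. \<Sum>j\<in>S. coupling n w i j * Q w j i) \<partial>N)"
    by (simp add: trace_coupling_resolvent)
  also have "\<dots> = (\<integral>w. (\<Sum>i\<in>S. \<Sum>j\<in>S. Q w j i * Q w j i + Q w j j * Q w i i)
      - (\<Sum>i\<in>S. Q w i i * Q w i i + Q w i i * Q w i i) \<partial>N) / n"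
  proof (rule loop_equation[where B = "1 / \<eta>" and C = "1 / \<eta> * (1 / \<eta>) + 1 / \<eta> * (1 / \<eta>)"])
    fix i j assume ij: "i \<in> S" "j \<in> S"
    show "continuous_on UNIV (\<lambda>w. Q w j i)" by (intro continuous_Q ij)
    show "cmod (Q w j i) \<le> 1 / \<eta>" for w by (intro cmod_Q_le ij)
    show "continuous_on UNIV (\<lambda>w. Q w j i * Q w j i + Q w j j * Q w i i)"
      by (intro continuous_on_add continuous_on_mult continuous_Q ij)
    show "cmod (Q w j i * Q w j i + Q w j j * Q w i i) \<le> 1 / \<eta> * (1 / \<eta>) + 1 / \<eta> * (1 / \<eta>)" for w
      using eta_pos ij by (intro norm_triangle_le add_mono) (auto simp: norm_mult intro!: mult_mono cmod_Q_le simp del: times_divide_eq_left times_divide_eq_right)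
    show "((\<lambda>y. Q (w(pair_of i j := y)) j i) has_vector_derivative
        (Q (w(pair_of i j := y)) j i * Q (w(pair_of i j := y)) j i
          + Q (w(pair_of i j := y)) j j * Q (w(pair_of i j := y)) i i) / sqrt n) (at y)"
      if "i \<noteq> j" for w y
      using has_vector_derivative_sk_resolvent[OF eta_pos ij that ij(2) ij(1), of w y] by (simp add: Let_def)
  qed
  also have "(\<lambda>w. (\<Sum>i\<in>S. \<Sum>j\<in>S. Q w j i * Q w j i + Q w j j * Q w i i)
      - (\<Sum>i\<in>S. Q w i i * Q w i i + Q w i i * Q w i i))
    = (\<lambda>w. (trQ w)\<^sup>2 + ((\<Sum>i\<in>S. \<Sum>j\<in>S. Q w j i * Q w j i) - 2 * (\<Sum>i\<in>S. Q w i i * Q w i i)))"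
    by (rule ext) (simp add: sum.distrib trQ_def power2_eq_square sum_product mult.commute, simp add: sum_distrib_left)
  finally show ?thesis .
qed

lemma has_vector_derivative_K:
  assumes ij: "i \<in> S" "j \<in> S" "i \<noteq> j"
  shows "((\<lambda>y. K (w(pair_of i j := y)) j i) has_vector_derivative
    (let v = w(pair_of i j := y) in
      Q v j i * K v j i + Q v j j * K v i i + \<beta> * K v j j - \<beta> * (K v j i * M v i j)) / sqrt n) (at y)"
proof -
  let ?v = "w(pair_of i j := y)"
  have "((\<lambda>y. K (w(pair_of i j := y)) j i) has_vector_derivative
    (\<Sum>a\<in>S. Q ?v j a * complex_of_real (\<beta> / sqrt n * (M ?v a j - M ?v a i * M ?v i j))
       + (Q ?v j i * Q ?v j a + Q ?v j j * Q ?v i a) / sqrt n * complex_of_real (M ?v a i))) (at y)"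
    unfolding K_def
  proof (intro has_vector_derivative_sum has_vector_derivative_mult)
    fix a assume a: "a \<in> S"
    show "((\<lambda>y. Q (w(pair_of i j := y)) j a) has_vector_derivative
        (Q ?v j i * Q ?v j a + Q ?v j j * Q ?v i a) / sqrt n) (at y)"
      using has_vector_derivative_sk_resolvent[OF eta_pos ij ij(2) a, of w y] by (simp add: Let_def)
    show "((\<lambda>y. complex_of_real (M (w(pair_of i j := y)) a i)) has_vector_derivative
        complex_of_real (\<beta> / sqrt n * (M ?v a j - M ?v a i * M ?v i j))) (at y)"
      using has_real_derivative_gibbs_cov[OF ij, of \<beta> w a y] unfolding Let_def
      by (intro has_vector_derivative_of_real) (simp add: has_real_derivative_iff_has_vector_derivative)
  qed
  moreover have "(\<Sum>a\<in>S. Q ?v j a * complex_of_real (\<beta> / sqrt n * (M ?v a j - M ?v a i * M ?v i j))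
       + (Q ?v j i * Q ?v j a + Q ?v j j * Q ?v i a) / sqrt n * complex_of_real (M ?v a i))
    = (Q ?v j i * K ?v j i + Q ?v j j * K ?v i i + \<beta> * K ?v j j - \<beta> * (K ?v j i * M ?v i j)) / sqrt n"
    unfolding K_def sum_distrib_left sum_distrib_right sum.distrib[symmetric] sum_subtractf[symmetric] sum_divide_distrib
    by (intro sum.cong refl) (simp add: add_divide_distrib diff_divide_distrib algebra_simps)
  ultimately show ?thesis by (simp add: Let_def)
qed

text \<open>Differentiating Q gives tr Q tr (Q M). Differentiating M gives \<beta> times
  \<open>K w j j\<close>, and the free sum over \<open>i\<close> multiplies it by n: this term
  shifts z by \<beta> in the final factor z - \<beta> - m. The other terms are errors.\<close>

lemma loop_equation_trK:
  "z * (\<integral>w. trK w \<partial>N) - n =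
    (\<integral>w. trQ w * trK w + (n * \<beta> * trK w + ((\<Sum>i\<in>S. \<Sum>j\<in>S. Q w j i * K w j i)
      - \<beta> * (\<Sum>i\<in>S. \<Sum>j\<in>S. K w j i * M w i j) - 2 * (\<Sum>i\<in>S. Q w i i * K w i i))) \<partial>N) / n"
proof -
  let ?D = "\<lambda>w i j. Q w j i * K w j i + Q w j j * K w i i + \<beta> * K w j j - \<beta> * (K w j i * M w i j)"
  have "z * (\<integral>w. trK w \<partial>N) - n = (\<integral>w. z * trK w - n \<partial>N)"
    using integrable_trK by (simp add: N.prob_space)
  also have "\<dots> = (\<integral>w. (\<Sum>i\<in>S. \<Sum>j\<in>S. coupling n w i j * K w j i) \<partial>N)"
    by (simp add: trace_coupling_K)
  also have "\<dots> = (\<integral>w. (\<Sum>i\<in>S. \<Sum>j\<in>S. ?D w i j) - (\<Sum>i\<in>S. ?D w i i) \<partial>N) / n"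
  proof (rule loop_equation[where B = "n / \<eta>" and
        C = "1 / \<eta> * (n / \<eta>) + 1 / \<eta> * (n / \<eta>) + \<bar>\<beta>\<bar> * (n / \<eta>) + \<bar>\<beta>\<bar> * (n / \<eta> * 1)"])
    fix i j assume ij: "i \<in> S" "j \<in> S"
    show "continuous_on UNIV (\<lambda>w. K w j i)" by (intro continuous_K ij)
    show "cmod (K w j i) \<le> n / \<eta>" for w by (intro cmod_K_le ij)
    show "continuous_on UNIV (\<lambda>w. ?D w i j)"
      by (intro continuous_on_add continuous_on_diff continuous_on_mult continuous_on_const
          continuous_Q continuous_K continuous_M ij)
    show "cmod (?D w i j) \<le> 1 / \<eta> * (n / \<eta>) + 1 / \<eta> * (n / \<eta>) + \<bar>\<beta>\<bar> * (n / \<eta>) + \<bar>\<beta>\<bar> * (n / \<eta> * 1)" for w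
    proof (intro norm_triangle_le norm_triangle_le_diff add_mono)
      show "cmod (Q w j i * K w j i) \<le> 1 / \<eta> * (n / \<eta>)" "cmod (Q w j j * K w i i) \<le> 1 / \<eta> * (n / \<eta>)"
        unfolding norm_mult using eta_pos by (intro mult_mono cmod_Q_le cmod_K_le ij; simp)+
      show "cmod (\<beta> * K w j j) \<le> \<bar>\<beta>\<bar> * (n / \<eta>)"
        unfolding norm_mult norm_of_real by (intro mult_left_mono cmod_K_le ij) simp
      show "cmod (\<beta> * (K w j i * M w i j)) \<le> \<bar>\<beta>\<bar> * (n / \<eta> * 1)"
        unfolding norm_mult norm_of_real using eta_pos
        by (intro mult_left_mono mult_mono cmod_K_le abs_gibbs_cov_le ij) simp_all
    qed
    show "((\<lambda>y. K (w(pair_of i j := y)) j i) has_vector_derivative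
        ?D (w(pair_of i j := y)) i j / sqrt n) (at y)" if "i \<noteq> j" for w y
      using has_vector_derivative_K[OF ij that, of w y] by (simp only: Let_def)
  qed
  also have "(\<lambda>w. (\<Sum>i\<in>S. \<Sum>j\<in>S. ?D w i j) - (\<Sum>i\<in>S. ?D w i i))
    = (\<lambda>w. trQ w * trK w + (n * \<beta> * trK w + ((\<Sum>i\<in>S. \<Sum>j\<in>S. Q w j i * K w j i)
      - \<beta> * (\<Sum>i\<in>S. \<Sum>j\<in>S. K w j i * M w i j) - 2 * (\<Sum>i\<in>S. Q w i i * K w i i))))"
  proof
    fix w
    have a: "(\<Sum>i\<in>S. \<Sum>j\<in>S. Q w j j * K w i i) = trQ w * trK w"
      unfolding trQ_def trK_def sum_product by (rule sum.swap)
    have b: "(\<Sum>i\<in>S. \<Sum>j\<in>S. \<beta> * K w j j) = n * \<beta> * trK w"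
      by (simp add: trK_def sum_distrib_left mult.assoc)
    \<comment> \<open>On the diagonal the two terms with \<beta> cancel, since M has diagonal
      1.\<close>
    have c: "(\<Sum>i\<in>S. ?D w i i) = 2 * (\<Sum>i\<in>S. Q w i i * K w i i)"
      by (simp add: gibbs_cov_diag sum.distrib, simp add: sum_distrib_left)
    have d: "(\<Sum>i\<in>S. \<Sum>j\<in>S. \<beta> * (K w j i * M w i j)) = \<beta> * (\<Sum>i\<in>S. \<Sum>j\<in>S. K w j i * M w i j)"
      by (simp only: sum_distrib_left)
    have "(\<Sum>i\<in>S. \<Sum>j\<in>S. ?D w i j) = (\<Sum>i\<in>S. \<Sum>j\<in>S. Q w j i * K w j i)
        + (\<Sum>i\<in>S. \<Sum>j\<in>S. Q w j j * K w i i) + (\<Sum>i\<in>S. \<Sum>j\<in>S. \<beta> * K w j j)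
        - (\<Sum>i\<in>S. \<Sum>j\<in>S. \<beta> * (K w j i * M w i j))"
      by (simp only: sum.distrib sum_subtractf)
    then show "(\<Sum>i\<in>S. \<Sum>j\<in>S. ?D w i j) - (\<Sum>i\<in>S. ?D w i i)
      = trQ w * trK w + (n * \<beta> * trK w + ((\<Sum>i\<in>S. \<Sum>j\<in>S. Q w j i * K w j i)
      - \<beta> * (\<Sum>i\<in>S. \<Sum>j\<in>S. K w j i * M w i j) - 2 * (\<Sum>i\<in>S. Q w i i * K w i i)))"
      unfolding a b c d by (simp only: diff_conv_add_uminus add_ac)
  qed
  finally show ?thesis .
qed

text \<open>By Poincare. The partial derivative \<open>E p\<close> is 2 / sqrt n times an entry of
  Q^2, the 2 counting the entries ij and ji. The squared gradient is thus at most 4 / n times the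
  squared Hilbert-Schmidt norm n / \<eta>^4 bound, and n cancels.\<close>

lemma variance_trQ: "(\<integral>w. (cmod (trQ w - (\<integral>w. trQ w \<partial>N)))\<^sup>2 \<partial>N) \<le> 4 / \<eta> ^ 4"
proof -
  define E where "E p w = complex_of_real (2 / sqrt n) * (\<Sum>a\<in>S. Q w a (fst p) * Q w (snd p) a)" for p w
  have fs: "fst p \<in> S" "snd p \<in> S" "fst p \<noteq> snd p" "pair_of (fst p) (snd p) = p" if "p \<in> sk_pairs n" for p
    using that by (auto simp: sk_pairs_def sites_def pair_of_def)
  have E_cont: "continuous_on UNIV (E p)" if p: "p \<in> sk_pairs n" for p
    unfolding E_def[abs_def] using fs[OF p]
    by (intro continuous_on_mult continuous_on_const continuous_on_sum continuous_Q)
  have E_bound: "cmod (E p w) \<le> 2 / sqrt n * (n * (1 / \<eta> * (1 / \<eta>)))" if p: "p \<in> sk_pairs n" for p w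
  proof -
    have "cmod (\<Sum>a\<in>S. Q w a (fst p) * Q w (snd p) a) \<le> (\<Sum>a\<in>S. 1 / \<eta> * (1 / \<eta>))"
      unfolding norm_mult[symmetric]
    proof (rule sum_norm_le)
      fix a assume "a \<in> S"
      then show "cmod (Q w a (fst p) * Q w (snd p) a) \<le> 1 / \<eta> * (1 / \<eta>)"
        unfolding norm_mult using fs[OF p] eta_pos by (intro mult_mono cmod_Q_le) auto
    qed
    then have "cmod (\<Sum>a\<in>S. Q w a (fst p) * Q w (snd p) a) \<le> n * (1 / \<eta> * (1 / \<eta>))" by simp
    then show ?thesis
      unfolding E_def norm_mult norm_of_real by (intro mult_mono) auto
  qed
  have deriv: "((\<lambda>y. trQ (w(p := y))) has_vector_derivative E p (w(p := y))) (at y)"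
    if p: "p \<in> sk_pairs n" for p w y
  proof -
    let ?v = "w(p := y)"
    interpret R: sym_resolvent S z "coupling n ?v" by (rule sym_resolvent_sk)
    have "((\<lambda>y. trQ (w(p := y))) has_vector_derivative
      (\<Sum>a\<in>S. (Q ?v a (fst p) * Q ?v (snd p) a + Q ?v a (snd p) * Q ?v (fst p) a) / sqrt n)) (at y)"
      unfolding trQ_def
    proof (rule has_vector_derivative_sum)
      fix a assume a: "a \<in> S"
      show "((\<lambda>y. Q (w(p := y)) a a) has_vector_derivative
          (Q ?v a (fst p) * Q ?v (snd p) a + Q ?v a (snd p) * Q ?v (fst p) a) / sqrt n) (at y)"
        using has_vector_derivative_sk_resolvent[OF eta_pos fs(1,2,3)[OF p] a a, of w y]
        unfolding fs(4)[OF p] Let_def .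
    qed
    moreover have "(\<Sum>a\<in>S. (Q ?v a (fst p) * Q ?v (snd p) a + Q ?v a (snd p) * Q ?v (fst p) a) / sqrt n) = E p ?v"
      unfolding E_def sum_distrib_left
    proof (rule sum.cong)
      fix a assume a: "a \<in> S"
      have "Q ?v a (snd p) = Q ?v (snd p) a" "Q ?v (fst p) a = Q ?v a (fst p)"
        using R.resolvent_sym[OF a fs(2)[OF p]] R.resolvent_sym[OF fs(1)[OF p] a] by (simp_all add: sk_resolvent_def)
      then show "(Q ?v a (fst p) * Q ?v (snd p) a + Q ?v a (snd p) * Q ?v (fst p) a) / sqrt n
        = complex_of_real (2 / sqrt n) * (Q ?v a (fst p) * Q ?v (snd p) a)" by (simp add: mult.commute)
    qed simp
    ultimately show ?thesis by simp
  qed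
  \<comment> \<open>The Poincare inequality is for real functions, so it is applied with
    \<open>P\<close> the real part and with \<open>P\<close> the imaginary part.\<close>
  have part: "(\<integral>w. (P (trQ w) - (\<integral>w. P (trQ w) \<partial>N))\<^sup>2 \<partial>N) \<le> (\<Sum>p\<in>sk_pairs n. \<integral>w. (P (E p w))\<^sup>2 \<partial>N)"
    if P: "bounded_linear P" "\<And>x. \<bar>P x\<bar> \<le> cmod x" for P :: "complex \<Rightarrow> real"
  proof (rule gauss_prod_poincare[OF finite_sk_pairs])
    have cP: "continuous_on UNIV P" using P(1) linear_continuous_on by blast
    show "(\<lambda>w. P (trQ w)) \<in> borel_measurable N"
      by (rule borel_measurable_gauss_prod_continuous, rule continuous_on_compose2[OF cP continuous_trQ]) simp
    show "\<bar>P (trQ w)\<bar> \<le> n / \<eta>" for w using P(2) cmod_trQ_le order_trans by blast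
    fix p assume p: "p \<in> sk_pairs n"
    have c: "continuous_on UNIV (\<lambda>w. P (E p w))"
      by (rule continuous_on_compose2[OF cP E_cont[OF p]]) simp
    show "(\<lambda>w. P (E p w)) \<in> borel_measurable N"
      by (rule borel_measurable_gauss_prod_continuous[OF c])
    show "\<bar>P (E p w)\<bar> \<le> 2 / sqrt n * (n * (1 / \<eta> * (1 / \<eta>)))" for w
      using P(2) E_bound[OF p] order_trans by blast
    show "((\<lambda>y. P (trQ (w(p := y)))) has_real_derivative P (E p (w(p := y)))) (at y)" for w y
      using bounded_linear.has_vector_derivative[OF P(1) deriv[OF p]]
      by (simp add: has_real_derivative_iff_has_vector_derivative)
    show "continuous_on UNIV (\<lambda>y. P (E p (w(p := y))))" for w
      by (rule continuous_on_slice[OF c])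
  qed
  let ?m = "\<integral>w. trQ w \<partial>N"
  have sq_int: "integrable N (\<lambda>w. (P (trQ w - ?m))\<^sup>2)" if P: "bounded_linear P" "\<And>x. \<bar>P x\<bar> \<le> cmod x" for P :: "complex \<Rightarrow> real"
  proof (rule integrable_continuous)
    have cP: "continuous_on UNIV P" using P(1) linear_continuous_on by blast
    have "continuous_on UNIV (\<lambda>w. P (trQ w - ?m))"
      by (rule continuous_on_compose2[OF cP, where s = UNIV]) (auto intro: continuous_on_diff continuous_trQ)
    then show "continuous_on UNIV (\<lambda>w. (P (trQ w - ?m))\<^sup>2)" by (rule continuous_on_power)
    have "\<bar>P (trQ w - ?m)\<bar> \<le> n / \<eta> + cmod ?m" for w
      using P(2)[of "trQ w - ?m"] norm_triangle_ineq4[of "trQ w" ?m] cmod_trQ_le[of w] by linarith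
    then show "norm ((P (trQ w - ?m))\<^sup>2) \<le> (n / \<eta> + cmod ?m)\<^sup>2" for w
      by (simp add: abs_le_square_iff[symmetric] order_trans[OF _ abs_ge_self])
  qed
  have E_int: "integrable N (\<lambda>w. (P (E p w))\<^sup>2)" if p: "p \<in> sk_pairs n" and P: "bounded_linear P" "\<And>x. \<bar>P x\<bar> \<le> cmod x"
    for P :: "complex \<Rightarrow> real" and p
  proof (rule integrable_continuous)
    have cP: "continuous_on UNIV P" using P(1) linear_continuous_on by blast
    have "continuous_on UNIV (\<lambda>w. P (E p w))"
      by (rule continuous_on_compose2[OF cP E_cont[OF p]]) simp
    then show "continuous_on UNIV (\<lambda>w. (P (E p w))\<^sup>2)" by (rule continuous_on_power)
    have "\<bar>P (E p w)\<bar> \<le> 2 / sqrt n * (n * (1 / \<eta> * (1 / \<eta>)))" for w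
      using P(2) E_bound[OF p] order_trans by blast
    then show "norm ((P (E p w))\<^sup>2) \<le> (2 / sqrt n * (n * (1 / \<eta> * (1 / \<eta>))))\<^sup>2" for w
      unfolding real_norm_def abs_power2 abs_le_square_iff[symmetric] by (rule order_trans[OF _ abs_ge_self])
  qed
  note re = bounded_linear_Re abs_Re_le_cmod and im = bounded_linear_Im abs_Im_le_cmod
  have "(\<integral>w. (cmod (trQ w - ?m))\<^sup>2 \<partial>N) = (\<integral>w. (Re (trQ w - ?m))\<^sup>2 \<partial>N) + (\<integral>w. (Im (trQ w - ?m))\<^sup>2 \<partial>N)"
    unfolding cmod_power2 by (rule Bochner_Integration.integral_add[OF sq_int[OF re] sq_int[OF im]])
  also have "\<dots> \<le> (\<Sum>p\<in>sk_pairs n. \<integral>w. (Re (E p w))\<^sup>2 \<partial>N) + (\<Sum>p\<in>sk_pairs n. \<integral>w. (Im (E p w))\<^sup>2 \<partial>N)"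
    using part[OF re] part[OF im] integrable_trQ by (simp add: integral_Re integral_Im)
  also have "\<dots> = (\<Sum>p\<in>sk_pairs n. \<integral>w. (cmod (E p w))\<^sup>2 \<partial>N)"
    unfolding cmod_power2 sum.distrib[symmetric]
    by (intro sum.cong refl Bochner_Integration.integral_add[symmetric] E_int re im)
  also have "\<dots> = (\<integral>w. (\<Sum>p\<in>sk_pairs n. (cmod (E p w))\<^sup>2) \<partial>N)"
    unfolding cmod_power2
    by (intro Bochner_Integration.integral_sum[symmetric] Bochner_Integration.integrable_add E_int re im)
  also have "\<dots> \<le> (\<integral>w. 4 / \<eta> ^ 4 \<partial>N)"
  proof (rule integral_mono)
    show "integrable N (\<lambda>w. \<Sum>p\<in>sk_pairs n. (cmod (E p w))\<^sup>2)"
      unfolding cmod_power2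
      by (intro Bochner_Integration.integrable_sum Bochner_Integration.integrable_add E_int re im)
    fix w
    have E2: "(cmod (E p w))\<^sup>2 = 4 / n * (cmod (\<Sum>a\<in>S. Q w a (fst p) * Q w (snd p) a))\<^sup>2" for p
      unfolding E_def norm_mult norm_of_real power_mult_distrib by (simp add: power_divide)
    \<comment> \<open>Passing from pairs with i < j to all ordered pairs only adds nonnegative
      terms.\<close>
    have "(\<Sum>p\<in>sk_pairs n. (cmod (\<Sum>a\<in>S. Q w a (fst p) * Q w (snd p) a))\<^sup>2)
        \<le> (\<Sum>p\<in>S \<times> S. (cmod (\<Sum>a\<in>S. Q w a (fst p) * Q w (snd p) a))\<^sup>2)"
      by (rule sum_mono2) (auto simp: sk_pairs_def sites_def)
    also have "\<dots> \<le> n / \<eta> ^ 4"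
      using sum_cmod_square_resolvent_le[of w] by (simp add: sum.cartesian_product case_prod_beta')
    finally have "4 / n * (\<Sum>p\<in>sk_pairs n. (cmod (\<Sum>a\<in>S. Q w a (fst p) * Q w (snd p) a))\<^sup>2) \<le> 4 / n * (n / \<eta> ^ 4)"
      by (rule mult_left_mono) simp
    then show "(\<Sum>p\<in>sk_pairs n. (cmod (E p w))\<^sup>2) \<le> 4 / \<eta> ^ 4"
      unfolding E2 sum_distrib_left using n_pos by simp
  qed simp
  finally show ?thesis by (simp add: N.prob_space)
qed

end

section \<open>Lower bound for the expected operator norm\<close>

text \<open>Completing the square at d = m - z / 2 gives d^2 = z^2 / 4 - 1 - e = i \<eta> - \<eta>^2
  / 4 - e, so |d| is of order sqrt \<eta>. Of the two roots, Im m \<le> 0 selects the one with both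
  parts negative. In D = (1 - \<beta>) + i \<eta> / 2 - d the real parts therefore add up, and so do
  the imaginary parts.\<close>

lemma edge_phase_bounds:
  fixes \<eta> \<beta> :: real and m e :: complex
  assumes eta: "0 < \<eta>" "\<eta> \<le> 1" and beta: "0 \<le> 1 - \<beta>" "1 - \<beta> \<le> sqrt \<eta>"
    and eq: "Complex 2 \<eta> * m - 1 - m\<^sup>2 = e" and e: "cmod e \<le> \<eta> / 100"
    and im: "Im m \<le> 0"
  defines "D \<equiv> Complex 2 \<eta> - \<beta> - m"
  shows "cmod D \<le> 4 * sqrt \<eta>" and "sqrt \<eta> / 3 \<le> Im D" and "- Im m \<le> 2 * sqrt \<eta>"
proof -
  define d where "d = m - Complex 1 (\<eta> / 2)"
  define t where "t = sqrt \<eta>"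
  have t: "0 < t" "t \<le> 1" "t\<^sup>2 = \<eta>" using eta by (auto simp: t_def)
  have d2: "d\<^sup>2 = Complex (- \<eta>\<^sup>2 / 4) \<eta> - e"
    unfolding d_def eq[symmetric] by (simp add: complex_eq_iff power2_eq_square algebra_simps)
  have Re_e: "\<bar>Re e\<bar> \<le> \<eta> / 100" and Im_e: "\<bar>Im e\<bar> \<le> \<eta> / 100"
    using abs_Re_le_cmod[of e] abs_Im_le_cmod[of e] e by linarith+
  have eta2: "\<eta>\<^sup>2 \<le> \<eta>" using eta mult_left_mono[of \<eta> 1 \<eta>] by (simp add: power2_eq_square)
  define x y where "x = Re d" and "y = Im d"
  have r: "x\<^sup>2 - y\<^sup>2 = - \<eta>\<^sup>2 / 4 - Re e"
    using arg_cong[OF d2, of Re] by (simp add: x_def y_def power2_eq_square)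
  have i: "2 * x * y = \<eta> - Im e"
    using arg_cong[OF d2, of Im] by (simp add: x_def y_def power2_eq_square mult_ac)
  have sum_le: "x\<^sup>2 + y\<^sup>2 \<le> (13/10) * t\<^sup>2"
  proof -
    have "(cmod d)\<^sup>2 = cmod (Complex (- \<eta>\<^sup>2 / 4) \<eta> - e)" unfolding d2[symmetric] by (simp add: norm_power)
    also have "\<dots> \<le> \<bar>- \<eta>\<^sup>2 / 4 - Re e\<bar> + \<bar>\<eta> - Im e\<bar>"
      using cmod_le[of "Complex (- \<eta>\<^sup>2 / 4) \<eta> - e"] by simp
    also have "\<dots> \<le> (13/10) * \<eta>" using Re_e Im_e eta2 eta zero_le_power2[of \<eta>] by linarith
    finally show ?thesis by (simp add: cmod_power2 x_def y_def t)
  qed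
  \<comment> \<open>Subtracting \<open>r\<close> from 2 x y \<le> x^2 + y^2 isolates 2 y^2, which is
    at least \<eta> up to the errors.\<close>
  have y2: "(37/100) * t\<^sup>2 \<le> y\<^sup>2"
  proof -
    have "0 \<le> (x - y)\<^sup>2" by simp
    then have "2 * x * y \<le> x\<^sup>2 + y\<^sup>2" by (simp add: power2_diff)
    then show ?thesis
      using i r Re_e Im_e eta zero_le_power2[of \<eta>] unfolding t by linarith
  qed
  have xy: "0 < x * y" using i Im_e eta by linarith
  have y_neg: "y < 0"
  proof (rule ccontr)
    assume "\<not> y < 0"
    moreover have "y \<le> - \<eta> / 2 + 0" using im by (simp add: y_def d_def)
    ultimately show False using eta by linarith
  qed
  have x_neg: "x < 0" using xy y_neg by (simp add: zero_less_mult_iff)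
  have absy: "t / 2 < - y"
  proof (rule ccontr)
    assume "\<not> t / 2 < - y"
    then have "(- y)\<^sup>2 \<le> (t / 2)\<^sup>2" using y_neg by (intro power_mono) auto
    then show False using y2 t eta by (simp add: power_divide)
  qed
  have upper: "- y \<le> (6/5) * t" "- x \<le> (6/5) * t"
  proof -
    have "y\<^sup>2 \<le> (36/25) * t\<^sup>2" "x\<^sup>2 \<le> (36/25) * t\<^sup>2"
      using sum_le zero_le_power2[of x] zero_le_power2[of y] zero_le_power2[of t] by linarith+
    then have sq: "(- y)\<^sup>2 \<le> ((6/5) * t)\<^sup>2" "(- x)\<^sup>2 \<le> ((6/5) * t)\<^sup>2"
      by (simp_all add: power_mult_distrib power_divide)
    have "0 \<le> (6/5) * t" using t by simp
    then show "- y \<le> (6/5) * t" "- x \<le> (6/5) * t"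
      using sq(1) sq(2) by (blast intro: power2_le_imp_le)+
  qed
  have eta_t: "\<eta> \<le> t" using t mult_left_mono[of t 1 t] by (simp add: power2_eq_square)
  have ReD: "Re D = (1 - \<beta>) - x" and ImD: "Im D = \<eta> / 2 - y"
    by (simp_all add: D_def x_def y_def d_def)
  show "sqrt \<eta> / 3 \<le> Im D" unfolding t_def[symmetric] ImD using absy eta t by linarith
  show "- Im m \<le> 2 * sqrt \<eta>" unfolding t_def[symmetric] using upper eta t by (simp add: y_def d_def)
  have "cmod D \<le> \<bar>Re D\<bar> + \<bar>Im D\<bar>" by (rule cmod_le)
  \<comment> \<open>The summands are at most t for 1 - \<beta>, (6/5) t for each of - x and - y, and
    t / 2 for \<eta> / 2.\<close>
  also have "\<dots> \<le> 4 * t"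
    unfolding ReD ImD using upper x_neg y_neg beta eta eta_t unfolding t_def[symmetric] by linarith
  finally show "cmod D \<le> 4 * sqrt \<eta>" by (simp add: t_def)
qed

text \<open>The imaginary part of 1 / D is - Im D / |D|^2. The error costs at most t / 25 in the
  numerator, which stays above t / 4, while |D|^2 \<le> 16 t^2; the quotient is 1 / (64 t).\<close>

lemma neg_im_quotient_lower_bound:
  fixes D W \<epsilon> :: complex
  assumes t: "0 < t" and D: "cmod D \<le> 4 * t" "t / 3 \<le> Im D" and eq: "D * W = 1 + \<epsilon>" and \<epsilon>: "cmod \<epsilon> \<le> 1 / 100"
  shows "1 / (64 * t) \<le> - Im W"
proof -
  have D0: "D \<noteq> 0" using D(2) t by auto
  have pos: "0 < (cmod D)\<^sup>2" using D0 by simp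
  have "W = (1 + \<epsilon>) / D" using eq D0 by (simp add: field_simps)
  then have W: "- Im W = ((1 + Re \<epsilon>) * Im D - Im \<epsilon> * Re D) / (cmod D)\<^sup>2"
    by (simp add: Im_divide cmod_power2 diff_divide_distrib)
  have "(1 + Re \<epsilon>) * Im D \<ge> (99/100) * (t / 3)"
    using D(2) t \<epsilon> abs_Re_le_cmod[of \<epsilon>] by (intro mult_mono) linarith+
  moreover have "\<bar>Im \<epsilon> * Re D\<bar> \<le> (1/100) * (4 * t)"
    unfolding abs_mult using abs_Im_le_cmod[of \<epsilon>] abs_Re_le_cmod[of D] \<epsilon> D(1) by (intro mult_mono) linarith+
  ultimately have num: "t / 4 \<le> (1 + Re \<epsilon>) * Im D - Im \<epsilon> * Re D" using t by linarith
  have den: "(cmod D)\<^sup>2 \<le> (4 * t)\<^sup>2" using D(1) by (intro power_mono) auto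
  have "1 / (64 * t) = (t / 4) / (4 * t)\<^sup>2" using t by (simp add: power2_eq_square field_simps)
  also have "\<dots> \<le> - Im W"
    unfolding W using num den pos t by (intro frac_le) auto
  finally show ?thesis .
qed

section \<open>Combination of the two loop equations\<close>

context sk_model
begin

lemma norm_expectation_bound:
  fixes F :: "(nat \<times> nat \<Rightarrow> real) \<Rightarrow> complex" and B :: "(nat \<times> nat \<Rightarrow> real) \<Rightarrow> real"
  assumes "\<And>w. cmod (F w) \<le> B w" and "integrable N B"
  shows "cmod (\<integral>w. F w \<partial>N) \<le> (\<integral>w. B w \<partial>N)"
proof (cases "integrable N F")
  case True
  have "cmod (\<integral>w. F w \<partial>N) \<le> (\<integral>w. cmod (F w) \<partial>N)" by (rule integral_norm_bound)
  also have "\<dots> \<le> (\<integral>w. B w \<partial>N)"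
    using assms(1) by (intro integral_mono integrable_norm True assms(2))
  finally show ?thesis .
next
  case False
  have "0 \<le> B w" for w using assms(1) norm_ge_zero order_trans by blast
  then show ?thesis using False by (simp add: not_integrable_integral_eq integral_nonneg_AE)
qed

lemma expectation_op_norm_lower_bound:
  assumes eta_le: "\<eta> \<le> 1" and beta: "0 \<le> \<beta>" "0 \<le> 1 - \<beta>" "1 - \<beta> \<le> sqrt \<eta>"
    and large: "1000 \<le> n * \<eta> ^ 3"
  shows "1 / (512 * \<eta>) \<le> (\<integral>w. opn w \<partial>N)"
proof (cases "(\<integral>w. opn w \<partial>N) \<le> 1 / \<eta>")
  case False
  have "1 / (512 * \<eta>) \<le> 1 / \<eta>" using eta_pos by (simp add: field_simps)
  with False show ?thesis by linarith
next
  case True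
  define E where "E = (\<integral>w. opn w \<partial>N)"
  \<comment> \<open>The small parameter of the argument: the error \<open>e\<close> is of order
    \<eta> \<zeta> and \<epsilon> is of order \<zeta>.\<close>
  define \<zeta> where "\<zeta> = 1 / (n * \<eta> ^ 3)"
  define t where "t = sqrt \<eta>"
  have n0: "0 < real n" using n_pos by simp
  have \<zeta>: "0 < \<zeta>" "\<zeta> \<le> 1 / 1000"
    using large eta_pos n0 by (auto simp: \<zeta>_def intro!: le_imp_inverse_le[of 1000, unfolded inverse_eq_divide])
  have t: "0 < t" "t\<^sup>2 = \<eta>" "t \<le> 1" using eta_pos eta_le by (auto simp: t_def)
  define mQ where "mQ = (\<integral>w. trQ w \<partial>N)"
  define V where "V = (\<integral>w. (cmod (trQ w - mQ))\<^sup>2 \<partial>N)"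
  have V: "V \<le> 4 / \<eta> ^ 4" unfolding V_def mQ_def by (rule variance_trQ)
  define dev where "dev w = trQ w - mQ" for w
  have dev_cont: "continuous_on UNIV dev"
    unfolding dev_def[abs_def] by (intro continuous_on_diff continuous_trQ continuous_on_const)
  have dev_le: "cmod (dev w) \<le> n / \<eta> + cmod mQ" for w
    unfolding dev_def using norm_triangle_ineq4[of "trQ w" mQ] cmod_trQ_le[of w] by linarith
  have dev_int: "integrable N dev" by (rule integrable_continuous[OF dev_cont dev_le])
  have dev_mean: "(\<integral>w. dev w \<partial>N) = 0"
    unfolding dev_def using integrable_trQ by (simp add: N.prob_space mQ_def)
  have ndev_int: "integrable N (\<lambda>w. cmod (dev w))"
    using dev_int by (rule integrable_norm)
  have dev2_int: "integrable N (\<lambda>w. (cmod (dev w))\<^sup>2)"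
  proof (rule integrable_continuous)
    show "continuous_on UNIV (\<lambda>w. (cmod (dev w))\<^sup>2)"
      by (intro continuous_on_power continuous_on_norm dev_cont)
    show "norm ((cmod (dev w))\<^sup>2) \<le> (n / \<eta> + cmod mQ)\<^sup>2" for w
      using dev_le[of w] by (simp add: power_mono)
  qed
  have V_dev: "V = (\<integral>w. (cmod (dev w))\<^sup>2 \<partial>N)" by (simp add: V_def dev_def)
  have absdev: "(\<integral>w. cmod (dev w) \<partial>N) \<le> 2 / \<eta>\<^sup>2"
  proof -
    have "(\<integral>w. cmod (dev w) \<partial>N)\<^sup>2 \<le> V"
      unfolding V_dev by (rule N.square_expectation_le[OF ndev_int dev2_int])
    also have "\<dots> \<le> (2 / \<eta>\<^sup>2)\<^sup>2" using V by (simp add: power_divide)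
    finally show ?thesis using eta_pos by (auto intro: power2_le_imp_le)
  qed
  define R1 where "R1 w = (\<Sum>i\<in>S. \<Sum>j\<in>S. Q w j i * Q w j i) - 2 * (\<Sum>i\<in>S. Q w i i * Q w i i)" for w
  define R2 where "R2 w = (\<Sum>i\<in>S. \<Sum>j\<in>S. Q w j i * K w j i)
      - \<beta> * (\<Sum>i\<in>S. \<Sum>j\<in>S. K w j i * M w i j) - 2 * (\<Sum>i\<in>S. Q w i i * K w i i)" for w
  have R1_le: "cmod (R1 w) \<le> 3 * (n / \<eta>\<^sup>2)" for w
    unfolding R1_def using norm_triangle_ineq4[of "\<Sum>i\<in>S. \<Sum>j\<in>S. Q w j i * Q w j i" "2 * (\<Sum>i\<in>S. Q w i i * Q w i i)"]
      cmod_trace_Q2_le[of w] cmod_diag_Q2_le[of w] by (simp add: norm_mult)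
  have R2_le: "cmod (R2 w) \<le> 3 * (n / \<eta>\<^sup>2) + n / \<eta> * opn w" for w
  proof -
    have "cmod (R2 w) \<le> cmod (\<Sum>i\<in>S. \<Sum>j\<in>S. Q w j i * K w j i)
        + cmod (\<beta> * (\<Sum>i\<in>S. \<Sum>j\<in>S. K w j i * M w i j)) + cmod (2 * (\<Sum>i\<in>S. Q w i i * K w i i))"
      unfolding R2_def by (intro norm_triangle_le_diff add_mono order_refl)
    moreover have "cmod (\<beta> * (\<Sum>i\<in>S. \<Sum>j\<in>S. K w j i * M w i j)) \<le> 1 * (n * opn w / \<eta>)"
      unfolding norm_mult using beta by (intro mult_mono cmod_trace_QM2_le) auto
    moreover have "cmod (2 * (\<Sum>i\<in>S. Q w i i * K w i i)) \<le> 2 * (n / \<eta>\<^sup>2)"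
      using cmod_diag_QK_le[of w] by (simp add: norm_mult)
    ultimately show ?thesis using cmod_trace_Q2M_le[of w] by simp
  qed
  have R1_int: "integrable N R1"
    by (rule integrable_continuous[OF _ R1_le], unfold R1_def)
       (intro continuous_on_diff continuous_on_mult continuous_on_const continuous_on_sum continuous_Q)
  have R2_int: "integrable N R2"
  proof (rule integrable_continuous)
    show "continuous_on UNIV R2"
      unfolding R2_def by (intro continuous_on_diff continuous_on_mult continuous_on_const
          continuous_on_sum continuous_Q continuous_K continuous_M)
    show "cmod (R2 w) \<le> 3 * (n / \<eta>\<^sup>2) + n / \<eta> * (n * n)" for w
      using R2_le[of w] mult_left_mono[OF opn_le[of w], of "n / \<eta>"] eta_pos by auto
  qed
  define m where "m = mQ / n"
  define W where "W = (\<integral>w. trK w \<partial>N) / n"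

  define e where "e = z * m - 1 - m\<^sup>2"
  \<comment> \<open>Centring tr Q at its mean removes the cross term, which leaves the mean of
    \<open>dev\<close> squared and the remainder \<open>R1\<close>.\<close>
  have e_eq: "e = ((\<integral>w. (dev w)\<^sup>2 \<partial>N) + (\<integral>w. R1 w \<partial>N)) / (of_nat n)\<^sup>2"
  proof -
    have dev2c: "integrable N (\<lambda>w. (dev w)\<^sup>2)"
    proof (rule integrable_continuous)
      show "continuous_on UNIV (\<lambda>w. (dev w)\<^sup>2)" by (intro continuous_on_power dev_cont)
      show "norm ((dev w)\<^sup>2) \<le> (n / \<eta> + cmod mQ)\<^sup>2" for w
        using dev_le[of w] by (simp add: norm_power power_mono)
    qed
    have "z * mQ - n = (\<integral>w. (trQ w)\<^sup>2 + R1 w \<partial>N) / n"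
      using loop_equation_trQ by (simp add: mQ_def R1_def)
    also have "(\<lambda>w. (trQ w)\<^sup>2 + R1 w) = (\<lambda>w. (dev w)\<^sup>2 + 2 * mQ * dev w + mQ\<^sup>2 + R1 w)"
      by (rule ext) (simp add: dev_def power2_eq_square algebra_simps)
    also have "(\<integral>w. (dev w)\<^sup>2 + 2 * mQ * dev w + mQ\<^sup>2 + R1 w \<partial>N)
        = (\<integral>w. (dev w)\<^sup>2 \<partial>N) + mQ\<^sup>2 + (\<integral>w. R1 w \<partial>N)"
      using dev2c dev_int R1_int by (simp add: dev_mean N.prob_space)
    finally have "z * mQ - n = ((\<integral>w. (dev w)\<^sup>2 \<partial>N) + mQ\<^sup>2 + (\<integral>w. R1 w \<partial>N)) / n" .
    then show ?thesis
      using n_pos by (simp add: e_def m_def field_simps power2_eq_square)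
  qed
  have e_le: "cmod e \<le> \<eta> / 100"
  proof -
    have "cmod (\<integral>w. (dev w)\<^sup>2 \<partial>N) \<le> V"
      unfolding V_dev by (rule norm_expectation_bound[OF _ dev2_int]) (simp add: norm_power)
    moreover have "cmod (\<integral>w. R1 w \<partial>N) \<le> 3 * (n / \<eta>\<^sup>2)"
      using norm_expectation_bound[OF R1_le] by (simp add: N.prob_space)
    ultimately have "cmod ((\<integral>w. (dev w)\<^sup>2 \<partial>N) + (\<integral>w. R1 w \<partial>N)) \<le> 4 / \<eta> ^ 4 + 3 * (n / \<eta>\<^sup>2)"
      using V norm_triangle_ineq[of "\<integral>w. (dev w)\<^sup>2 \<partial>N" "\<integral>w. R1 w \<partial>N"] by linarith
    then have "cmod e \<le> (4 / \<eta> ^ 4 + 3 * (n / \<eta>\<^sup>2)) / n\<^sup>2"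
      unfolding e_eq by (simp add: norm_divide norm_power divide_right_mono)
    also have "\<dots> = \<eta> * (4 * \<eta> * \<zeta>\<^sup>2 + 3 * \<zeta>)"
      using n0 eta_pos by (simp add: \<zeta>_def field_simps power2_eq_square power3_eq_cube power4_eq_xxxx)
    also have "\<dots> \<le> \<eta> * (1 / 100)"
    proof (rule mult_left_mono)
      have "\<eta> * \<zeta>\<^sup>2 \<le> 1 * \<zeta>"
        unfolding power2_eq_square mult.assoc[symmetric] using \<zeta> eta_le eta_pos
        by (intro mult_right_mono mult_le_one) auto
      then show "4 * \<eta> * \<zeta>\<^sup>2 + 3 * \<zeta> \<le> 1 / 100" using \<zeta> by linarith
    qed (use eta_pos in simp)
    finally show ?thesis by simp
  qed
  have im_mQ: "- Im mQ = (\<integral>w. - Im (trQ w) \<partial>N)"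
    using integrable_trQ by (simp add: mQ_def integral_Im)
  have im_m: "Im m \<le> 0"
  proof -
    have "0 \<le> - Im mQ" unfolding im_mQ by (rule integral_nonneg_AE) (simp add: im_trQ_nonneg del: neg_0_le_iff_le)
    then show ?thesis unfolding m_def using n0 by (simp add: divide_nonpos_pos)
  qed
  define D where "D = z - \<beta> - m"
  note phase = edge_phase_bounds[OF eta_pos eta_le beta(2,3) e_def[symmetric] e_le im_m, folded D_def t_def]

  \<comment> \<open>In E (tr Q tr (Q M)) the mean of tr Q goes into the factor \<open>D\<close>; the
    deviation stays here and is bounded through E |dev| and the uniform bound on |tr (Q M)|.\<close>
  define \<epsilon> where "\<epsilon> = ((\<integral>w. dev w * trK w \<partial>N) + (\<integral>w. R2 w \<partial>N)) / (of_nat n)\<^sup>2"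
  have devK_le: "cmod (dev w * trK w) \<le> n / \<eta> * cmod (dev w)" for w
    unfolding norm_mult using mult_right_mono[OF cmod_trK_le[of w], of "cmod (dev w)"] by (simp add: mult.commute)
  have DW: "D * W = 1 + \<epsilon>"
  proof -
    have devK: "integrable N (\<lambda>w. dev w * trK w)"
    proof (rule integrable_continuous)
      show "continuous_on UNIV (\<lambda>w. dev w * trK w)" by (intro continuous_on_mult dev_cont continuous_trK)
      show "cmod (dev w * trK w) \<le> n / \<eta> * (n / \<eta> + cmod mQ)" for w
        using devK_le[of w] mult_left_mono[OF dev_le[of w], of "n / \<eta>"] eta_pos by auto
    qed
    have "z * (W * n) - n = (\<integral>w. trQ w * trK w + (n * \<beta> * trK w + R2 w) \<partial>N) / n"
      using loop_equation_trK n_pos by (simp add: W_def R2_def)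
    also have "(\<lambda>w. trQ w * trK w + (n * \<beta> * trK w + R2 w))
        = (\<lambda>w. dev w * trK w + (mQ + n * \<beta>) * trK w + R2 w)"
      by (rule ext) (simp add: dev_def algebra_simps)
    also have "(\<integral>w. dev w * trK w + (mQ + n * \<beta>) * trK w + R2 w \<partial>N)
        = (\<integral>w. dev w * trK w \<partial>N) + (mQ + n * \<beta>) * (W * n) + (\<integral>w. R2 w \<partial>N)"
      using devK integrable_trK R2_int n_pos by (simp add: W_def)
    finally have "z * (W * n) - n = ((\<integral>w. dev w * trK w \<partial>N) + (mQ + n * \<beta>) * (W * n) + (\<integral>w. R2 w \<partial>N)) / n" .
    then show ?thesis
      using n_pos by (simp add: D_def \<epsilon>_def m_def field_simps power2_eq_square)
  qed
  have \<epsilon>_le: "cmod \<epsilon> \<le> 1 / 100"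
  proof -
    have "cmod (\<integral>w. dev w * trK w \<partial>N) \<le> n / \<eta> * (2 / \<eta>\<^sup>2)"
    proof -
      have "cmod (\<integral>w. dev w * trK w \<partial>N) \<le> (\<integral>w. n / \<eta> * cmod (dev w) \<partial>N)"
        by (rule norm_expectation_bound[OF devK_le]) (use ndev_int in simp)
      also have "\<dots> = n / \<eta> * (\<integral>w. cmod (dev w) \<partial>N)"
        by (rule integral_mult_right_zero)
      also have "\<dots> \<le> n / \<eta> * (2 / \<eta>\<^sup>2)"
        by (rule mult_left_mono[OF absdev]) (use eta_pos in simp)
      finally show ?thesis .
    qed
    \<comment> \<open>Here the case assumption enters: a mean operator norm of at most 1 / \<eta>
      keeps the tr (Q M^2) term of order n / \<eta>^2.\<close>
    moreover have "cmod (\<integral>w. R2 w \<partial>N) \<le> 3 * (n / \<eta>\<^sup>2) + n / \<eta> * (1 / \<eta>)"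
    proof -
      have "cmod (\<integral>w. R2 w \<partial>N) \<le> (\<integral>w. 3 * (n / \<eta>\<^sup>2) + n / \<eta> * opn w \<partial>N)"
        by (rule norm_expectation_bound[OF R2_le]) (use integrable_opn in simp)
      also have "\<dots> = 3 * (n / \<eta>\<^sup>2) + n / \<eta> * E"
        using integrable_opn by (simp add: N.prob_space E_def)
      also have "\<dots> \<le> 3 * (n / \<eta>\<^sup>2) + n / \<eta> * (1 / \<eta>)"
        using True eta_pos unfolding E_def by (intro add_mono mult_left_mono order_refl) auto
      finally show ?thesis .
    qed
    ultimately have "cmod ((\<integral>w. dev w * trK w \<partial>N) + (\<integral>w. R2 w \<partial>N))
        \<le> n / \<eta> * (2 / \<eta>\<^sup>2) + (3 * (n / \<eta>\<^sup>2) + n / \<eta> * (1 / \<eta>))"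
      by (rule norm_triangle_le[OF add_mono])
    then have "cmod \<epsilon> \<le> (n / \<eta> * (2 / \<eta>\<^sup>2) + (3 * (n / \<eta>\<^sup>2) + n / \<eta> * (1 / \<eta>))) / n\<^sup>2"
      unfolding \<epsilon>_def by (simp add: norm_divide norm_power divide_right_mono)
    also have "\<dots> = 2 * \<zeta> + 4 * (\<eta> * \<zeta>)"
      using n0 eta_pos by (simp add: \<zeta>_def field_simps power2_eq_square power3_eq_cube)
    also have "\<eta> * \<zeta> \<le> 1 * \<zeta>"
      using eta_le \<zeta> by (intro mult_right_mono) auto
    finally show ?thesis using \<zeta> by linarith
  qed
  have lower: "1 / (64 * t) \<le> - Im W"
    by (rule neg_im_quotient_lower_bound[OF t(1) phase(1,2) DW \<epsilon>_le])

  \<comment> \<open>The trace inequality contains the product of the norm and the random - Im tr Q.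
    As the mean of - Im tr Q is at most 2 t n, it exceeds 4 t n only where |dev| \<ge> 2 t n. There
    the uniform bound n / \<eta> is used, and the indicator is at most |dev|^2 / (4 \<eta> n^2), as
    in Chebyshev's inequality.\<close>
  have pointwise: "- Im (trK w) \<le> n * (4 * t) * opn w + n / \<eta> * ((cmod (dev w))\<^sup>2 / (4 * \<eta> * n\<^sup>2))" for w
  proof (cases "- Im (trQ w) \<le> n * (4 * t)")
    case True
    have "- Im (trK w) \<le> opn w * (- Im (trQ w))" by (rule im_trK_le_op_norm)
    also have "\<dots> \<le> opn w * (n * (4 * t))" using True by (intro mult_left_mono op_norm_nonneg)
    also have "\<dots> \<le> n * (4 * t) * opn w + n / \<eta> * ((cmod (dev w))\<^sup>2 / (4 * \<eta> * n\<^sup>2))"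
      using eta_pos by (simp add: mult_ac)
    finally show ?thesis .
  next
    case False
    have "- Im mQ \<le> n * (2 * t)"
      using phase(3) n0 by (simp add: m_def field_simps)
    then have "n * (2 * t) \<le> \<bar>Im (dev w)\<bar>" using False by (simp add: dev_def)
    also have "\<dots> \<le> cmod (dev w)" by (rule abs_Im_le_cmod)
    finally have "(n * (2 * t))\<^sup>2 \<le> (cmod (dev w))\<^sup>2" using t n0 by (intro power_mono) auto
    then have "4 * \<eta> * n\<^sup>2 \<le> (cmod (dev w))\<^sup>2" by (simp add: power_mult_distrib t mult_ac)
    then have "1 \<le> (cmod (dev w))\<^sup>2 / (4 * \<eta> * n\<^sup>2)" using n0 eta_pos by simp
    then have "n / \<eta> * 1 \<le> n / \<eta> * ((cmod (dev w))\<^sup>2 / (4 * \<eta> * n\<^sup>2))"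
      using eta_pos by (intro mult_left_mono) auto
    moreover have "- Im (trK w) \<le> n / \<eta>" using abs_Im_le_cmod[of "trK w"] cmod_trK_le[of w] by linarith
    moreover have "0 \<le> n * (4 * t) * opn w" using t op_norm_nonneg by simp
    ultimately show ?thesis by linarith
  qed
  have "n * (- Im W) = (\<integral>w. - Im (trK w) \<partial>N)"
    using integrable_trK n0 by (simp add: W_def integral_Im)
  also have "\<dots> \<le> (\<integral>w. n * (4 * t) * opn w + n / \<eta> * ((cmod (dev w))\<^sup>2 / (4 * \<eta> * n\<^sup>2)) \<partial>N)"
    by (rule integral_mono) (use pointwise integrable_trK integrable_opn dev2_int in auto)
  also have "\<dots> = n * (4 * t) * E + n / \<eta> * (V / (4 * \<eta> * n\<^sup>2))"
    using integrable_opn dev2_int by (simp add: E_def V_dev)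
  also have "\<dots> \<le> n * (4 * t) * E + n / \<eta> * ((4 / \<eta> ^ 4) / (4 * \<eta> * n\<^sup>2))"
    using V eta_pos by (intro add_mono mult_left_mono divide_right_mono order_refl) auto
  also have "\<dots> = n * (4 * t * E + \<zeta>\<^sup>2)"
    using n0 eta_pos by (simp add: \<zeta>_def field_simps power2_eq_square power3_eq_cube power4_eq_xxxx)
  finally have upper: "- Im W \<le> 4 * t * E + \<zeta>\<^sup>2"
    using n0 by (simp only: mult_le_cancel_left_pos)
  have "\<zeta>\<^sup>2 \<le> 1 / (128 * t)"
  proof -
    have "\<zeta>\<^sup>2 \<le> (1 / 1000)\<^sup>2" using \<zeta> by (intro power_mono) auto
    also have "\<dots> \<le> 1 / 128" by (simp add: power2_eq_square)
    also have "\<dots> \<le> 1 / (128 * t)" using t by (intro divide_left_mono) auto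
    finally show ?thesis .
  qed
  moreover have "1 / (64 * t) = 2 * (1 / (128 * t))" by simp
  \<comment> \<open>Half of 1 / (64 t) absorbs \<zeta>^2; the other half divided by 4 t is 1 / (512
    t^2), and t^2 = \<eta>.\<close>
  ultimately have "1 / (128 * t) \<le> 4 * t * E"
    using lower upper by linarith
  then have "1 / (128 * t) / (4 * t) \<le> 4 * t * E / (4 * t)"
    using t by (intro divide_right_mono) auto
  then have "1 / (512 * t\<^sup>2) \<le> E" using t(1) by (simp add: power2_eq_square)
  then show ?thesis unfolding t(2) E_def .
qed

end

section \<open>Transfer to an arbitrary disorder and conclusion\<close>

lemma sk_weight_cong:
  assumes "\<And>i j. (i, j) \<in> sk_pairs n \<Longrightarrow> w i j = w' i j"
  shows "sk_weight \<beta> n w = sk_weight \<beta> n w'"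
proof
  fix \<sigma>
  have "(\<Sum>(i, j) \<in> sk_pairs n. w i j * \<sigma> i * \<sigma> j) = (\<Sum>(i, j) \<in> sk_pairs n. w' i j * \<sigma> i * \<sigma> j)"
    by (rule sum.cong) (use assms in auto)
  then show "sk_weight \<beta> n w \<sigma> = sk_weight \<beta> n w' \<sigma>" by (simp add: sk_weight_def)
qed

lemma sk_cov_cong:
  assumes "\<And>i j. (i, j) \<in> sk_pairs n \<Longrightarrow> w i j = w' i j"
  shows "sk_cov \<beta> n w = sk_cov \<beta> n w'"
  by (intro ext) (simp add: sk_cov_def integral_sk_gibbs sk_partition_def sk_weight_cong[OF assms])

text \<open>Independence and the marginal densities determine the joint law of the couplings, so
  every realisation of the disorder gives the same expectation as the product Gaussian
  measure.\<close>

lemma expectation_sk_disorder: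
  fixes F :: "(nat \<times> nat \<Rightarrow> real) \<Rightarrow> real"
  assumes dis: "sk_disorder M n g" and n: "2 \<le> n"
    and F: "F \<in> borel_measurable (gauss_prod (sk_pairs n))"
  shows "(\<integral>w. F w \<partial>gauss_prod (sk_pairs n)) = (\<integral>\<omega>. F (\<lambda>p\<in>sk_pairs n. g (fst p) (snd p) \<omega>) \<partial>M)"
    (is "_ = (\<integral>\<omega>. F (?X \<omega>) \<partial>M)")
proof -
  let ?I = "sk_pairs n"
  interpret prob_space M using dis by (simp add: sk_disorder_def)
  define X where "X p = g (fst p) (snd p)" for p
  have gX: "(\<lambda>(i, j). g i j) = X" by (auto simp: X_def)
  have dist: "distributed M lborel (X p) (\<lambda>x. ennreal (std_normal_density x))" if "p \<in> ?I" for p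
    using dis that by (auto simp: sk_disorder_def X_def)
  have rv: "random_variable borel (X p)" if "p \<in> ?I" for p
    using distributed_measurable[OF dist[OF that]] by simp
  \<comment> \<open>The characterisation of independence by a product law is for a nonempty index
    set; this is where n \<ge> 2 enters.\<close>
  have "(1, 2) \<in> ?I" using n by (simp add: sk_pairs_def)
  then have ne: "?I \<noteq> {}" by blast
  have ind: "indep_vars (\<lambda>_. borel) X ?I" using dis by (simp add: sk_disorder_def gX)
  have "distr M (\<Pi>\<^sub>M p\<in>?I. borel) (\<lambda>\<omega>. \<lambda>p\<in>?I. X p \<omega>) = (\<Pi>\<^sub>M p\<in>?I. distr M borel (X p))"
    using indep_vars_iff_distr_eq_PiM'[OF ne rv] ind by simp
  also have "\<dots> = gauss_prod ?I"
  proof (rule PiM_cong)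
    fix p assume p: "p \<in> ?I"
    have "distr M borel (X p) = distr M lborel (X p)" by (rule distr_cong) simp_all
    then show "distr M borel (X p) = std_gauss"
      using distributed_distr_eq_density[OF dist[OF p]] by (simp add: std_gauss_def)
  qed simp
  finally have D: "distr M (\<Pi>\<^sub>M p\<in>?I. borel) (\<lambda>\<omega>. \<lambda>p\<in>?I. X p \<omega>) = gauss_prod ?I" .
  have meas: "(\<lambda>\<omega>. \<lambda>p\<in>?I. X p \<omega>) \<in> measurable M (\<Pi>\<^sub>M p\<in>?I. borel)"
    by (rule measurable_restrict) (rule rv)
  have F': "F \<in> borel_measurable (\<Pi>\<^sub>M p\<in>?I. borel)"
    using F measurable_cong_sets[OF sets_PiM_cong[OF refl, of ?I "\<lambda>_. std_gauss" "\<lambda>_. borel"] refl] by simp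
  have "(\<integral>w. F w \<partial>gauss_prod ?I) = (\<integral>\<omega>. F (\<lambda>p\<in>?I. X p \<omega>) \<partial>M)"
    unfolding D[symmetric] by (rule integral_distr[OF meas F'])
  then show ?thesis by (simp add: X_def)
qed

lemma expectation_op_norm_sk_cov_ge:
  assumes dis: "sk_disorder M n g" and n: "2 \<le> n" and eta: "0 < \<eta>" "\<eta> \<le> 1"
    and beta: "0 \<le> \<beta>" "0 \<le> 1 - \<beta>" "1 - \<beta> \<le> sqrt \<eta>" and large: "1000 \<le> n * \<eta> ^ 3"
  shows "1 / (512 * \<eta>) \<le> (\<integral>\<omega>. op_norm n (sk_cov \<beta> n (\<lambda>i j. g i j \<omega>)) \<partial>M)"
proof -
  interpret sk_model n \<beta> \<eta> using n eta by unfold_locales auto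
  have meas: "(\<lambda>w. op_norm n (gibbs_cov \<beta> n w)) \<in> borel_measurable (gauss_prod (sk_pairs n))"
    by (rule borel_measurable_gauss_prod_continuous[OF continuous_opn])
  have cov: "gibbs_cov \<beta> n (\<lambda>p\<in>sk_pairs n. g (fst p) (snd p) \<omega>) = sk_cov \<beta> n (\<lambda>i j. g i j \<omega>)" for \<omega>
    unfolding sk_cov_eq_gibbs_cov[symmetric] by (rule sk_cov_cong) simp
  show ?thesis
    using expectation_op_norm_lower_bound[OF eta(2) beta large]
    unfolding expectation_sk_disorder[OF dis n meas] cov .
qed

theorem proposition4p4:
  fixes f :: "nat \<Rightarrow> real"
  assumes "\<And>n. 0 \<le> f n"
    and "filterlim f at_top sequentially"
    and "f \<in> o(\<lambda>n. real n powr (1 / 3))"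
  shows "\<exists>\<beta> :: nat \<Rightarrow> real.
    (\<forall>n. 0 \<le> \<beta> n \<and> \<beta> n < 1) \<and> \<beta> \<longlonglongrightarrow> 1 \<and>
    (\<forall>\<^sub>F n in sequentially. \<forall>(M :: 'a measure) g. sk_disorder M n g \<longrightarrow>
       f n \<le> (\<integral>\<omega>. op_norm n (sk_cov (\<beta> n) n (\<lambda>i j. g i j \<omega>)) \<partial>M))"
proof (intro exI[of _ "\<lambda>n. 1 - 1 / real (Suc n)"] conjI allI)
  \<comment> \<open>The lower bound only asks 1 - \<beta> to be at most sqrt \<eta>, so the sequence
    can be chosen independently of \<open>f\<close>; \<open>Suc n\<close> makes it start at
    0.\<close>
  show "0 \<le> 1 - 1 / real (Suc n)" "1 - 1 / real (Suc n) < 1" for n by simp_all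
  show "(\<lambda>n. 1 - 1 / real (Suc n)) \<longlonglongrightarrow> 1"
    using tendsto_diff[OF tendsto_const LIMSEQ_inverse_real_of_nat, of 1] by (simp add: inverse_eq_divide)
  \<comment> \<open>5120 = 10 * 512: from (5120 f n)^3 \<le> n follows n \<eta>^3 = n / (512 f n)^3
    \<ge> 10^3, the hypothesis of the lower bound.\<close>
  have "\<forall>\<^sub>F n in sequentially. norm (f n) \<le> 1 / 5120 * norm (real n powr (1 / 3))"
    using assms(3) by (rule landau_o.smallD) simp
  moreover have "\<forall>\<^sub>F n in sequentially. 1 \<le> f n"
    using assms(2) by (simp add: filterlim_at_top)
  ultimately show "\<forall>\<^sub>F n in sequentially. \<forall>(M :: 'a measure) g. sk_disorder M n g \<longrightarrow>
      f n \<le> (\<integral>\<omega>. op_norm n (sk_cov (1 - 1 / real (Suc n)) n (\<lambda>i j. g i j \<omega>)) \<partial>M)"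
    using eventually_ge_at_top[of 2]
  proof eventually_elim
    case (elim n)
    define \<eta> where "\<eta> = 1 / (512 * f n)"
    have n0: "0 < real n" using elim by simp
    have fpos: "0 < f n" using elim by simp
    have "(5120 * f n) ^ 3 \<le> (real n powr (1 / 3)) ^ 3"
      using elim by (intro power_mono) auto
    also have "\<dots> = real n" using n0 by (simp flip: powr_realpow add: powr_powr)
    finally have large: "1000 \<le> n * \<eta> ^ 3"
      using fpos by (simp add: \<eta>_def field_simps)
    have eta: "0 < \<eta>" "\<eta> \<le> 1" using elim by (auto simp: \<eta>_def)
    \<comment> \<open>For \<eta> \<le> 1 the condition on n \<eta>^3 also gives n \<eta> \<ge> 1000,
      so 1 - \<beta> = 1 / (n + 1) lies below \<eta> and hence below sqrt \<eta>.\<close>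
    have "\<eta> ^ 3 \<le> \<eta>" using power_decreasing[of 1 3 \<eta>] eta by simp
    then have "1000 \<le> n * \<eta>" using large mult_left_mono[of "\<eta> ^ 3" \<eta> "real n"] by simp
    then have "1 / real (Suc n) \<le> \<eta>" using eta n0 by (simp add: field_simps)
    also have "\<eta> \<le> sqrt \<eta>"
      using eta mult_left_mono[of \<eta> 1 \<eta>] by (intro real_le_rsqrt) (simp add: power2_eq_square)
    finally have b: "1 - (1 - 1 / real (Suc n)) \<le> sqrt \<eta>" by simp
    have "f n \<le> (\<integral>\<omega>. op_norm n (sk_cov (1 - 1 / real (Suc n)) n (\<lambda>i j. g i j \<omega>)) \<partial>M)"
      if "sk_disorder M n g" for M :: "'a measure" and g
      using expectation_op_norm_sk_cov_ge[OF that _ eta _ _ b large] elim fpos by (simp add: \<eta>_def)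
    then show ?case by blast
  qed
qed

end
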